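(* Let $\phi\in\mathrm{Der}(\mathfrak{N},\mathcal{W})$ be $\mathbb{Z}$-homogeneous with $\phi(\mathfrak{N}_{[-1]}\oplus\mathfrak{N}_{[0]})=0$. Then there are $\lambda,\lambda_r^{(s_r)},\mu_r^{(s_r)},\eta_r^{(s_r)}\in\mathbb{F}$, where $r\in Y_0$ and $1\le s_r<t_r$, such that $\mu_r^{(s_r)}\eta_r^{(s_r)}=0$ and $$\phi=\lambda\,\mathrm{ad}\,\Gamma'+\sum_{r=1}^{2m}\sum_{s_r=1}^{t_r-1}\Big(\lambda_r^{(s_r)}\Phi_r^{(s_r)}+\mu_r^{(s_r)}\Theta_r^{(s_r)}+\eta_r^{(s_r)}(\mathrm{ad}\,\partial_r)^{p^{s_r}}\Big)$$ on $\mathfrak{N}$. In particular, if $n$ is odd then $\phi=\lambda\,\mathrm{ad}\,\Gamma'+\sum_{r=1}^{2m}\sum_{s_r=1}^{t_r-1}\eta_r^{(s_r)}(\mathrm{ad}\,\partial_r)^{p^{s_r}}$ for some $\lambda,\eta_r^{(s_r)}\in\mathbb{F}$.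
   Context: Let $\mathbb{F}$ be a field of characteristic $p>3$, and let $m>1$, $n>3$ be integers. Put $Y_0=\{1,\dots,2m\}$, $Y_1=\{2m+1,\dots,2m+n\}$, $Y=Y_0\cup Y_1$. Fix $\underline t=(t_1,\dots,t_{2m})$ with positive integer entries, $\pi_i=p^{t_i}-1$, $\pi=(\pi_1,\dots,\pi_{2m})$, $\mathbb{A}=\{\alpha\in\mathbb{N}_0^{2m}:\alpha_i\le\pi_i\}$, $|\alpha|=\sum\alpha_i$; $\varepsilon_i$ is the $i$-th unit vector. $\mathbb{B}_k$ is the set of strictly increasing $k$-tuples $u=\langle i_1,\dots,i_k\rangle$ in $Y_1$ (also viewed as subsets), $|u|=k$, $\mathbb{B}=\bigcup_{k=0}^n\mathbb{B}_k$, $\mathbb{B}^0=\{u\in\mathbb{B}: |u|\text{ even}\}$, $x^u=x_{i_1}\cdots x_{i_k}$, $x^{\emptyset}=1$, $\omega=\langle 2m+1,\dots,2m+n\rangle$ (so $|\omega|=n$). $\mathcal{O}=\mathcal{O}(2m,n;\underline t)$ is the associative superalgebra with basis $\{x^{(\alpha)}x^u:\alpha\in\mathbb{A},u\in\mathbb{B}\}$ and products $x^{(\alpha)}x^{(\beta)}=\prod_i\binom{\alpha_i+\beta_i}{\alpha_i}x^{(\alpha+\beta)}$ (zero if $\alpha+\beta\notin\mathbb{A}$), $x_kx_l=-x_lx_k$, $x_k^2=0$ for $k,l\in Y_1$, $x^{(\alpha)}x_k=x_kx^{(\alpha)}$; write $x_i=x^{(\varepsilon_i)}$ for $i\in Y_0$.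 The parity of $x^{(\alpha)}x^u$ is $|u|$ mod 2 and its $\mathbb{Z}$-degree is $|\alpha|+|u|$. The superderivations $\partial_i$ ($i\in Y$) are $\partial_i(x^{(\alpha)}x^u)=x^{(\alpha-\varepsilon_i)}x^u$ for $i\in Y_0$ (zero if $\alpha_i=0$), and $\partial_i(x^{(\alpha)}x^u)=x^{(\alpha)}\,\partial x^u/\partial x_i$ (left derivative) for $i\in Y_1$; $\mu(i)=\overline 0$ for $i\in Y_0$, $\mu(i)=\overline 1$ for $i\in Y_1$ is the parity of $\partial_i$. $W=\{\sum_{i\in Y}a_i\partial_i: a_i\in\mathcal{O}\}$ is the generalized Witt Lie superalgebra (an $\mathcal{O}$-module), with bracket $[a\partial_i,b\partial_j]=a\partial_i(b)\partial_j-(-1)^{\mathrm p(a\partial_i)\mathrm p(b\partial_j)}b\partial_j(a)\partial_i$, where $\mathrm p(a\partial_i)=\mathrm p(a)+\mu(i)$; $(\mathrm{ad}\,D)(x)=[D,x]$. It is $\mathbb{Z}$-graded: $W_{[k]}$ is spanned by $f\partial_s$ with $f$ homogeneous of degree $k+1$. $\mathcal{W}$ is the even part of $W$, with the induced $\mathbb{Z}$-grading. For $i\in Y_0$: $i'=i+m$, $\tau(i)=1$ if $i\le m$; $i'=i-m$, $\tau(i)=-1$ if $m<i\le 2m$; for $i\in Y_1$: $i'=i$, $\tau(i)=1$. Define the linear map $\mathrm{D_H}:\mathcal{O}\to W$ by $\mathrm{D_H}(a)=\sum_{i\in Y}\tau(i)(-1)^{\mu(i)\mathrm p(a)}\partial_i(a)\partial_{i'}$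 for homogeneous $a$; its kernel is $\mathbb{F}1$. Let $$\mathcal{H}=\mathrm{span}_{\mathbb{F}}\{\mathrm{D_H}(x^{(\alpha)}x^u):\alpha\in\mathbb{A},u\in\mathbb{B}^0,(\alpha,u)\ne(\pi,\omega)\},$$ $$\mathfrak{N}=\mathrm{span}_{\mathbb{F}}\{\mathrm{D_H}(x^{(\alpha)}x^u):\alpha\in\mathbb{A},u\in\mathbb{B}^0,(\alpha,u)\ne(\pi,\omega),(\alpha,u)\ne(\pi,\emptyset)\},$$ $\mathbb{Z}$-graded Lie subalgebras of $\mathcal{W}$ ($\mathrm{D_H}(x^{(\alpha)}x^u)$ has degree $|\alpha|+|u|-2$; $[k]$ denotes the degree-$k$ component). $\mathrm{Der}(\mathfrak{N},\mathcal{W})$ is the space of linear maps $D:\mathfrak{N}\to\mathcal{W}$ with $D([x,y])=[x,D(y)]-[y,D(x)]$; $D$ is homogeneous of degree $\mathrm{zd}(D)=k$ if $D(\mathfrak{N}_{[i]})\subset\mathcal{W}_{[i+k]}$ for all $i$. Put $\Gamma'=\sum_{r\in Y_1}x_r\partial_r$. For $r\in Y_0$ and a positive integer $q$, define linear maps $\mathcal{H}\to W$ by $\Phi_r^{(q)}(\mathrm{D_H}(f))=\partial_r^{p^q}(f)\,\mathrm{D_H}(x^{\omega})$ and $\Theta_r^{(q)}(\mathrm{D_H}(f))=x^{\omega}(\mathrm{ad}\,\partial_r)^{p^q}(\mathrm{D_H}(f))$, for $f$ in the span of the $x^{(\alpha)}x^u$ with $\alpha\in\mathbb{A}$, $u\in\mathbb{B}^0$,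 $(\alpha,u)\neq(\pi,\omega)$ (for $n$ even these take values in $\mathcal{W}$). In the claim they are restricted to $\mathfrak{N}$. *)

theory Defs
  imports Complex_Main "HOL-Library.Function_Algebras"
begin

text \<open>
  An element of the superalgebra O is its family of coefficients: the value at
  \<open>(\<alpha>, u)\<close> is the coefficient of \<open>x\<^sup>(\<^sup>\<alpha>\<^sup>) x\<^sup>u\<close>.  An element of W is the family of its
  coefficients in O: \<open>D\<close> stands for \<open>\<Sum>i\<in>Y. D i \<partial>\<^sub>i\<close> (W is a free O-module on the \<open>\<partial>\<^sub>i\<close>).
\<close>

type_synonym 'a sup = "(nat \<Rightarrow> nat) \<times> nat set \<Rightarrow> 'a"
type_synonym 'a witt = "nat \<Rightarrow> 'a sup"

definition oscale :: "'a::field \<Rightarrow> 'a sup \<Rightarrow> 'a sup"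
  where "oscale c f = (\<lambda>b. c * f b)"

definition wscale :: "'a::field \<Rightarrow> 'a witt \<Rightarrow> 'a witt"
  where "wscale c D = (\<lambda>i. oscale c (D i))"

interpretation ovec: vector_space oscale
  by unfold_locales (auto simp: oscale_def fun_eq_iff algebra_simps)

interpretation wvec: vector_space wscale
  by unfold_locales (auto simp: wscale_def oscale_def fun_eq_iff algebra_simps)

definition xmon :: "(nat \<Rightarrow> nat) \<Rightarrow> nat set \<Rightarrow> 'a::field sup"
  where "xmon \<alpha> u = (\<lambda>b. if b = (\<alpha>, u) then 1 else 0)"

text \<open>\<open>vf a i\<close> is \<open>a \<partial>\<^sub>i\<close>.\<close>
definition vf :: "'a::field sup \<Rightarrow> nat \<Rightarrow> 'a witt"
  where "vf a i = (\<lambda>j. if j = i then a else 0)"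

text \<open>The component of parity \<open>s\<close>, where \<open>s \<in> {0, 1}\<close>.\<close>
definition ppart :: "nat \<Rightarrow> 'a::field sup \<Rightarrow> 'a sup"
  where "ppart s f = (\<lambda>(\<alpha>, u). if card u mod 2 = s then f (\<alpha>, u) else 0)"

text \<open>
  The sign in \<open>x\<^sup>u x\<^sup>v = reord_sign u v \<cdot> x\<^bsup>u \<union> v\<^esup>\<close> for disjoint \<open>u\<close> and \<open>v\<close>: it counts
  the transpositions needed to sort the concatenation of the increasing tuples
  \<open>u\<close> and \<open>v\<close>.
\<close>
definition reord_sign :: "nat set \<Rightarrow> nat set \<Rightarrow> 'a::field"
  where "reord_sign u v = (-1) ^ card {(k, l). k \<in> u \<and> l \<in> v \<and> l < k}"

locale ham =
  fixes p m n :: nat and t :: "nat \<Rightarrow> nat"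
begin

definition Y0 :: "nat set" where "Y0 = {1..2*m}"
definition Y1 :: "nat set" where "Y1 = {2*m+1..2*m+n}"
definition Y :: "nat set" where "Y = Y0 \<union> Y1"

definition \<mu> :: "nat \<Rightarrow> nat"
  where "\<mu> i = (if i \<in> Y1 then 1 else 0)"

definition \<tau> :: "nat \<Rightarrow> 'a::field"
  where "\<tau> i = (if m < i \<and> i \<le> 2*m then -1 else 1)"

definition prm :: "nat \<Rightarrow> nat"
  where "prm i = (if i \<le> m then i + m else if i \<le> 2*m then i - m else i)"

text \<open>Multi-indices are functions on \<open>nat\<close> vanishing outside \<open>Y0\<close>.\<close>
definition \<pi> :: "nat \<Rightarrow> nat"
  where "\<pi> i = (if i \<in> Y0 then p ^ t i - 1 else 0)"

definition A :: "(nat \<Rightarrow> nat) set"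
  where "A = {\<alpha>. \<forall>i. \<alpha> i \<le> \<pi> i}"

text \<open>The increasing tuples in \<open>Y1\<close> are identified with their sets of entries.\<close>
definition B :: "nat set set"
  where "B = Pow Y1"

definition B0 :: "nat set set"
  where "B0 = {u \<in> B. even (card u)}"

definition \<omega> :: "nat set"
  where "\<omega> = Y1"

lemma finite_A: "finite A"
proof -
  have "A \<subseteq> {f. \<forall>x. (x \<in> Y0 \<longrightarrow> f x \<in> {..Max (\<pi> ` Y0)}) \<and> (x \<notin> Y0 \<longrightarrow> f x = 0)}"
  proof
    fix \<alpha> assume "\<alpha> \<in> A"
    then have le: "\<alpha> i \<le> \<pi> i" for i by (auto simp: A_def)
    have "\<alpha> x \<le> Max (\<pi> ` Y0)" if "x \<in> Y0" for x
      using le[of x] that by (intro order.trans[OF le] Max_ge) (auto simp: Y0_def)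
    moreover have "\<alpha> x = 0" if "x \<notin> Y0" for x
      using le[of x] that by (auto simp: \<pi>_def)
    ultimately show "\<alpha> \<in> {f. \<forall>x. (x \<in> Y0 \<longrightarrow> f x \<in> {..Max (\<pi> ` Y0)}) \<and> (x \<notin> Y0 \<longrightarrow> f x = 0)}"
      by auto
  qed
  moreover have "finite {f :: nat \<Rightarrow> nat. \<forall>x. (x \<in> Y0 \<longrightarrow> f x \<in> {..Max (\<pi> ` Y0)}) \<and> (x \<notin> Y0 \<longrightarrow> f x = 0)}"
    by (rule finite_set_of_finite_funs) (auto simp: Y0_def)
  ultimately show ?thesis by (rule finite_subset)
qed

lemma finite_B: "finite B"
  by (simp add: B_def Y1_def)

definition O_set :: "'a::field sup set"
  where "O_set = ovec.span {xmon \<alpha> u |\<alpha> u. \<alpha> \<in> A \<and> u \<in> B}"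

definition xmon_mult :: "(nat \<Rightarrow> nat) \<Rightarrow> nat set \<Rightarrow> (nat \<Rightarrow> nat) \<Rightarrow> nat set \<Rightarrow> 'a::field sup"
  where "xmon_mult \<alpha> u \<beta> v =
    (if (\<lambda>i. \<alpha> i + \<beta> i) \<in> A \<and> u \<inter> v = {}
     then oscale (of_nat (\<Prod>i\<in>Y0. (\<alpha> i + \<beta> i) choose \<alpha> i) * reord_sign u v)
            (xmon (\<lambda>i. \<alpha> i + \<beta> i) (u \<union> v))
     else 0)"

definition omult :: "'a::field sup \<Rightarrow> 'a sup \<Rightarrow> 'a sup"  (infixl \<open>\<star>\<close> 70)
  where "f \<star> g = (\<Sum>(\<alpha>, u)\<in>A \<times> B. \<Sum>(\<beta>, v)\<in>A \<times> B.
           oscale (f (\<alpha>, u) * g (\<beta>, v)) (xmon_mult \<alpha> u \<beta> v))"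

definition xmon_der :: "nat \<Rightarrow> (nat \<Rightarrow> nat) \<Rightarrow> nat set \<Rightarrow> 'a::field sup"
  where "xmon_der i \<alpha> u =
    (if i \<in> Y0 then (if \<alpha> i = 0 then 0 else xmon (\<alpha>(i := \<alpha> i - 1)) u)
     else if i \<in> u then oscale ((-1) ^ card {k \<in> u. k < i}) (xmon \<alpha> (u - {i}))
     else 0)"

definition der :: "nat \<Rightarrow> 'a::field sup \<Rightarrow> 'a sup"
  where "der i f = (\<Sum>(\<alpha>, u)\<in>A \<times> B. oscale (f (\<alpha>, u)) (xmon_der i \<alpha> u))"

definition O_deg :: "int \<Rightarrow> 'a::field sup set"
  where "O_deg k = ovec.span {xmon \<alpha> u |\<alpha> u. \<alpha> \<in> A \<and> u \<in> B \<and> int (sum \<alpha> Y0 + card u) = k}"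

definition O_par :: "nat \<Rightarrow> 'a::field sup set"
  where "O_par s = ovec.span {xmon \<alpha> u |\<alpha> u. \<alpha> \<in> A \<and> u \<in> B \<and> card u mod 2 = s}"

definition W :: "'a::field witt set"
  where "W = {D. (\<forall>i\<in>Y. D i \<in> O_set) \<and> (\<forall>i. i \<notin> Y \<longrightarrow> D i = 0)}"

text \<open>\<open>wmod f D\<close> is the module action \<open>f D\<close> of O on W.\<close>
definition wmod :: "'a::field sup \<Rightarrow> 'a witt \<Rightarrow> 'a witt"
  where "wmod f D = (\<lambda>i. f \<star> D i)"

text \<open>
  The sign in the bracket only makes sense for homogeneous coefficients, so the
  coefficients are first decomposed into their even and odd parts.
\<close>
definition bracket :: "'a::field witt \<Rightarrow> 'a witt \<Rightarrow> 'a witt"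
  where "bracket D E =
    (\<Sum>i\<in>Y. \<Sum>j\<in>Y. \<Sum>r\<in>{0, 1}. \<Sum>s\<in>{0, 1}.
       vf (ppart r (D i) \<star> der i (ppart s (E j))) j
       - wscale ((-1) ^ ((r + \<mu> i) * (s + \<mu> j))) (vf (ppart s (E j) \<star> der j (ppart r (D i))) i))"

definition ad :: "'a::field witt \<Rightarrow> 'a witt \<Rightarrow> 'a witt"
  where "ad D = (\<lambda>E. bracket D E)"

definition W_deg :: "int \<Rightarrow> 'a::field witt set"
  where "W_deg k = wvec.span {vf f s |f s. s \<in> Y \<and> f \<in> O_deg (k + 1)}"

text \<open>The superderivation \<open>a \<partial>\<^sub>i\<close> is even iff \<open>a\<close> and \<open>\<partial>\<^sub>i\<close> have the same parity.\<close>
definition W_even :: "'a::field witt set"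
  where "W_even = {D \<in> W. \<forall>i\<in>Y. D i \<in> O_par (\<mu> i)}"

definition D\<^sub>H :: "'a::field sup \<Rightarrow> 'a witt"
  where "D\<^sub>H a = (\<Sum>s\<in>{0, 1}. \<Sum>i\<in>Y.
           wscale (\<tau> i * (-1) ^ (\<mu> i * s)) (vf (der i (ppart s a)) (prm i)))"

definition H_monos :: "'a::field sup set"
  where "H_monos = {xmon \<alpha> u |\<alpha> u. \<alpha> \<in> A \<and> u \<in> B0 \<and> (\<alpha>, u) \<noteq> (\<pi>, \<omega>)}"

definition N_monos :: "'a::field sup set"
  where "N_monos = {xmon \<alpha> u |\<alpha> u. \<alpha> \<in> A \<and> u \<in> B0 \<and> (\<alpha>, u) \<noteq> (\<pi>, \<omega>) \<and> (\<alpha>, u) \<noteq> (\<pi>, {})}"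

definition H :: "'a::field witt set"
  where "H = wvec.span (D\<^sub>H ` H_monos)"

definition N :: "'a::field witt set"
  where "N = wvec.span (D\<^sub>H ` N_monos)"

definition N_deg :: "int \<Rightarrow> 'a::field witt set"
  where "N_deg k = N \<inter> W_deg k"

definition W_even_deg :: "int \<Rightarrow> 'a::field witt set"
  where "W_even_deg k = W_even \<inter> W_deg k"

text \<open>Linear maps from \<open>N\<close> are total functions of which only the values on \<open>N\<close> matter.\<close>
definition Der :: "('a::field witt \<Rightarrow> 'a witt) set"
  where "Der = {\<phi>. (\<forall>x\<in>N. \<phi> x \<in> W_even)
    \<and> (\<forall>x\<in>N. \<forall>y\<in>N. \<phi> (x + y) = \<phi> x + \<phi> y)
    \<and> (\<forall>c. \<forall>x\<in>N. \<phi> (wscale c x) = wscale c (\<phi> x))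
    \<and> (\<forall>x\<in>N. \<forall>y\<in>N. \<phi> (bracket x y) = bracket x (\<phi> y) - bracket y (\<phi> x))}"

definition homogeneous_of_degree :: "('a::field witt \<Rightarrow> 'a witt) \<Rightarrow> int \<Rightarrow> bool"
  where "homogeneous_of_degree \<phi> k \<longleftrightarrow> (\<forall>i. \<phi> ` N_deg i \<subseteq> W_even_deg (i + k))"

definition \<Gamma>' :: "'a::field witt"
  where "\<Gamma>' = (\<Sum>r\<in>Y1. vf (xmon (\<lambda>_. 0) {r}) r)"

text \<open>\<open>pd r\<close> is \<open>\<partial>\<^sub>r\<close> in W.\<close>
definition pd :: "nat \<Rightarrow> 'a::field witt"
  where "pd r = vf (xmon (\<lambda>_. 0) {}) r"

definition x\<omega> :: "'a::field sup"
  where "x\<omega> = xmon (\<lambda>_. 0) \<omega>"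

text \<open>
  \<open>\<Phi> r q\<close> sends \<open>D\<^sub>H f\<close> to \<open>\<partial>\<^sub>r\<^bsup>p^q\<^esup>(f) D\<^sub>H(x\<^sup>\<omega>)\<close>.  On \<open>H\<close> it picks some
  preimage \<open>f\<close> of its argument; lemma \<open>\<Phi>_D\<^sub>H\<close> below says that the choice is irrelevant.
\<close>
definition \<Phi> :: "nat \<Rightarrow> nat \<Rightarrow> 'a::field witt \<Rightarrow> 'a witt"
  where "\<Phi> r q x = wmod ((der r ^^ (p ^ q)) (inv_into (ovec.span H_monos) D\<^sub>H x)) (D\<^sub>H x\<omega>)"

definition \<Theta> :: "nat \<Rightarrow> nat \<Rightarrow> 'a::field witt \<Rightarrow> 'a witt"
  where "\<Theta> r q x = wmod x\<omega> ((ad (pd r) ^^ (p ^ q)) x)"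

lemma der_add: "der i (f + g) = der i f + der i g"
  by (auto simp: der_def case_prod_unfold ovec.scale_left_distrib sum.distrib)

lemma ppart_sum: "ppart 0 f + ppart 1 f = f"
  by (auto simp: ppart_def fun_eq_iff)

lemma D\<^sub>H_coeff:
  assumes "r \<in> Y0"
  shows "D\<^sub>H f (prm r) = oscale (\<tau> r) (der r f)"
proof -
  have inj: "i = r" if "i \<in> Y" "prm i = prm r" for i
    using that assms by (auto simp: Y_def Y0_def Y1_def prm_def split: if_splits)
  have mu: "\<mu> r = 0" using assms by (auto simp: \<mu>_def Y0_def Y1_def)
  have rY: "r \<in> Y" "finite Y" using assms by (auto simp: Y_def Y0_def Y1_def)
  have 1: "(\<Sum>i\<in>Y. wscale (\<tau> i * (-1) ^ (\<mu> i * s)) (vf (der i (ppart s f)) (prm i))) (prm r)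
      = oscale (\<tau> r) (der r (ppart s f))" for s
  proof -
    have app: "(\<Sum>i\<in>S. F i) k = (\<Sum>i\<in>S. F i k)" for F :: "nat \<Rightarrow> 'a witt" and k S
      by (induction S rule: infinite_finite_induct) auto
    have "(\<Sum>i\<in>Y. wscale (\<tau> i * (-1) ^ (\<mu> i * s)) (vf (der i (ppart s f)) (prm i)) (prm r))
      = (\<Sum>i\<in>Y. if i = r then oscale (\<tau> r) (der r (ppart s f)) else 0)"
      by (rule sum.cong) (auto simp: wscale_def vf_def mu dest: inj)
    then show ?thesis unfolding app using rY by simp
  qed
  have "D\<^sub>H f (prm r) = oscale (\<tau> r) (der r (ppart 0 f)) + oscale (\<tau> r) (der r (ppart 1 f))"
    unfolding D\<^sub>H_def using 1[of 0] 1[of 1] by simp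
  also have "\<dots> = oscale (\<tau> r) (der r (ppart 0 f + ppart 1 f))"
    by (simp only: der_add ovec.scale_right_distrib)
  finally show ?thesis by (simp only: ppart_sum)
qed

lemma \<Phi>_D\<^sub>H:
  fixes f :: "'a::field sup"
  assumes "p > 0" "r \<in> Y0" "f \<in> ovec.span H_monos"
  shows "\<Phi> r q (D\<^sub>H f) = wmod ((der r ^^ (p ^ q)) f) (D\<^sub>H x\<omega>)"
proof -
  let ?g = "inv_into (ovec.span H_monos) D\<^sub>H (D\<^sub>H f)"
  have "D\<^sub>H ?g = D\<^sub>H f" by (rule f_inv_into_f[OF imageI[OF assms(3)]])
  then have "oscale (\<tau> r) (der r ?g) = oscale (\<tau> r) (der r f)"
    using D\<^sub>H_coeff[OF assms(2)] by metis
  moreover have "\<tau> r \<noteq> (0::'a)" by (auto simp: \<tau>_def)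
  ultimately have eq: "der r ?g = der r f" by simp
  obtain k where "p ^ q = Suc k" using assms(1) by (metis gr0_implies_Suc zero_less_power)
  then show ?thesis by (simp add: \<Phi>_def funpow_swap1 eq funpow_Suc_right del: funpow.simps)
qed

end

end

theory Submission
  imports Defs "HOL-Computational_Algebra.Primes"
begin

text \<open>
  Since \<open>\<phi>\<close> commutes with the \<open>\<partial>\<^sub>i\<close>, \<open>i \<in> Y0\<close>, it is determined by the constant terms in the even
  variables, \<open>c(\<alpha>, u)\<close>, of \<open>\<phi> (D\<^sub>H (x\<^sup>(\<^sup>\<alpha>\<^sup>) x\<^sup>u))\<close>. If \<open>f\<close> and \<open>g\<close> have degree at least 3 in the even
  variables, then \<open>\<phi> [D\<^sub>H f, D\<^sub>H g]\<close> has zero constant term; together with the equivariance under the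
  \<open>D\<^sub>H (x\<^sub>a x\<^sub>b)\<close>, \<open>a, b \<in> Y0\<close>, this leaves \<open>c(\<alpha>, u) \<noteq> 0\<close> only for \<open>\<alpha> = \<delta>\<close> and \<open>\<alpha> = \<delta> + \<epsilon>\<^sub>l\<close>, where
  \<open>\<delta> = 0\<close> or \<open>\<delta> = p\<^sup>s \<epsilon>\<^sub>r\<close> with \<open>s \<ge> 1\<close>. Moreover \<open>c(\<delta>, u)\<close> is a superderivation \<open>g(u)\<close> of the
  Grassmann algebra, and \<open>c(\<delta> + \<epsilon>\<^sub>l, u) = \<tau> l e(u) \<partial>\<^bsub>l'\<^esub>\<close> with \<open>e(u)\<close> in the Grassmann algebra.

  For \<open>\<delta> = p\<^sup>s \<epsilon>\<^sub>r\<close>, brackets with \<open>D\<^sub>H (x\<^sub>i x\<^sup>u)\<close> give \<open>e(u) = x\<^sup>u e\<close> and \<open>g(u) = x\<^sup>u g + e D\<^sub>H (x\<^sup>u)\<close>, where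
  \<open>e = e({})\<close> and \<open>g = g({})\<close>. Brackets with \<open>D\<^sub>H (x\<^sup>u)\<close>, \<open>|u| \<in> {2, 4}\<close>, show that \<open>e\<close> and \<open>g\<close> are
  invariant, hence \<open>e \<in> \<langle>1, x\<^sup>\<omega>\<rangle>\<close> and \<open>g \<in> \<langle>D\<^sub>H (x\<^sup>\<omega>)\<rangle>\<close>; these are the coefficients \<open>\<eta>\<close>, \<open>\<mu>\<close> and
  \<open>\<lambda>\<^sub>r\<close>, and \<open>\<mu> \<eta> = 0\<close> since \<open>\<phi>\<close> is homogeneous. For \<open>\<delta> = 0\<close> the map \<open>e\<close> is a derivation-like
  function of \<open>u\<close> commuting with rotations, so that \<open>e(u) = \<lambda> |u| x\<^sup>u\<close>, which is the action of \<open>\<lambda> \<Gamma>'\<close>.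
\<close>

text \<open>Up to sign \<partial>_i is \<open>D\<^sub>H\<close> of the linear monomial x_{i'}, which
  has degree -1, so \<phi> kills it; this is why \<phi> commutes with \<partial>_i. Likewise \<phi>
  kills \<open>D\<^sub>H\<close> of quadratic monomials, and these act linearly on constant terms.
  The obstacle to discarding exponents is the characteristic: writing x^(\<gamma>) as a bracket of
  x_a^(k+1) with another monomial costs the factor (\<gamma>_a choose k), which must be nonzero
  modulo p. Lucas' congruence supplies a suitable k = p^s unless the p-divisible part of \<gamma> is
  0 or a single p^s \<epsilon>_r, and exactly these exponents survive. A second obstacle is the
  truncation: the other monomial needs one more x_{a'}, so exponents that are maximal at a' require
  other brackets, and \<pi> itself requires an odd contraction. Finally, \<mu> and \<eta> are up to
  sign the coefficients of x^\<omega> and 1 in one component of one value of \<phi>, and these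
  monomials have the different degrees n and 0.\<close>

section \<open>Signs from reordering exterior monomials\<close>

lemma neg_one_power_sq: "(-1) ^ k * (-1) ^ k = (1::'a::comm_ring_1)"
  by (simp flip: power_mult_distrib)

lemma reord_sign_empty [simp]: "reord_sign {} v = 1" "reord_sign u {} = 1"
  by (simp_all add: reord_sign_def)

lemma reord_sign_sq: "reord_sign u v * reord_sign u v = (1::'a::field)"
  by (simp add: reord_sign_def neg_one_power_sq)

lemma reord_sign_sq': "reord_sign u v * (reord_sign u v * x) = (x::'a::field)"
  by (simp add: reord_sign_sq flip: mult.assoc)

lemma reord_sign_nonzero [simp]: "reord_sign u v \<noteq> (0::'a::field)"
  by (simp add: reord_sign_def)

lemma reord_sign_finite:
  assumes "finite u" "finite v"
  shows "finite {(k, l). k \<in> u \<and> l \<in> v \<and> l < k}"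
  by (rule finite_subset[of _ "u \<times> v"]) (use assms in auto)

lemma reord_sign_union_left:
  assumes "finite u" "finite u'" "finite v" "u \<inter> u' = {}"
  shows "reord_sign (u \<union> u') v = (reord_sign u v * reord_sign u' v :: 'a::field)"
proof -
  have "{(k, l). k \<in> u \<union> u' \<and> l \<in> v \<and> l < k} =
      {(k, l). k \<in> u \<and> l \<in> v \<and> l < k} \<union> {(k, l). k \<in> u' \<and> l \<in> v \<and> l < k}" by auto
  then have "card {(k, l). k \<in> u \<union> u' \<and> l \<in> v \<and> l < k} =
      card {(k, l). k \<in> u \<and> l \<in> v \<and> l < k} + card {(k, l). k \<in> u' \<and> l \<in> v \<and> l < k}"
    using assms by (simp only:) (rule card_Un_disjoint; auto intro!: reord_sign_finite)
  then show ?thesis by (simp add: reord_sign_def power_add)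
qed

lemma reord_sign_union_right:
  assumes "finite u" "finite v" "finite v'" "v \<inter> v' = {}"
  shows "reord_sign u (v \<union> v') = (reord_sign u v * reord_sign u v' :: 'a::field)"
proof -
  have "{(k, l). k \<in> u \<and> l \<in> v \<union> v' \<and> l < k} =
      {(k, l). k \<in> u \<and> l \<in> v \<and> l < k} \<union> {(k, l). k \<in> u \<and> l \<in> v' \<and> l < k}" by auto
  then have "card {(k, l). k \<in> u \<and> l \<in> v \<union> v' \<and> l < k} =
      card {(k, l). k \<in> u \<and> l \<in> v \<and> l < k} + card {(k, l). k \<in> u \<and> l \<in> v' \<and> l < k}"
    using assms by (simp only:) (rule card_Un_disjoint; auto intro!: reord_sign_finite)
  then show ?thesis by (simp add: reord_sign_def power_add)
qed

text \<open>The inversions counted for \<open>(u, v)\<close> and the swapped inversions for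
  \<open>(v, u)\<close> partition \<open>u \<times> v\<close>, because the sets share no
  entry.\<close>

lemma reord_sign_commute:
  assumes "finite u" "finite v" "u \<inter> v = {}"
  shows "reord_sign v u = ((-1) ^ (card u * card v) * reord_sign u v :: 'a::field)"
proof -
  let ?P = "{(k, l). k \<in> u \<and> l \<in> v \<and> l < k}"
  let ?Q = "{(k, l). k \<in> v \<and> l \<in> u \<and> l < k}"
  have fin: "finite ?P" "finite ?Q" using assms by (auto intro: reord_sign_finite)
  have Q: "card ?Q = card (prod.swap ` ?Q)" by (simp add: card_image)
  have "u \<times> v = ?P \<union> prod.swap ` ?Q"
    using assms(3) by (auto simp: image_iff)
  moreover have "?P \<inter> prod.swap ` ?Q = {}" by auto
  ultimately have "card u * card v = card ?P + card ?Q"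
    unfolding Q using card_Un_disjoint[OF fin(1) finite_imageI[OF fin(2)]]
    by (simp flip: card_cartesian_product)
  then have "(-1) ^ (card u * card v) = ((-1) ^ card ?P * (-1) ^ card ?Q :: 'a)"
    by (simp only: power_add)
  then show ?thesis
    unfolding reord_sign_def using neg_one_power_sq[of "card ?P", where 'a = 'a]
    by (simp add: mult.assoc mult.left_commute)
qed

lemma reord_sign_single_left: "reord_sign {k} v = ((-1) ^ card {l \<in> v. l < k} :: 'a::field)"
proof -
  have "{(k', l). k' \<in> {k} \<and> l \<in> v \<and> l < k'} = Pair k ` {l \<in> v. l < k}" by auto
  then show ?thesis by (simp add: reord_sign_def card_image inj_on_def)
qed

text \<open>The inequality in the count is strict, so \<open>k\<close> never counts against
  itself.\<close>

lemma reord_sign_single_diff: "reord_sign {k} (v - {k}) = (reord_sign {k} v :: 'a::field)"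
  unfolding reord_sign_single_left by (rule arg_cong[where f = "\<lambda>s. (-1) ^ card s"]) auto

lemma reord_sign_insert_right:
  assumes "finite u" "finite v" "k \<notin> v"
  shows "reord_sign u (insert k v) = (reord_sign u {k} * reord_sign u v :: 'a::field)"
  using reord_sign_union_right[of u "{k}" v] assms by simp

lemma reord_sign_insert_left:
  assumes "finite u" "finite v" "k \<notin> u"
  shows "reord_sign (insert k u) v = (reord_sign {k} v * reord_sign u v :: 'a::field)"
  using reord_sign_union_left[of "{k}" u v] assms by simp

lemma reord_sign_less:
  assumes "\<And>k l. k \<in> u \<Longrightarrow> l \<in> v \<Longrightarrow> k < l"
  shows "reord_sign u v = (1 :: 'a::field)"
proof -
  have "{(k, l). k \<in> u \<and> l \<in> v \<and> l < k} = {}" using assms by fastforce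
  then show ?thesis unfolding reord_sign_def by (metis card.empty power_0)
qed

section \<open>Pointwise operations and binomial coefficients modulo p\<close>

definition eps :: "nat \<Rightarrow> nat \<Rightarrow> nat"
  where "eps i = (\<lambda>j. if j = i then 1 else 0)"

lemma sum_fun_apply: "(\<Sum>i\<in>S. F i) x = (\<Sum>i\<in>S. F i x)"
  by (induction S rule: infinite_finite_induct) auto

lemma oscale_apply [simp]: "oscale c f b = c * f b"
  by (simp add: oscale_def)

lemma wscale_apply [simp]: "wscale c D i = oscale c (D i)"
  by (simp add: wscale_def)

text \<open>By j (p^s choose j) = p^s (p^s - 1 choose j - 1): if p did not divide the binomial
  coefficient, p^s would divide the smaller number j.\<close>

lemma prime_dvd_choose_prime_power:
  assumes "prime (p::nat)" "0 < j" "j < p ^ s"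
  shows "p dvd (p ^ s choose j)"
proof (rule ccontr)
  assume nd: "\<not> p dvd (p ^ s choose j)"
  obtain q i where qi: "p ^ s = Suc q" "j = Suc i" using assms(2,3) by (metis less_nat_zero_code not0_implies_Suc)
  have "j * (p ^ s choose j) = p ^ s * (q choose i)"
    unfolding qi by (rule Suc_times_binomial)
  then have "p ^ s dvd j * (p ^ s choose j)" by simp
  moreover have "coprime (p ^ s) (p ^ s choose j)"
    using nd assms(1) prime_imp_coprime[of p] coprime_power_left_iff by blast
  ultimately have "p ^ s dvd j" by (simp add: coprime_dvd_mult_left_iff)
  then show False using assms by (auto dest: dvd_imp_le)
qed

text \<open>A case of Lucas' congruence: (N choose p^s) is N div p^s modulo p, and this quotient
  lies strictly between 0 and p. By Vandermonde, raising the top by p^s raises the value by 1, since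
  the inner binomial coefficients of p^s vanish.\<close>

lemma binomial_prime_power_neq_0:
  assumes "prime p" "CHAR('a::field) = p" "p ^ s \<le> N" "N < p ^ Suc s"
  shows "of_nat (N choose (p ^ s)) \<noteq> (0::'a)"
proof -
  have p0: "p ^ s > 0" using assms(1) prime_gt_0_nat by simp
  have zero: "of_nat (p ^ s choose j) = (0::'a)" if j: "0 < j" "j < p ^ s" for j
    using prime_dvd_choose_prime_power[OF assms(1) j] assms(2) by (simp add: of_nat_eq_0_iff_char_dvd)
  have step: "of_nat ((M + p ^ s) choose (p ^ s)) = (of_nat (M choose p ^ s) + 1 :: 'a)" for M
  proof -
    have "of_nat ((M + p ^ s) choose (p ^ s)) =
        (\<Sum>k\<le>p ^ s. of_nat (M choose k) * of_nat (p ^ s choose (p ^ s - k)) :: 'a)"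
      by (subst vandermonde[symmetric]) simp
    also have "\<dots> = (\<Sum>k\<in>{0, p ^ s}. of_nat (M choose k) * of_nat (p ^ s choose (p ^ s - k)) :: 'a)"
      by (rule sum.mono_neutral_right) (auto intro!: zero)
    also have "\<dots> = of_nat (M choose p ^ s) + 1" using p0 by simp
    finally show ?thesis .
  qed
  have "of_nat ((M + k * p ^ s) choose (p ^ s)) = (of_nat (M choose p ^ s) + of_nat k :: 'a)" for M k
  proof (induction k)
    case (Suc k)
    have "M + Suc k * p ^ s = (M + k * p ^ s) + p ^ s" by simp
    then show ?case by (simp only: step Suc) simp
  qed simp
  from this[of "N mod p ^ s" "N div p ^ s"]
  have "of_nat (N choose (p ^ s)) = (of_nat (N div p ^ s) :: 'a)"
    unfolding mod_div_mult_eq[of N "p ^ s"] using p0 by (simp add: binomial_eq_0)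
  moreover have "\<not> p dvd N div p ^ s"
  proof
    assume "p dvd N div p ^ s"
    moreover have "N div p ^ s < p" using assms(4) p0 by (simp add: less_mult_imp_div_less)
    moreover have "N div p ^ s > 0" using assms(3) p0 by (simp add: div_greater_zero_iff)
    ultimately show False by (auto dest: dvd_imp_le)
  qed
  ultimately show ?thesis using assms(2) by (simp add: of_nat_eq_0_iff_char_dvd)
qed

section \<open>Index sets, and subspaces described by coefficients\<close>

context ham
begin

lemma finite_Y [simp]: "finite Y0" "finite Y1" "finite Y"
  by (auto simp: Y0_def Y1_def Y_def)

lemma Y_disjoint: "i \<in> Y0 \<Longrightarrow> i \<notin> Y1" "i \<in> Y1 \<Longrightarrow> i \<notin> Y0"
  by (auto simp: Y0_def Y1_def)

lemma Y_cases: "i \<in> Y \<longleftrightarrow> i \<in> Y0 \<or> i \<in> Y1"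
  by (auto simp: Y_def)

lemma prm_simps:
  "i \<in> Y0 \<Longrightarrow> prm i \<in> Y0" "i \<in> Y1 \<Longrightarrow> prm i = i" "i \<in> Y \<Longrightarrow> prm i \<in> Y"
  "i \<in> Y \<Longrightarrow> prm (prm i) = i" "i \<in> Y0 \<Longrightarrow> prm i \<noteq> i"
  by (auto simp: prm_def Y0_def Y1_def Y_def)

lemma prm_eq_iff: "i \<in> Y0 \<Longrightarrow> j \<in> Y0 \<Longrightarrow> prm i = j \<longleftrightarrow> i = prm j"
  using prm_simps(4)[of i] prm_simps(4)[of j] by (auto simp: Y_cases)

lemma bij_prm: "bij_betw prm Y Y" "bij_betw prm Y0 Y0"
  by (rule bij_betw_byWitness[where f' = prm]; auto simp: prm_simps Y_cases)+

lemma \<mu>_simps [simp]: "i \<in> Y0 \<Longrightarrow> \<mu> i = 0" "i \<in> Y1 \<Longrightarrow> \<mu> i = 1"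
  by (auto simp: \<mu>_def Y_disjoint)

lemma \<mu>_prm [simp]: "i \<in> Y \<Longrightarrow> \<mu> (prm i) = \<mu> i"
  by (auto simp: Y_cases prm_simps)

lemma \<tau>_sq: "\<tau> i * \<tau> i = (1::'a::field)"
  by (simp add: \<tau>_def)

lemma \<tau>_nonzero [simp]: "\<tau> i \<noteq> (0::'a::field)"
  by (simp add: \<tau>_def)

lemma \<tau>_simps: "i \<in> Y1 \<Longrightarrow> \<tau> i = (1::'a::field)" "i \<in> Y0 \<Longrightarrow> \<tau> (prm i) = (- \<tau> i ::'a::field)"
  by (auto simp: \<tau>_def prm_def Y0_def Y1_def)

lemma B_finite: "u \<in> B \<Longrightarrow> finite u"
  using finite_subset[of u Y1] by (auto simp: B_def)

lemma B_subset: "u \<in> B \<Longrightarrow> v \<subseteq> u \<Longrightarrow> v \<in> B"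
  by (auto simp: B_def)

lemma B_insert: "insert k u \<in> B \<longleftrightarrow> k \<in> Y1 \<and> u \<in> B"
  by (auto simp: B_def)

lemma B_Un: "u \<union> v \<in> B \<longleftrightarrow> u \<in> B \<and> v \<in> B"
  by (auto simp: B_def)

lemma zero_in_A [simp]: "0 \<in> A" "(\<lambda>_. 0) \<in> A"
  by (auto simp: A_def)

lemma A_down: "\<alpha> \<in> A \<Longrightarrow> \<beta> \<le> \<alpha> \<Longrightarrow> \<beta> \<in> A"
  unfolding A_def le_fun_def by (auto intro: order_trans)

lemma empty_in_B [simp]: "{} \<in> B" by (simp add: B_def)

lemma A_outside: "\<alpha> \<in> A \<Longrightarrow> i \<notin> Y0 \<Longrightarrow> \<alpha> i = 0"
  unfolding A_def by (drule CollectD, drule spec[of _ i]) (simp add: \<pi>_def)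

text \<open>Turns the spans defining \<open>O_set\<close>, \<open>O_par\<close> and
  \<open>O_deg\<close> into conditions on coefficients, the form used throughout.\<close>

lemma span_xmon:
  assumes "finite S"
  shows "ovec.span {xmon \<alpha> u |\<alpha> u. (\<alpha>, u) \<in> S} = {f :: 'a::field sup. \<forall>b. b \<notin> S \<longrightarrow> f b = 0}"
    (is "ovec.span ?M = ?R")
proof
  show "ovec.span ?M \<subseteq> ?R"
  proof
    fix f assume "f \<in> ovec.span ?M"
    then show "f \<in> ?R"
      by (induction rule: ovec.span_induct_alt) (auto simp: xmon_def split: if_splits)
  qed
  show "?R \<subseteq> ovec.span ?M"
  proof
    fix f assume f: "f \<in> ?R"
    have "f = (\<Sum>b\<in>S. oscale (f b) (xmon (fst b) (snd b)))"
    proof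
      fix c
      have "(\<Sum>b\<in>S. oscale (f b) (xmon (fst b) (snd b))) c = (\<Sum>b\<in>S. if c = b then f b else 0)"
        unfolding sum_fun_apply by (rule sum.cong) (auto simp: xmon_def)
      also have "\<dots> = f c" using assms f by (cases c) auto
      finally show "f c = (\<Sum>b\<in>S. oscale (f b) (xmon (fst b) (snd b))) c" ..
    qed
    also have "\<dots> \<in> ovec.span ?M"
      by (intro ovec.span_sum ovec.span_scale ovec.span_base CollectI) (metis prod.collapse)
    finally show "f \<in> ovec.span ?M" .
  qed
qed

lemma O_set_iff: "f \<in> O_set \<longleftrightarrow> (\<forall>\<alpha> u. \<not> (\<alpha> \<in> A \<and> u \<in> B) \<longrightarrow> f (\<alpha>, u) = 0)"
  using span_xmon[of "A \<times> B"] finite_A finite_B by (auto simp: O_set_def)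

lemma O_par_iff: "f \<in> O_par s \<longleftrightarrow>
    (\<forall>\<alpha> u. \<not> (\<alpha> \<in> A \<and> u \<in> B \<and> card u mod 2 = s) \<longrightarrow> f (\<alpha>, u) = 0)"
proof -
  have "finite {(\<alpha>, u). \<alpha> \<in> A \<and> u \<in> B \<and> card u mod 2 = s}"
    by (rule finite_subset[of _ "A \<times> B"]) (auto simp: finite_A finite_B)
  from span_xmon[OF this, where 'a = 'a] show ?thesis by (auto simp: O_par_def)
qed

lemma O_deg_iff: "f \<in> O_deg k \<longleftrightarrow>
    (\<forall>\<alpha> u. \<not> (\<alpha> \<in> A \<and> u \<in> B \<and> int (sum \<alpha> Y0 + card u) = k) \<longrightarrow> f (\<alpha>, u) = 0)"
proof -
  have "finite {(\<alpha>, u). \<alpha> \<in> A \<and> u \<in> B \<and> int (sum \<alpha> Y0 + card u) = k}"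
    by (rule finite_subset[of _ "A \<times> B"]) (auto simp: finite_A finite_B)
  from span_xmon[OF this, where 'a = 'a] show ?thesis by (auto simp: O_deg_def)
qed

lemma O_par_O_set: "f \<in> O_par s \<Longrightarrow> f \<in> O_set"
  unfolding O_par_iff O_set_iff by blast

lemma O_set_zero [simp]: "0 \<in> O_set" by (simp add: O_set_iff)

lemma O_set_xmon: "\<alpha> \<in> A \<Longrightarrow> u \<in> B \<Longrightarrow> xmon \<alpha> u \<in> O_set"
  by (auto simp: O_set_iff xmon_def)

lemma O_par_zero [simp]: "0 \<in> O_par s" by (simp add: O_par_iff)

lemma O_par_oscale: "f \<in> O_par s \<Longrightarrow> oscale c f \<in> O_par s" by (simp add: O_par_iff)

lemma O_par_add: "f \<in> O_par s \<Longrightarrow> g \<in> O_par s \<Longrightarrow> f + g \<in> O_par s"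
  by (simp add: O_par_iff)

lemma O_par_sum: "(\<And>i. i \<in> S \<Longrightarrow> F i \<in> O_par s) \<Longrightarrow> sum F S \<in> O_par s"
  by (induction S rule: infinite_finite_induct) (auto intro: O_par_add)

lemma O_par_xmon: "\<alpha> \<in> A \<Longrightarrow> u \<in> B \<Longrightarrow> card u mod 2 = s \<Longrightarrow> xmon \<alpha> u \<in> O_par s"
  by (auto simp: O_par_iff xmon_def)

subsection \<open>Superderivations\<close>

text \<open>The truncation is built in: if raising \<open>\<gamma>\<close> at \<open>i\<close>
  leaves \<open>A\<close>, then \<open>f\<close> vanishes there.\<close>

lemma der_apply0:
  assumes "i \<in> Y0" "f \<in> O_set"
  shows "der i f (\<gamma>, v) = f (\<gamma>(i := Suc (\<gamma> i)), v)"
proof -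
  have "der i f (\<gamma>, v) = (\<Sum>b\<in>A \<times> B. if b = (\<gamma>(i := Suc (\<gamma> i)), v) then f b else 0)"
    unfolding der_def sum_fun_apply
    by (rule sum.cong) (use assms in \<open>auto simp: xmon_der_def xmon_def fun_eq_iff split: if_splits\<close>)
  also have "\<dots> = f (\<gamma>(i := Suc (\<gamma> i)), v)"
    using assms(2) by (auto simp: finite_A finite_B O_set_iff)
  finally show ?thesis .
qed

lemma der_apply1:
  assumes "k \<in> Y1" "f \<in> O_set"
  shows "der k f (\<gamma>, v) = (if k \<in> v then 0 else reord_sign {k} v * f (\<gamma>, insert k v))"
proof -
  have "der k f (\<gamma>, v) =
      (\<Sum>b\<in>A \<times> B. if b = (\<gamma>, insert k v) then if k \<in> v then 0 else reord_sign {k} v * f b else 0)"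
    unfolding der_def sum_fun_apply
  proof (rule sum.cong, goal_cases)
    case (2 b)
    obtain \<alpha> u where b: "b = (\<alpha>, u)" by (cases b)
    have "xmon_der k \<alpha> u (\<gamma>, v) =
        (if \<alpha> = \<gamma> \<and> u = insert k v \<and> k \<notin> v then reord_sign {k} v else 0 :: 'a)"
    proof (cases "k \<in> u")
      case True
      then have eq: "v = u - {k} \<longleftrightarrow> u = insert k v \<and> k \<notin> v" by auto
      have "{l \<in> insert k v. l < k} = {l \<in> v. l < k}" by auto
      then show ?thesis using True assms(1) eq
        by (auto simp: xmon_der_def xmon_def Y_disjoint reord_sign_single_left)
    next
      case False
      then show ?thesis using assms(1) by (auto simp: xmon_der_def Y_disjoint)
    qed
    then show ?case by (simp add: b)
  qed auto
  also have "\<dots> = (if k \<in> v then 0 else reord_sign {k} v * f (\<gamma>, insert k v))"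
    using assms(2) by (auto simp: finite_A finite_B O_set_iff)
  finally show ?thesis .
qed

lemma der_oscale: "der i (oscale c f) = oscale c (der i f)"
  by (auto simp: der_def fun_eq_iff sum_fun_apply sum_distrib_left case_prod_unfold mult.assoc)

lemma der_zero [simp]: "der i 0 = 0"
  by (auto simp: der_def fun_eq_iff sum_fun_apply case_prod_unfold)

lemma der_sum: "der i (sum F S) = (\<Sum>s\<in>S. der i (F s))"
proof (induction S rule: infinite_finite_induct)
  case (infinite S)
  then have "der i (sum F S) = (\<Sum>s\<in>S. der i (F s))" by simp
  then show ?case .
next
  case empty
  have "der i (sum F {}) = (\<Sum>s\<in>{}. der i (F s))" by simp
  then show ?case .
next
  case (insert x S)
  then have "der i (sum F (insert x S)) = (\<Sum>s\<in>insert x S. der i (F s))"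
    by (simp add: der_add)
  then show ?case .
qed

lemma der_xmon:
  assumes "\<alpha> \<in> A" "u \<in> B"
  shows "der i (xmon \<alpha> u) = xmon_der i \<alpha> u"
proof -
  have "der i (xmon \<alpha> u) = (\<Sum>b\<in>A \<times> B. if b = (\<alpha>, u) then xmon_der i \<alpha> u else 0)"
    unfolding der_def by (rule sum.cong) (auto simp: xmon_def fun_eq_iff split: if_splits)
  then show ?thesis using assms by (simp add: finite_A finite_B)
qed

lemma der_xmon0:
  assumes "\<alpha> \<in> A" "u \<in> B" "i \<in> Y0"
  shows "der i (xmon \<alpha> u) = (if \<alpha> i = 0 then 0 else xmon (\<alpha>(i := \<alpha> i - 1)) u)"
  using assms by (simp add: der_xmon xmon_der_def)

lemma der_xmon1:
  assumes "\<alpha> \<in> A" "u \<in> B" "k \<in> Y1"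
  shows "der k (xmon \<alpha> u) =
    (if k \<in> u then oscale (reord_sign {k} (u - {k})) (xmon \<alpha> (u - {k})) else 0)"
proof -
  have "(-1) ^ card {l \<in> u. l < k} = (reord_sign {k} (u - {k}) :: 'a)"
    by (simp only: reord_sign_single_diff) (simp only: reord_sign_single_left)
  then show ?thesis using assms by (simp add: der_xmon xmon_der_def Y_disjoint)
qed

lemma A_upd_Suc: "\<gamma>(i := Suc (\<gamma> i)) \<in> A \<Longrightarrow> \<gamma> \<in> A"
  by (erule A_down) (auto simp: le_fun_def)

lemma der_O_set:
  assumes "i \<in> Y" "f \<in> O_set"
  shows "der i f \<in> O_set"
  unfolding O_set_iff
proof (intro allI impI)
  fix \<gamma> v assume v: "\<not> (\<gamma> \<in> A \<and> v \<in> B)"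
  then have "\<gamma>(i := Suc (\<gamma> i)) \<notin> A \<or> v \<notin> B" using A_upd_Suc by blast
  then show "der i f (\<gamma>, v) = 0"
    using assms v by (auto simp: Y_cases der_apply0 der_apply1 O_set_iff B_insert)
qed

lemma der_O_par:
  assumes "i \<in> Y" "f \<in> O_par s" "s < 2"
  shows "der i f \<in> O_par ((s + \<mu> i) mod 2)"
  unfolding O_par_iff
proof (intro allI impI)
  fix \<gamma> v assume v: "\<not> (\<gamma> \<in> A \<and> v \<in> B \<and> card v mod 2 = (s + \<mu> i) mod 2)"
  note f = assms(2)[THEN O_par_O_set]
  have c: "card (insert i v) = Suc (card v)" if "v \<in> B" "i \<notin> v"
    using that by (simp add: B_finite)
  from assms(1) consider "i \<in> Y0" | "i \<in> Y1" by (auto simp: Y_cases)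
  then show "der i f (\<gamma>, v) = 0"
  proof cases
    case 1
    then show ?thesis using v assms(2,3) f by (auto simp: der_apply0 O_par_iff dest: A_upd_Suc)
  next
    case 2
    show ?thesis
    proof (cases "i \<in> v \<or> v \<notin> B \<or> \<gamma> \<notin> A")
      case True
      then show ?thesis using 2 f by (auto simp: der_apply1 O_set_iff B_insert)
    next
      case False
      then have "card (insert i v) mod 2 \<noteq> s" using v 2 c assms(3) by (auto simp: mod_Suc split: if_splits)
      then show ?thesis using 2 f assms(2) False by (auto simp: der_apply1 O_par_iff)
    qed
  qed
qed

lemma der_commute:
  assumes "i \<in> Y" "j \<in> Y" "f \<in> O_set"
  shows "der i (der j f) = oscale ((-1) ^ (\<mu> i * \<mu> j)) (der j (der i f))"
proof -
  have "der i (der j f) (\<gamma>, v) = (-1) ^ (\<mu> i * \<mu> j) * der j (der i f) (\<gamma>, v)" for \<gamma> v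
  proof -
    note O = assms(3) der_O_set[OF assms(1,3)] der_O_set[OF assms(2,3)]
    show ?thesis
    proof (cases "i \<in> Y1 \<and> j \<in> Y1 \<and> i \<noteq> j \<and> i \<notin> v \<and> j \<notin> v \<and> v \<in> B")
      case True
      then have fin: "finite v" by (simp add: B_finite)
      have "reord_sign {j} {i} = (- reord_sign {i} {j} :: 'a)"
        using reord_sign_commute[of "{i}" "{j}", where 'a = 'a] True by simp
      then show ?thesis
        using True O reord_sign_insert_right[of "{i}" v j, where 'a = 'a]
          reord_sign_insert_right[of "{j}" v i, where 'a = 'a] fin
        by (simp add: der_apply1 insert_commute[of i j])
    next
      case False
      from assms(1,2) consider "i \<in> Y0" "j \<in> Y0" | "i \<in> Y0" "j \<in> Y1" | "i \<in> Y1" "j \<in> Y0" | "i \<in> Y1" "j \<in> Y1"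
        unfolding Y_cases by blast
      then show ?thesis
      proof cases
        case 1
        then show ?thesis using O by (cases "i = j") (simp_all add: der_apply0 fun_upd_twist)
      next
        case 4
        have "f (\<gamma>, insert i (insert j v)) = 0" if "v \<notin> B"
          using that assms(3) by (simp add: O_set_iff B_insert)
        then show ?thesis using O 4 False by (auto simp: der_apply1 insert_commute)
      qed (use O in \<open>simp_all add: der_apply0 der_apply1\<close>)
    qed
  qed
  then show ?thesis by (auto simp: fun_eq_iff)
qed

subsection \<open>The product\<close>

text \<open>The structure constant of x^(\<alpha>) x^(\<gamma>-\<alpha>), indexed by the target
  exponent \<gamma> so that products can be read off coefficientwise.\<close>

definition bin :: "(nat \<Rightarrow> nat) \<Rightarrow> (nat \<Rightarrow> nat) \<Rightarrow> nat"
  where "bin \<gamma> \<alpha> = (\<Prod>i\<in>Y0. \<gamma> i choose \<alpha> i)"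

lemma bin_eq_0: "\<alpha> \<in> A \<Longrightarrow> \<not> \<alpha> \<le> \<gamma> \<Longrightarrow> bin \<gamma> \<alpha> = 0"
  using A_outside unfolding bin_def le_fun_def
  by (metis finite_Y(1) binomial_eq_0 bot_nat_0.extremum linorder_not_le prod_zero)

lemma bin_zero [simp]: "bin \<gamma> 0 = 1" "bin \<gamma> (\<lambda>_. 0) = 1"
  by (simp_all add: bin_def)

lemma xmon_mult_apply:
  "xmon_mult \<alpha> u \<beta> w (\<gamma>, v) =
    (if \<gamma> = \<alpha> + \<beta> \<and> v = u \<union> w \<and> \<gamma> \<in> A \<and> u \<inter> w = {}
     then of_nat (bin \<gamma> \<alpha>) * reord_sign u w else 0 :: 'a::field)"
proof -
  have "(\<lambda>i. \<alpha> i + \<beta> i) = \<alpha> + \<beta>" by (simp add: fun_eq_iff)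
  then show ?thesis by (auto simp: xmon_mult_def xmon_def bin_def)
qed

lemma omult_add_left: "(f + g) \<star> h = f \<star> h + g \<star> h"
  by (auto simp: omult_def fun_eq_iff sum_fun_apply case_prod_unfold algebra_simps sum.distrib)

lemma omult_add_right: "h \<star> (f + g) = h \<star> f + h \<star> g"
  by (auto simp: omult_def fun_eq_iff sum_fun_apply case_prod_unfold algebra_simps sum.distrib)

lemma omult_scale_left: "oscale c f \<star> g = oscale c (f \<star> g)"
  by (auto simp: omult_def fun_eq_iff sum_fun_apply case_prod_unfold algebra_simps sum_distrib_left)

lemma omult_scale_right: "f \<star> oscale c g = oscale c (f \<star> g)"
  by (auto simp: omult_def fun_eq_iff sum_fun_apply case_prod_unfold algebra_simps sum_distrib_left)

lemma omult_zero [simp]: "0 \<star> f = 0" "f \<star> 0 = 0"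
  by (auto simp: omult_def fun_eq_iff sum_fun_apply case_prod_unfold)

lemma omult_xmon_xmon:
  assumes "\<alpha> \<in> A" "u \<in> B" "\<beta> \<in> A" "w \<in> B"
  shows "xmon \<alpha> u \<star> xmon \<beta> w = (xmon_mult \<alpha> u \<beta> w :: 'a::field sup)"
proof -
  have "xmon \<alpha> u \<star> xmon \<beta> w =
      (\<Sum>b\<in>A \<times> B. if b = (\<alpha>, u) then xmon_mult \<alpha> u \<beta> w else (0 :: 'a sup))"
    unfolding omult_def
  proof (rule sum.cong, goal_cases)
    case (2 b)
    have "(\<Sum>c\<in>A \<times> B. oscale (xmon \<alpha> u b * xmon \<beta> w c) (xmon_mult (fst b) (snd b) (fst c) (snd c)))
        = (\<Sum>c\<in>A \<times> B. if c = (\<beta>, w) then oscale (xmon \<alpha> u b) (xmon_mult (fst b) (snd b) \<beta> w) else (0::'a sup))"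
      by (rule sum.cong) (auto simp: xmon_def fun_eq_iff)
    also have "\<dots> = oscale (xmon \<alpha> u b) (xmon_mult (fst b) (snd b) \<beta> w)"
      using assms by (simp add: finite_A finite_B)
    also have "\<dots> = (if b = (\<alpha>, u) then xmon_mult \<alpha> u \<beta> w else 0)"
      by (auto simp: xmon_def fun_eq_iff)
    finally show ?case by (simp only: case_prod_unfold prod.collapse)
  qed simp
  then show ?thesis using assms by (simp add: finite_A finite_B)
qed

text \<open>Truncated subtraction is harmless in \<open>\<gamma> - \<alpha>\<close>: unless
  \<open>\<alpha> \<le> \<gamma>\<close>, the factor \<open>bin \<gamma> \<alpha>\<close> is
  zero.\<close>

lemma xmon_omult_apply:
  assumes "\<alpha> \<in> A" "u \<in> B" "f \<in> O_set"
  shows "(xmon \<alpha> u \<star> f) (\<gamma>, v) = (if \<gamma> \<in> A \<and> v \<in> B \<and> u \<subseteq> v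
     then of_nat (bin \<gamma> \<alpha>) * reord_sign u (v - u) * f (\<gamma> - \<alpha>, v - u) else 0)"
proof -
  have "f \<in> ovec.span {xmon \<beta> w |\<beta> w. \<beta> \<in> A \<and> w \<in> B}" using assms(3) by (simp add: O_set_def)
  then show ?thesis
  proof (induction rule: ovec.span_induct_alt)
    case (step c x y)
    then obtain \<beta> w where x: "x = xmon \<beta> w" "\<beta> \<in> A" "w \<in> B" by auto
    have "(xmon \<alpha> u \<star> x) (\<gamma>, v) = (if \<gamma> \<in> A \<and> v \<in> B \<and> u \<subseteq> v
      then of_nat (bin \<gamma> \<alpha>) * reord_sign u (v - u) * x (\<gamma> - \<alpha>, v - u) else 0)"
    proof (cases "\<alpha> \<le> \<gamma>")
      case True
      then have eq: "\<gamma> = \<alpha> + \<beta> \<longleftrightarrow> \<gamma> - \<alpha> = \<beta>"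
        by (auto simp: fun_eq_iff le_fun_def) (metis le_add_diff_inverse)
      have eq2: "v = u \<union> w \<and> u \<inter> w = {} \<longleftrightarrow> u \<subseteq> v \<and> v - u = w" by auto
      show ?thesis
        unfolding x(1) omult_xmon_xmon[OF assms(1,2) x(2,3)] xmon_mult_apply
        using eq eq2 x assms by (auto simp: xmon_def B_Un)
    next
      case False
      then have "\<gamma> \<noteq> \<alpha> + \<beta>" by (auto simp: le_fun_def)
      then show ?thesis using bin_eq_0[OF assms(1) False]
        unfolding x(1) omult_xmon_xmon[OF assms(1,2) x(2,3)] xmon_mult_apply by auto
    qed
    then have "(xmon \<alpha> u \<star> (oscale c x + y)) (\<gamma>, v) = (if \<gamma> \<in> A \<and> v \<in> B \<and> u \<subseteq> v
      then of_nat (bin \<gamma> \<alpha>) * reord_sign u (v - u) * (oscale c x + y) (\<gamma> - \<alpha>, v - u) else 0)"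
      using step by (simp add: omult_add_right omult_scale_right algebra_simps)
    then show ?case .
  next
    case base
    have "(xmon \<alpha> u \<star> 0) (\<gamma>, v) = (if \<gamma> \<in> A \<and> v \<in> B \<and> u \<subseteq> v
      then of_nat (bin \<gamma> \<alpha>) * reord_sign u (v - u) * 0 (\<gamma> - \<alpha>, v - u) else (0 :: 'a))"
      by simp
    then show ?case .
  qed
qed

text \<open>Two span inductions reduce it to monomials, where the even parts commute by the symmetry
  of binomial coefficients and the odd parts contribute \<open>reord_sign_commute\<close>.\<close>

lemma omult_commute:
  assumes "f \<in> O_par r" "g \<in> O_par s"
  shows "g \<star> f = oscale ((-1) ^ (r * s)) (f \<star> g)"
proof -
  have "f \<in> ovec.span {xmon \<alpha> u |\<alpha> u. \<alpha> \<in> A \<and> u \<in> B \<and> card u mod 2 = r}"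
    using assms(1) by (simp add: O_par_def)
  then show ?thesis
  proof (induction rule: ovec.span_induct_alt)
    case (step c x y)
    then obtain \<alpha> u where x: "x = xmon \<alpha> u" "\<alpha> \<in> A" "u \<in> B" "card u mod 2 = r" by auto
    have "g \<in> ovec.span {xmon \<beta> w |\<beta> w. \<beta> \<in> A \<and> w \<in> B \<and> card w mod 2 = s}"
      using assms(2) by (simp add: O_par_def)
    then have gx: "g \<star> x = oscale ((-1) ^ (r * s)) (x \<star> g)"
    proof (induction rule: ovec.span_induct_alt)
      case (step d z y')
      then obtain \<beta> w where z: "z = xmon \<beta> w" "\<beta> \<in> A" "w \<in> B" "card w mod 2 = s" by auto
      have par: "(-1) ^ (card u * card w) = ((-1) ^ (r * s) :: 'a)"
      proof -
        have "even (card u * card w) \<longleftrightarrow> even (r * s)"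
          unfolding x(4)[symmetric] z(4)[symmetric] by simp
        then show ?thesis by (simp add: minus_one_power_iff)
      qed
      have sg: "reord_sign w u = (-1) ^ (r * s) * (reord_sign u w :: 'a)" if "u \<inter> w = {}"
        using reord_sign_commute[of u w] that x z B_finite par by metis
      have bin: "bin (\<alpha> + \<beta>) \<beta> = bin (\<alpha> + \<beta>) \<alpha>"
        unfolding bin_def
        by (rule prod.cong) (auto, metis add_diff_cancel_left' binomial_symmetric le_add1)
      have "xmon_mult \<beta> w \<alpha> u = oscale ((-1) ^ (r * s)) (xmon_mult \<alpha> u \<beta> w :: 'a sup)"
        unfolding fun_eq_iff
        using sg bin by (auto simp: xmon_mult_apply add.commute Int_commute Un_commute)
      then have zx: "z \<star> x = oscale ((-1) ^ (r * s)) (x \<star> z)"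
        using x z by (simp add: omult_xmon_xmon)
      have IH: "y' \<star> x = oscale ((-1) ^ (r * s)) (x \<star> y')" by (rule step(2))
      have "(oscale d z + y') \<star> x = oscale ((-1) ^ (r * s)) (x \<star> (oscale d z + y'))"
        unfolding omult_add_left omult_add_right omult_scale_left omult_scale_right IH
        using zx by (simp add: omult_add_left omult_add_right omult_scale_left omult_scale_right
            ovec.scale_right_distrib mult.commute)
      then show ?case .
    next
      case base
      have "0 \<star> x = oscale ((-1) ^ (r * s)) (x \<star> 0)" by simp
      then show ?case .
    qed
    have IH: "g \<star> y = oscale ((-1) ^ (r * s)) (y \<star> g)" by (rule step(2))
    have "g \<star> (oscale c x + y) = oscale ((-1) ^ (r * s)) ((oscale c x + y) \<star> g)"
      unfolding omult_add_left omult_add_right omult_scale_left omult_scale_right IH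
      using gx by (simp add: ovec.scale_right_distrib mult.commute)
    then show ?case .
  next
    case base
    have "g \<star> 0 = oscale ((-1) ^ (r * s)) (0 \<star> g)" by simp
    then show ?case .
  qed
qed

lemma omult_O_set:
  assumes "f \<in> O_set" "g \<in> O_set"
  shows "f \<star> g \<in> O_set"
proof -
  have "f \<in> ovec.span {xmon \<alpha> u |\<alpha> u. \<alpha> \<in> A \<and> u \<in> B}" using assms(1) by (simp add: O_set_def)
  then show ?thesis
  proof (induction rule: ovec.span_induct_alt)
    case (step c x y)
    then have "x \<star> g \<in> O_set"
      by (auto simp: O_set_iff xmon_omult_apply[OF _ _ assms(2)])
    with step have "(oscale c x + y) \<star> g \<in> O_set"
      by (simp add: omult_add_left omult_scale_left O_set_iff)
    then show ?case .
  next
    case base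
    have "0 \<star> g \<in> O_set" by simp
    then show ?case .
  qed
qed

lemma omult_O_par:
  assumes "f \<in> O_par r" "g \<in> O_par s"
  shows "f \<star> g \<in> O_par ((r + s) mod 2)"
proof -
  have "f \<in> ovec.span {xmon \<alpha> u |\<alpha> u. \<alpha> \<in> A \<and> u \<in> B \<and> card u mod 2 = r}"
    using assms(1) by (simp add: O_par_def)
  then show ?thesis
  proof (induction rule: ovec.span_induct_alt)
    case (step c x y)
    then obtain \<alpha> u where x: "x = xmon \<alpha> u" "\<alpha> \<in> A" "u \<in> B" "card u mod 2 = r" by auto
    have "x \<star> g \<in> O_par ((r + s) mod 2)"
      unfolding O_par_iff
    proof (intro allI impI)
      fix \<gamma> v assume v: "\<not> (\<gamma> \<in> A \<and> v \<in> B \<and> card v mod 2 = (r + s) mod 2)"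
      show "(x \<star> g) (\<gamma>, v) = 0"
      proof (cases "\<gamma> \<in> A \<and> v \<in> B \<and> u \<subseteq> v")
        case True
        then have "card v = card u + card (v - u)"
          using x(3) B_finite by (metis card_Diff_subset card_mono le_add_diff_inverse)
        then have "card (v - u) mod 2 \<noteq> s" using v True x(4) by (metis mod_add_eq mod_add_right_eq)
        then show ?thesis using assms(2) unfolding x(1) xmon_omult_apply[OF x(2,3) O_par_O_set[OF assms(2)]]
          by (auto simp: O_par_iff)
      qed (auto simp: x(1) xmon_omult_apply[OF x(2,3) O_par_O_set[OF assms(2)]])
    qed
    then have "(oscale c x + y) \<star> g \<in> O_par ((r + s) mod 2)"
      unfolding omult_add_left omult_scale_left by (intro O_par_add O_par_oscale step)
    then show ?case .
  next
    case base
    have "0 \<star> g \<in> O_par ((r + s) mod 2)" by simp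
    then show ?case .
  qed
qed

text \<open>Pascal's rule in the coordinate \<open>j\<close>; this is the Leibniz rule for divided
  powers at the level of coefficients.\<close>

lemma bin_upd_Suc:
  assumes "j \<in> Y0"
  shows "bin (\<gamma>(j := Suc (\<gamma> j))) \<alpha> =
    (if \<alpha> j = 0 then 0 else bin \<gamma> (\<alpha>(j := \<alpha> j - 1))) + bin \<gamma> \<alpha>"
proof -
  have *: "bin \<gamma> \<alpha> = (\<gamma> j choose \<alpha> j) * (\<Prod>i\<in>Y0 - {j}. \<gamma> i choose \<alpha> i)" for \<gamma> \<alpha>
    unfolding bin_def using assms by (intro prod.remove) auto
  show ?thesis unfolding * by (cases "\<alpha> j") (auto simp: algebra_simps intro!: prod.cong)
qed

lemma ppart_O_par: "f \<in> O_par s \<Longrightarrow> ppart r f = (if r = s then f else 0)"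
  by (auto simp: ppart_def O_par_iff fun_eq_iff)

lemma \<mu>_cases: "\<mu> i = 0 \<or> \<mu> i = 1"
  by (simp add: \<mu>_def)

subsection \<open>The bracket of even elements\<close>

text \<open>The Poisson bracket of even functions, to which the bracket of W corresponds under
  \<open>D\<^sub>H\<close> (see \<open>bracket_D\<^sub>H\<close>). For even arguments the parity
  sign in \<open>D\<^sub>H\<close> is 1.\<close>

definition pb :: "'a::field sup \<Rightarrow> 'a sup \<Rightarrow> 'a sup"
  where "pb f g = (\<Sum>i\<in>Y. oscale (\<tau> i) (der i f \<star> der (prm i) g))"

lemma D\<^sub>H_apply:
  "D\<^sub>H f j = (if j \<in> Y then oscale (\<tau> (prm j))
      (der (prm j) (ppart 0 f) + oscale ((-1) ^ \<mu> j) (der (prm j) (ppart 1 f))) else 0)"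
proof -
  have *: "(\<Sum>i\<in>Y. wscale (c i) (vf (F i) (prm i)) j) = (if j \<in> Y then oscale (c (prm j)) (F (prm j)) else 0)"
    for c and F :: "nat \<Rightarrow> 'a sup"
  proof -
    have "(\<Sum>i\<in>Y. wscale (c i) (vf (F i) (prm i)) j) =
        (\<Sum>i\<in>Y. if i = prm j then oscale (c (prm j)) (F (prm j)) else 0)"
      if "j \<in> Y"
    proof (rule sum.cong, goal_cases)
      case (2 i)
      then have "j = prm i \<longleftrightarrow> i = prm j" using that prm_simps(4) by metis
      then show ?case by (simp add: vf_def)
    qed simp
    moreover have "(\<Sum>i\<in>Y. wscale (c i) (vf (F i) (prm i)) j) = 0" if "j \<notin> Y"
      by (rule sum.neutral) (use that prm_simps(3) in \<open>auto simp: vf_def\<close>)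
    ultimately show ?thesis using prm_simps(3) by simp
  qed
  have "D\<^sub>H f j = (\<Sum>i\<in>Y. wscale (\<tau> i * (-1) ^ (\<mu> i * 0)) (vf (der i (ppart 0 f)) (prm i)) j)
      + (\<Sum>i\<in>Y. wscale (\<tau> i * (-1) ^ (\<mu> i * 1)) (vf (der i (ppart 1 f)) (prm i)) j)"
    by (simp add: D\<^sub>H_def sum_fun_apply del: wscale_apply)
  then show ?thesis
    unfolding * by (simp add: ovec.scale_right_distrib)
qed

lemma ppart_add: "ppart s (f + g) = ppart s f + ppart s g"
  by (auto simp: ppart_def fun_eq_iff)

lemma ppart_oscale: "ppart s (oscale c f) = oscale c (ppart s f)"
  by (auto simp: ppart_def fun_eq_iff)

lemma D\<^sub>H_add: "D\<^sub>H (f + g) = D\<^sub>H f + D\<^sub>H g"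
  unfolding fun_eq_iff[of "D\<^sub>H (f + g)"]
  by (simp add: D\<^sub>H_apply ppart_add der_add ovec.scale_right_distrib)

lemma D\<^sub>H_oscale: "D\<^sub>H (oscale c f) = wscale c (D\<^sub>H f)"
  unfolding fun_eq_iff[of "D\<^sub>H (oscale c f)"]
  by (simp add: D\<^sub>H_apply ppart_oscale der_oscale ovec.scale_right_distrib mult_ac)

lemma D\<^sub>H_even:
  assumes "f \<in> O_par 0"
  shows "D\<^sub>H f j = (if j \<in> Y then oscale (\<tau> (prm j)) (der (prm j) f) else 0)"
  using assms by (simp add: D\<^sub>H_apply ppart_O_par)

lemma W_even_O_par: "D \<in> W_even \<Longrightarrow> j \<in> Y \<Longrightarrow> D j \<in> O_par (\<mu> j)"
  by (simp add: W_even_def)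

lemma W_even_outside: "D \<in> W_even \<Longrightarrow> j \<notin> Y \<Longrightarrow> D j = 0"
  by (simp add: W_even_def W_def)

lemma W_even_O_set: "D \<in> W_even \<Longrightarrow> D j \<in> O_set"
  using W_even_O_par W_even_outside O_par_O_set by (cases "j \<in> Y") fastforce+

lemma W_evenI:
  assumes "\<And>j. j \<in> Y \<Longrightarrow> D j \<in> O_par (\<mu> j)" "\<And>j. j \<notin> Y \<Longrightarrow> D j = 0"
  shows "D \<in> W_even"
  using assms O_par_O_set by (fastforce simp: W_even_def W_def)

lemma D\<^sub>H_W_even:
  assumes "f \<in> O_par 0"
  shows "D\<^sub>H f \<in> W_even"
proof (rule W_evenI)
  fix j assume "j \<in> Y"
  then have "der (prm j) f \<in> O_par (\<mu> j)"
    using der_O_par[OF _ assms, of "prm j"] \<mu>_cases[of j] prm_simps(3) by auto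
  then show "D\<^sub>H f j \<in> O_par (\<mu> j)"
    using \<open>j \<in> Y\<close> assms by (simp add: D\<^sub>H_even O_par_oscale)
qed (simp add: D\<^sub>H_even[OF assms])

text \<open>In an even element the coefficient of \<partial>_i has parity \<open>\<mu> i\<close>, so
  a single pair of parities contributes, and its sign exponent is even.\<close>

lemma bracket_even:
  assumes "D \<in> W_even" "E \<in> W_even"
  shows "bracket D E j = (if j \<in> Y then \<Sum>i\<in>Y. D i \<star> der i (E j) - E i \<star> der i (D j) else 0)"
proof -
  have inner: "(\<Sum>r\<in>{0, 1}. \<Sum>s\<in>{0, 1}.
       vf (ppart r (D i) \<star> der i (ppart s (E k))) k
       - wscale ((-1) ^ ((r + \<mu> i) * (s + \<mu> k))) (vf (ppart s (E k) \<star> der k (ppart r (D i))) i)) =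
       vf (D i \<star> der i (E k)) k - vf (E k \<star> der k (D i)) i" (is "?L = _")
    if "i \<in> Y" "k \<in> Y" for i k
  proof -
    have z: "vf 0 j = (0 :: 'a witt)" for j by (simp add: vf_def fun_eq_iff)
    have one: "(-1) ^ ((\<mu> i + \<mu> i) * (\<mu> k + \<mu> k)) = (1 :: 'a)" by simp
    have "?L = vf (D i \<star> der i (E k)) k
       - wscale ((-1) ^ ((\<mu> i + \<mu> i) * (\<mu> k + \<mu> k))) (vf (E k \<star> der k (D i)) i)"
      using \<mu>_cases[of i] \<mu>_cases[of k] ppart_O_par[OF W_even_O_par[OF assms(1) that(1)]]
        ppart_O_par[OF W_even_O_par[OF assms(2) that(2)]]
      by (elim disjE) (simp_all add: z)
    then show ?thesis unfolding one by (simp only: wvec.scale_one)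
  qed
  have "bracket D E = (\<Sum>i\<in>Y. \<Sum>k\<in>Y. vf (D i \<star> der i (E k)) k - vf (E k \<star> der k (D i)) i)"
    unfolding bracket_def using inner by (intro sum.cong refl) blast
  then have "bracket D E j = (\<Sum>i\<in>Y. \<Sum>k\<in>Y. vf (D i \<star> der i (E k)) k j - vf (E k \<star> der k (D i)) i j)"
    by (simp add: sum_fun_apply)
  also have "\<dots> = (\<Sum>i\<in>Y. \<Sum>k\<in>Y. vf (D i \<star> der i (E k)) k j) - (\<Sum>k\<in>Y. \<Sum>i\<in>Y. vf (E k \<star> der k (D i)) i j)"
    by (subst (2) sum.swap) (simp add: sum_subtractf)
  also have "\<dots> = (if j \<in> Y then \<Sum>i\<in>Y. D i \<star> der i (E j) - E i \<star> der i (D j) else 0)"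
    by (simp add: vf_def sum_subtractf)
  finally show ?thesis .
qed

lemma unit_omult:
  assumes "f \<in> O_set"
  shows "xmon 0 {} \<star> f = f" "xmon (\<lambda>_. 0) {} \<star> f = f"
proof -
  show "xmon (\<lambda>_. 0) {} \<star> f = f"
  proof
    fix c show "(xmon (\<lambda>_. 0) {} \<star> f) c = f c"
      using assms by (cases c) (auto simp: xmon_omult_apply O_set_iff fun_diff_def)
  qed
  then show "xmon 0 {} \<star> f = f" by (simp add: zero_fun_def)
qed

lemma pd_W_even: "i \<in> Y0 \<Longrightarrow> pd i \<in> W_even"
  by (rule W_evenI) (auto simp: pd_def vf_def Y_def Y_disjoint intro: O_par_xmon)

lemma bracket_pd:
  assumes "i \<in> Y0" "E \<in> W_even"
  shows "bracket (pd i) E = (\<lambda>j. der i (E j))"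
proof
  fix j
  show "bracket (pd i) E j = der i (E j)"
  proof (cases "j \<in> Y")
    case True
    have i: "i \<in> Y" using assms(1) by (simp add: Y_def)
    have E: "E k \<in> O_set" for k using assms(2) by (rule W_even_O_set)
    have 1: "pd i k \<star> der k (E j) = (if k = i then der i (E j) else 0)" for k
      using der_O_set[OF i E] by (simp add: pd_def vf_def unit_omult)
    have 2: "der k (pd i j) = 0" if "k \<in> Y" for k
      using that by (auto simp: pd_def vf_def Y_cases der_xmon0 der_xmon1)
    show ?thesis using True i bracket_even[OF pd_W_even[OF assms(1)] assms(2)] by (simp add: 1 2)
  next
    case False
    then have "E j = 0" by (rule W_even_outside[OF assms(2)])
    then show ?thesis using False assms by (simp add: bracket_even pd_W_even)
  qed
qed

end

section \<open>Arithmetic modulo p, the Leibniz rules, and the Poisson bracket\<close>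

locale ham_field = ham p m n t for p m n :: nat and t :: "nat \<Rightarrow> nat" +
  fixes field_type :: "'a::field itself"
  assumes char: "CHAR('a) = p" and p3: "p > 3" and m1: "m > 1" and n3: "n > 3"
    and t_pos: "\<forall>i\<in>Y0. t i > 0"
begin

lemma prime_p: "prime p"
  using prime_CHAR_semidom[where 'a = 'a] char p3 by simp

lemma of_nat_eq_0: "of_nat k = (0::'a) \<longleftrightarrow> p dvd k"
  using char by (simp add: of_nat_eq_0_iff_char_dvd)

lemma of_nat_small: "0 < k \<Longrightarrow> k < p \<Longrightarrow> of_nat k \<noteq> (0::'a)"
  by (auto simp: of_nat_eq_0 dest: dvd_imp_le)

lemma Suc_\<pi>: "i \<in> Y0 \<Longrightarrow> Suc (\<pi> i) = p ^ t i"
  using p3 by (simp add: \<pi>_def)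

lemma of_nat_\<pi>:
  assumes "i \<in> Y0"
  shows "of_nat (\<pi> i) = (-1 :: 'a)"
proof -
  have "of_nat (Suc (\<pi> i)) = (0::'a)" unfolding Suc_\<pi>[OF assms] of_nat_eq_0 using t_pos assms by simp
  then have "of_nat (\<pi> i) + 1 = (0::'a)" by (simp add: add.commute)
  then show ?thesis by (simp only: eq_neg_iff_add_eq_0)
qed

text \<open>The bound 4 comes from p being a prime above 3, hence at least 5.\<close>

lemma \<pi>_ge:
  assumes "i \<in> Y0"
  shows "\<pi> i \<ge> 4"
proof -
  have "p ^ 1 \<le> p ^ t i" using p3 t_pos assms by (intro power_increasing) auto
  moreover have "p \<noteq> 4" using prime_p by auto
  ultimately show ?thesis using p3 Suc_\<pi>[OF assms] by simp
qed

text \<open>One step above the top exponent the upper index is p^(t_j), whose inner binomial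
  coefficients vanish modulo p.\<close>

lemma bin_overflow:
  assumes "j \<in> Y0" "\<gamma> j = \<pi> j" "0 < \<alpha> j" "\<alpha> j \<le> \<pi> j"
  shows "of_nat (bin (\<gamma>(j := Suc (\<gamma> j))) \<alpha>) = (0::'a)"
proof -
  have "p dvd (p ^ t j choose \<alpha> j)"
    using assms Suc_\<pi>[OF assms(1)] by (intro prime_dvd_choose_prime_power prime_p) auto
  moreover have "(p ^ t j choose \<alpha> j) dvd bin (\<gamma>(j := Suc (\<gamma> j))) \<alpha>"
    unfolding bin_def using assms Suc_\<pi>[OF assms(1)]
    by (intro dvd_trans[OF _ dvd_prodI[of _ j]]) auto
  ultimately show ?thesis unfolding of_nat_eq_0 by (rule dvd_trans)
qed

text \<open>Inside \<open>A\<close> this is Pascal's rule. The critical coefficients have \<gamma>_j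
  = \<pi>_j: the product is truncated there, so the right side must vanish, either by
  \<open>bin_overflow\<close> or because \<open>g\<close> is evaluated outside
  \<open>A\<close>.\<close>

lemma der_xmon_omult0:
  fixes g :: "'a sup"
  assumes "\<alpha> \<in> A" "u \<in> B" "g \<in> O_set" "j \<in> Y0"
  shows "der j (xmon \<alpha> u \<star> g) = der j (xmon \<alpha> u) \<star> g + xmon \<alpha> u \<star> der j g"
proof
  fix c :: "(nat \<Rightarrow> nat) \<times> nat set"
  obtain \<gamma> v where c: "c = (\<gamma>, v)" by (cases c)
  let ?\<gamma> = "\<gamma>(j := Suc (\<gamma> j))" and ?\<alpha> = "\<alpha>(j := \<alpha> j - 1)"
  have jY: "j \<in> Y" using assms(4) by (simp add: Y_def)
  have \<alpha>: "?\<alpha> \<in> A" using assms(1) by (rule A_down) (auto simp: le_fun_def)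
  have O: "xmon \<alpha> u \<star> g \<in> O_set" "der j g \<in> O_set"
    using assms jY by (simp_all add: omult_O_set O_set_xmon der_O_set)
  have L: "der j (xmon \<alpha> u \<star> g) c = (if ?\<gamma> \<in> A \<and> v \<in> B \<and> u \<subseteq> v
      then of_nat (bin ?\<gamma> \<alpha>) * reord_sign u (v - u) * g (?\<gamma> - \<alpha>, v - u) else 0)"
    unfolding c der_apply0[OF assms(4) O(1)] xmon_omult_apply[OF assms(1-3)] ..
  have "\<gamma> - ?\<alpha> = ?\<gamma> - \<alpha>" if "\<alpha> j \<noteq> 0" using that by (auto simp: fun_eq_iff)
  then have R1: "(der j (xmon \<alpha> u) \<star> g) c = (if \<alpha> j \<noteq> 0 \<and> \<gamma> \<in> A \<and> v \<in> B \<and> u \<subseteq> v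
      then of_nat (bin \<gamma> ?\<alpha>) * reord_sign u (v - u) * g (?\<gamma> - \<alpha>, v - u) else 0)"
    unfolding c der_xmon0[OF assms(1,2,4)] using xmon_omult_apply[OF \<alpha> assms(2,3)] by simp
  have "of_nat (bin \<gamma> \<alpha>) = (0::'a) \<or> der j g (\<gamma> - \<alpha>, v - u) = g (?\<gamma> - \<alpha>, v - u)"
  proof (cases "\<alpha> \<le> \<gamma>")
    case True
    then have "(\<gamma> - \<alpha>)(j := Suc ((\<gamma> - \<alpha>) j)) = ?\<gamma> - \<alpha>"
      by (auto simp: fun_eq_iff le_fun_def Suc_diff_le)
    then show ?thesis by (simp add: der_apply0[OF assms(4,3)])
  qed (use bin_eq_0[OF assms(1)] in simp)
  then have R2: "(xmon \<alpha> u \<star> der j g) c = (if \<gamma> \<in> A \<and> v \<in> B \<and> u \<subseteq> v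
      then of_nat (bin \<gamma> \<alpha>) * reord_sign u (v - u) * g (?\<gamma> - \<alpha>, v - u) else 0)"
    unfolding c xmon_omult_apply[OF assms(1,2) O(2)] by auto
  have R: "(der j (xmon \<alpha> u) \<star> g + xmon \<alpha> u \<star> der j g) c = (if \<gamma> \<in> A \<and> v \<in> B \<and> u \<subseteq> v
      then of_nat (bin ?\<gamma> \<alpha>) * reord_sign u (v - u) * g (?\<gamma> - \<alpha>, v - u) else 0)"
    unfolding plus_fun_apply R1 R2 by (auto simp: bin_upd_Suc[OF assms(4)] algebra_simps)
  show "der j (xmon \<alpha> u \<star> g) c = (der j (xmon \<alpha> u) \<star> g + xmon \<alpha> u \<star> der j g) c"
  proof (cases "?\<gamma> \<in> A")
    case True
    then have "\<gamma> \<in> A" by (rule A_upd_Suc)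
    then show ?thesis unfolding L R using True by simp
  next
    case False
    have "of_nat (bin ?\<gamma> \<alpha>) = (0::'a) \<or> g (?\<gamma> - \<alpha>, v - u) = 0" if \<gamma>: "\<gamma> \<in> A"
    proof -
      have "Suc (\<gamma> j) > \<pi> j" using \<gamma> False by (auto simp: A_def split: if_splits)
      with \<gamma> have eq: "\<gamma> j = \<pi> j" by (auto simp: A_def intro: antisym)
      show ?thesis
      proof (cases "\<alpha> j = 0")
        case True
        then have "?\<gamma> - \<alpha> \<notin> A" using eq by (auto simp: A_def intro!: exI[of _ j])
        then show ?thesis using assms(3) by (simp add: O_set_iff)
      next
        case False
        then show ?thesis using bin_overflow[of j \<gamma> \<alpha>] eq assms(1,4) by (simp add: A_def)
      qed
    qed
    then show ?thesis unfolding L R using False by auto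
  qed
qed

end

context ham
begin

text \<open>A sign identity for each position of \<open>k\<close>. When \<open>k\<close> lies in
  both \<open>u\<close> and \<open>v\<close>, the left side vanishes and the two terms on the right
  cancel.\<close>

lemma der_xmon_omult1:
  fixes g :: "'a::field sup"
  assumes "\<alpha> \<in> A" "u \<in> B" "g \<in> O_set" "k \<in> Y1"
  shows "der k (xmon \<alpha> u \<star> g) =
    der k (xmon \<alpha> u) \<star> g + oscale ((-1) ^ card u) (xmon \<alpha> u \<star> der k g)"
proof
  fix c :: "(nat \<Rightarrow> nat) \<times> nat set"
  obtain \<gamma> v where c: "c = (\<gamma>, v)" by (cases c)
  have jY: "k \<in> Y" using assms(4) by (simp add: Y_def)
  have u: "u - {k} \<in> B" using assms(2) by (rule B_subset) auto
  have O: "xmon \<alpha> u \<star> g \<in> O_set" "der k g \<in> O_set"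
    using assms jY by (simp_all add: omult_O_set O_set_xmon der_O_set)
  have L: "der k (xmon \<alpha> u \<star> g) c = (if k \<notin> v \<and> \<gamma> \<in> A \<and> v \<in> B \<and> u \<subseteq> insert k v
      then of_nat (bin \<gamma> \<alpha>) * (reord_sign {k} v * reord_sign u (insert k v - u)) * g (\<gamma> - \<alpha>, insert k v - u) else 0)"
    unfolding c der_apply1[OF assms(4) O(1)] xmon_omult_apply[OF assms(1-3)] using assms(4)
    by (auto simp: B_insert)
  have R1: "(der k (xmon \<alpha> u) \<star> g) c = (if k \<in> u \<and> \<gamma> \<in> A \<and> v \<in> B \<and> u - {k} \<subseteq> v
      then of_nat (bin \<gamma> \<alpha>) * (reord_sign {k} (u - {k}) * reord_sign (u - {k}) (v - (u - {k}))) * g (\<gamma> - \<alpha>, v - (u - {k})) else 0)"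
    unfolding c der_xmon1[OF assms(1,2,4)] using xmon_omult_apply[OF assms(1) u assms(3)]
    by (simp add: omult_scale_left)
  have R2: "oscale ((-1) ^ card u) (xmon \<alpha> u \<star> der k g) c = (if k \<notin> v - u \<and> \<gamma> \<in> A \<and> v \<in> B \<and> u \<subseteq> v
      then of_nat (bin \<gamma> \<alpha>) * ((-1) ^ card u * reord_sign u (v - u) * reord_sign {k} (v - u)) * g (\<gamma> - \<alpha>, insert k (v - u)) else 0)"
    unfolding c oscale_apply xmon_omult_apply[OF assms(1,2) O(2)] by (auto simp: der_apply1[OF assms(4,3)])
  show "der k (xmon \<alpha> u \<star> g) c = (der k (xmon \<alpha> u) \<star> g + oscale ((-1) ^ card u) (xmon \<alpha> u \<star> der k g)) c"
  proof (cases "\<gamma> \<in> A \<and> v \<in> B \<and> u \<subseteq> insert k v")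
    case False
    then show ?thesis unfolding plus_fun_apply L R1 R2 by auto
  next
    case True
    have fin: "finite u" "finite v" using True assms(2) B_finite by auto
    let ?w = "u - {k}"
    consider "k \<in> u" "k \<notin> v" | "k \<in> u" "k \<in> v" | "k \<notin> u" "k \<notin> v" | "k \<notin> u" "k \<in> v" by blast
    then show ?thesis
    proof cases
      case 1
      let ?z = "v - ?w"
      have z: "insert k v - u = ?z" using 1 by auto
      have v: "v = ?w \<union> ?z" and u: "u = insert k ?w" using 1 True by auto
      have "reord_sign {k} v = (reord_sign {k} ?w * reord_sign {k} ?z :: 'a)"
        using reord_sign_union_right[of "{k}" ?w ?z] fin v by simp
      moreover have "reord_sign u ?z = (reord_sign {k} ?z * reord_sign ?w ?z :: 'a)"
        using reord_sign_insert_left[of ?w ?z k] fin u by simp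
      ultimately have "reord_sign {k} v * reord_sign u ?z = (reord_sign {k} ?w * reord_sign ?w ?z :: 'a)"
        by (simp add: mult_ac reord_sign_sq')
      then show ?thesis unfolding plus_fun_apply L R1 R2 using 1 True z by auto
    next
      case 2
      let ?y = "v - u"
      have z: "v - ?w = insert k ?y" and u: "u = insert k ?w" using 2 by auto
      have "reord_sign ?w (insert k ?y) = (reord_sign ?w {k} * reord_sign ?w ?y :: 'a)"
        using reord_sign_insert_right[of ?w ?y k] fin 2 by simp
      moreover have "reord_sign u ?y = (reord_sign {k} ?y * reord_sign ?w ?y :: 'a)"
        using reord_sign_insert_left[of ?w ?y k] fin u by simp
      moreover have "reord_sign ?w {k} = ((-1) ^ card ?w * reord_sign {k} ?w :: 'a)"
        using reord_sign_commute[of "{k}" ?w] fin by simp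
      moreover have "card u = Suc (card ?w)" using card_Suc_Diff1[of u k] 2 fin by simp
      ultimately have "reord_sign {k} ?w * reord_sign ?w (insert k ?y) +
          (-1) ^ card u * reord_sign u ?y * reord_sign {k} ?y = (0 :: 'a)"
        by (simp add: mult_ac reord_sign_sq')
      then have s: "reord_sign {k} ?w * reord_sign ?w (v - ?w) =
          - ((-1) ^ card u * reord_sign u ?y * reord_sign {k} ?y :: 'a)"
        unfolding z by (simp add: eq_neg_iff_add_eq_0)
      show ?thesis unfolding plus_fun_apply L R1 R2 s unfolding z using 2 True by auto
    next
      case 3
      let ?y = "v - u"
      have z: "insert k v - u = insert k ?y" and v: "v = u \<union> ?y" using 3 True by auto
      have "reord_sign {k} v = (reord_sign {k} u * reord_sign {k} ?y :: 'a)"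
        using reord_sign_union_right[of "{k}" u ?y] fin v by simp
      moreover have "reord_sign u (insert k ?y) = (reord_sign u {k} * reord_sign u ?y :: 'a)"
        using reord_sign_insert_right[of u ?y k] fin 3 by simp
      moreover have "reord_sign u {k} = ((-1) ^ card u * reord_sign {k} u :: 'a)"
        using reord_sign_commute[of "{k}" u] fin 3 by simp
      ultimately have "reord_sign {k} v * reord_sign u (insert k ?y) =
          ((-1) ^ card u * reord_sign u ?y * reord_sign {k} ?y :: 'a)"
        by (simp add: mult_ac reord_sign_sq')
      then show ?thesis unfolding plus_fun_apply L R1 R2 z using 3 True by auto
    next
      case 4
      then show ?thesis unfolding plus_fun_apply L R1 R2 by auto
    qed
  qed
qed

end

context ham_field
begin

lemma der_omult:
  fixes f g :: "'a sup"
  assumes "f \<in> O_par r" "g \<in> O_set" "j \<in> Y"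
  shows "der j (f \<star> g) = der j f \<star> g + oscale ((-1) ^ (\<mu> j * r)) (f \<star> der j g)"
proof -
  have "f \<in> ovec.span {xmon \<alpha> u |\<alpha> u. \<alpha> \<in> A \<and> u \<in> B \<and> card u mod 2 = r}"
    using assms(1) by (simp add: O_par_def)
  then show ?thesis
  proof (induction rule: ovec.span_induct_alt)
    case (step c x y)
    then obtain \<alpha> u where x: "x = xmon \<alpha> u" "\<alpha> \<in> A" "u \<in> B" "card u mod 2 = r" by auto
    have IH: "der j (y \<star> g) = der j y \<star> g + oscale ((-1) ^ (\<mu> j * r)) (y \<star> der j g)" by (rule step(2))
    have "even (card u) \<longleftrightarrow> even r" unfolding x(4)[symmetric] by simp
    then have "(-1) ^ card u = ((-1) ^ r :: 'a)" by (simp add: minus_one_power_iff)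
    then have xg: "der j (x \<star> g) = der j x \<star> g + oscale ((-1) ^ (\<mu> j * r)) (x \<star> der j g)"
      unfolding x(1) using assms(3) der_xmon_omult0[OF x(2,3) assms(2)] der_xmon_omult1[OF x(2,3) assms(2)]
      by (auto simp: Y_cases)
    have "der j ((oscale c x + y) \<star> g) =
        der j (oscale c x + y) \<star> g + oscale ((-1) ^ (\<mu> j * r)) ((oscale c x + y) \<star> der j g)"
      unfolding omult_add_left der_add omult_scale_left der_oscale IH xg
      by (simp add: ovec.scale_right_distrib mult.commute)
    then show ?case .
  next
    case base
    have "der j (0 \<star> g) = der j 0 \<star> g + oscale ((-1) ^ (\<mu> j * r)) (0 \<star> der j g)" by simp
    then show ?case .
  qed
qed

lemma pb_O_par:
  fixes f g :: "'a sup"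
  assumes "f \<in> O_par 0" "g \<in> O_par 0"
  shows "pb f g \<in> O_par 0"
  unfolding pb_def
proof (intro O_par_sum O_par_oscale)
  fix i assume i: "i \<in> Y"
  have "der i f \<in> O_par (\<mu> i)" "der (prm i) g \<in> O_par (\<mu> i)"
    using der_O_par[OF i assms(1)] der_O_par[OF prm_simps(3)[OF i] assms(2)] i \<mu>_cases[of i] by auto
  from omult_O_par[OF this] show "der i f \<star> der (prm i) g \<in> O_par 0" by simp
qed

text \<open>The Leibniz rule splits \<partial>_l of the Poisson bracket into terms with second
  derivatives of \<open>f\<close> and terms with second derivatives of \<open>g\<close>. These are
  the two halves of the bracket in W, the latter after replacing i by i'.\<close>

lemma bracket_D\<^sub>H:
  fixes f g :: "'a sup"
  assumes "f \<in> O_par 0" "g \<in> O_par 0"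
  shows "bracket (D\<^sub>H f) (D\<^sub>H g) = D\<^sub>H (pb f g)"
proof
  fix j
  note W = D\<^sub>H_W_even[OF assms(1)] D\<^sub>H_W_even[OF assms(2)]
  note fO = O_par_O_set[OF assms(1)] and gO = O_par_O_set[OF assms(2)]
  show "bracket (D\<^sub>H f) (D\<^sub>H g) j = D\<^sub>H (pb f g) j"
  proof (cases "j \<in> Y")
    case True
    define l where "l = prm j"
    have l: "l \<in> Y" using True by (simp add: l_def prm_simps)
    have par: "der i f \<in> O_par (\<mu> i)" "der i g \<in> O_par (\<mu> i)" if "i \<in> Y" for i
      using der_O_par[OF that assms(1)] der_O_par[OF that assms(2)] \<mu>_cases[of i] by auto
    have trm: "der l (der i f \<star> der (prm i) g) =
        oscale ((-1) ^ (\<mu> i)) (der (prm i) g \<star> der i (der l f)) + der i f \<star> der (prm i) (der l g)"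
      if i: "i \<in> Y" for i
    proof -
      note i' = prm_simps(3)[OF i]
      have sq: "(-1) ^ (\<mu> l * \<mu> i) * (-1) ^ (\<mu> l * \<mu> i) = (1::'a)" by (rule neg_one_power_sq)
      have 1: "der l (der i f) = oscale ((-1) ^ (\<mu> l * \<mu> i)) (der i (der l f))"
        by (rule der_commute[OF l i fO])
      have 2: "der l (der (prm i) g) = oscale ((-1) ^ (\<mu> l * \<mu> i)) (der (prm i) (der l g))"
        using der_commute[OF l i' gO] i by simp
      have "der i (der l f) \<in> O_par ((\<mu> l + \<mu> i) mod 2)"
        using der_O_par[OF i par(1)[OF l]] \<mu>_cases[of l] by auto
      from omult_commute[OF par(2)[OF i'] this]
      have 3: "der i (der l f) \<star> der (prm i) g =
          oscale ((-1) ^ (\<mu> i * ((\<mu> l + \<mu> i) mod 2))) (der (prm i) g \<star> der i (der l f))"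
        using i by simp
      have s: "(-1) ^ (\<mu> l * \<mu> i) * (-1) ^ (\<mu> i * ((\<mu> l + \<mu> i) mod 2)) = ((-1) ^ \<mu> i :: 'a)"
        using \<mu>_cases[of l] \<mu>_cases[of i] by auto
      have "der l (der i f \<star> der (prm i) g) =
          der l (der i f) \<star> der (prm i) g + oscale ((-1) ^ (\<mu> l * \<mu> i)) (der i f \<star> der l (der (prm i) g))"
        by (rule der_omult[OF par(1)[OF i] der_O_set[OF i' gO] l])
      also have "\<dots> = oscale ((-1) ^ (\<mu> l * \<mu> i) * (-1) ^ (\<mu> i * ((\<mu> l + \<mu> i) mod 2))) (der (prm i) g \<star> der i (der l f))
          + oscale ((-1) ^ (\<mu> l * \<mu> i) * (-1) ^ (\<mu> l * \<mu> i)) (der i f \<star> der (prm i) (der l g))"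
        unfolding 1 2 omult_scale_left omult_scale_right 3 by (simp only: ovec.scale_scale)
      finally show ?thesis unfolding s sq by (simp only: ovec.scale_one)
    qed
    \<comment> \<open>The form is alternating on the even variables and symmetric on the odd ones;
      this one rule covers both and yields the minus sign of the bracket.\<close>
    have ts: "\<tau> i * (-1) ^ \<mu> i = (- \<tau> (prm i) :: 'a)" if "i \<in> Y" for i
      using that by (auto simp: Y_cases \<tau>_simps prm_simps)
    have "D\<^sub>H (pb f g) j = oscale (\<tau> l) (\<Sum>i\<in>Y. oscale (\<tau> i) (der l (der i f \<star> der (prm i) g)))"
      using True by (simp add: D\<^sub>H_even[OF pb_O_par[OF assms]] flip: l_def) (simp add: pb_def der_sum der_oscale)
    also have "\<dots> = oscale (\<tau> l) (\<Sum>i\<in>Y. oscale (\<tau> i) (der i f \<star> der (prm i) (der l g))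
        - oscale (\<tau> (prm i)) (der (prm i) g \<star> der i (der l f)))"
      by (rule arg_cong[of _ _ "oscale (\<tau> l)"], rule sum.cong)
        (auto simp: trm ovec.scale_right_distrib ts)
    also have "\<dots> = oscale (\<tau> l) ((\<Sum>i\<in>Y. oscale (\<tau> i) (der i f \<star> der (prm i) (der l g)))
        - (\<Sum>i\<in>Y. oscale (\<tau> (prm i)) (der (prm i) g \<star> der i (der l f))))"
      by (simp only: sum_subtractf)
    also have "(\<Sum>i\<in>Y. oscale (\<tau> i) (der i f \<star> der (prm i) (der l g))) =
        (\<Sum>i\<in>Y. oscale (\<tau> (prm i)) (der (prm i) f \<star> der i (der l g)))"
      by (subst sum.reindex_bij_betw[OF bij_prm(1), symmetric]) (rule sum.cong; simp add: prm_simps)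
    also have "oscale (\<tau> l) ((\<Sum>i\<in>Y. oscale (\<tau> (prm i)) (der (prm i) f \<star> der i (der l g)))
        - (\<Sum>i\<in>Y. oscale (\<tau> (prm i)) (der (prm i) g \<star> der i (der l f)))) =
      (\<Sum>i\<in>Y. D\<^sub>H f i \<star> der i (D\<^sub>H g j) - D\<^sub>H g i \<star> der i (D\<^sub>H f j))"
      using True
      by (simp add: D\<^sub>H_even assms omult_scale_left omult_scale_right der_oscale mult.commute
          sum_subtractf ovec.scale_right_diff_distrib ovec.scale_sum_right flip: l_def)
    also have "\<dots> = bracket (D\<^sub>H f) (D\<^sub>H g) j" using True by (simp add: bracket_even[OF W])
    finally show ?thesis ..
  next
    case False
    then show ?thesis by (simp add: bracket_even[OF W] D\<^sub>H_even[OF pb_O_par[OF assms]])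
  qed
qed

end

subsection \<open>Constant parts of brackets\<close>

definition ee :: "nat \<Rightarrow> nat \<Rightarrow> nat \<Rightarrow> nat"
  where "ee a c = (\<lambda>_. 0)(a := c)"

lemma ee_apply [simp]: "ee a c i = (if i = a then c else 0)"
  by (simp add: ee_def)

lemma eps_apply [simp]: "eps a i = (if i = a then 1 else 0)"
  by (simp add: eps_def)

lemma eps_nonzero [simp]: "eps a \<noteq> 0" "0 \<noteq> eps a"
  by (auto simp: fun_eq_iff)

lemma eps_inject [simp]: "eps a = eps b \<longleftrightarrow> a = b"
  by (auto simp: fun_eq_iff split: if_splits)

lemma ee_0 [simp]: "ee a 0 = 0"
  by (simp add: ee_def fun_eq_iff)

lemma ee_inject: "c > 0 \<Longrightarrow> ee a c = ee b d \<longleftrightarrow> a = b \<and> c = d"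
  by (auto simp: fun_eq_iff split: if_splits)

lemma ee_add_eq: "eps a + eps b = eps i + eps j \<longleftrightarrow> (i = a \<and> j = b) \<or> (i = b \<and> j = a)"
proof
  assume eq: "eps a + eps b = eps i + eps j"
  then have "eps a i + eps b i = eps i i + eps j i" by (metis plus_fun_apply)
  then consider "i = a" | "i = b" by (auto split: if_splits)
  then show "(i = a \<and> j = b) \<or> (i = b \<and> j = a)"
  proof cases
    case 1
    then show ?thesis using eq by simp
  next
    case 2
    then have "eps b + eps a = eps b + eps j" using eq by (simp add: add.commute)
    then show ?thesis using 2 by simp
  qed
qed (auto simp: add.commute)

context ham
begin

text \<open>Left multiplication by \<open>x\<^sup>u\<close> on the constant parts, which are functions of the exterior index only.\<close>
definition ml :: "nat set \<Rightarrow> (nat set \<Rightarrow> 'a::field) \<Rightarrow> nat set \<Rightarrow> 'a"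
  where "ml u F v = (if u \<subseteq> v \<and> v \<in> B then reord_sign u (v - u) * F (v - u) else 0)"

abbreviation cst :: "'a sup \<Rightarrow> nat set \<Rightarrow> 'a" where "cst f \<equiv> (\<lambda>v. f (0, v))"

lemma ml_scale: "ml u (\<lambda>v. c * F v) v = c * ml u F v"
  by (simp add: ml_def)

lemma ml_zero [simp]: "ml u (\<lambda>v. 0) v = 0"
  by (simp add: ml_def)

lemma ml_empty: "v \<in> B \<Longrightarrow> ml {} F v = F v"
  by (simp add: ml_def)

lemma bin_0_left: "\<alpha> \<in> A \<Longrightarrow> bin 0 \<alpha> = (if \<alpha> = 0 then 1 else 0)"
proof (cases "\<alpha> = 0")
  case False
  then have "\<not> \<alpha> \<le> 0" by (auto simp: le_fun_def fun_eq_iff)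
  then show "\<alpha> \<in> A \<Longrightarrow> ?thesis" using bin_eq_0[of \<alpha> 0] False by simp
qed simp

lemma xmon_omult_cst:
  assumes "\<alpha> \<in> A" "u \<in> B" "f \<in> O_set"
  shows "(xmon \<alpha> u \<star> f) (0, v) = (if \<alpha> = 0 then ml u (cst f) v else 0)"
  using assms by (auto simp: xmon_omult_apply ml_def bin_0_left)

lemma omult_xmon_right:
  assumes "f \<in> O_par r" "\<alpha> \<in> A" "u \<in> B"
  shows "f \<star> xmon \<alpha> u = oscale ((-1) ^ (r * card u)) (xmon \<alpha> u \<star> f)"
proof -
  have "(-1) ^ (card u mod 2 * r) = ((-1) ^ (r * card u) :: 'a)"
    by (simp add: minus_one_power_iff)
  then show ?thesis
    using omult_commute[OF O_par_xmon[OF assms(2,3) refl] assms(1)] by simp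
qed

lemma B0_B: "u \<in> B0 \<Longrightarrow> u \<in> B"
  by (simp add: B0_def)

lemma O_par_xmon_B0: "\<alpha> \<in> A \<Longrightarrow> u \<in> B0 \<Longrightarrow> xmon \<alpha> u \<in> O_par 0"
  by (rule O_par_xmon) (auto simp: B0_def)

lemma B0_empty [simp]: "{} \<in> B0" by (simp add: B0_def)

lemma D\<^sub>H_xmon:
  assumes "\<alpha> \<in> A" "u \<in> B0"
  shows "D\<^sub>H (xmon \<alpha> u) j =
    (if j \<in> Y0 \<and> \<alpha> (prm j) \<noteq> 0 then oscale (\<tau> (prm j)) (xmon (\<alpha>(prm j := \<alpha> (prm j) - 1)) u)
     else if j \<in> Y1 \<and> j \<in> u then oscale (reord_sign {j} (u - {j})) (xmon \<alpha> (u - {j})) else 0)"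
  using assms B0_B[OF assms(2)]
  by (auto simp: D\<^sub>H_even[OF O_par_xmon_B0] Y_cases der_xmon0 der_xmon1 prm_simps \<tau>_simps Y_disjoint
      dest: Y_disjoint)

lemma sub_eq_0_iff: "\<alpha> i \<noteq> 0 \<Longrightarrow> \<alpha>(i := \<alpha> i - 1) = 0 \<longleftrightarrow> \<alpha> = eps i"
  by (auto simp: fun_eq_iff)

lemma A_upd_dec: "\<alpha> \<in> A \<Longrightarrow> \<alpha>(i := \<alpha> i - 1) \<in> A"
  by (erule A_down) (auto simp: le_fun_def)

lemma D\<^sub>H_omult_cst:
  assumes "\<alpha> \<in> A" "u \<in> B0" "g \<in> O_set" "i \<in> Y"
  shows "(D\<^sub>H (xmon \<alpha> u) i \<star> g) (0, v) =
    (if i \<in> Y0 then if \<alpha> = eps (prm i) then \<tau> (prm i) * ml u (cst g) v else 0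
     else if \<alpha> = 0 \<and> i \<in> u then reord_sign {i} (u - {i}) * ml (u - {i}) (cst g) v else 0)"
proof -
  have uB: "u \<in> B" "u - {i} \<in> B" using B0_B[OF assms(2)] by (auto intro: B_subset)
  have n: "\<alpha> \<noteq> eps (prm i)" if "\<alpha> (prm i) = 0" using that by auto
  have "(xmon (\<alpha>(prm i := \<alpha> (prm i) - 1)) u \<star> g) (0, v) =
      (if \<alpha> = eps (prm i) then ml u (cst g) v else 0)" if "\<alpha> (prm i) \<noteq> 0"
    using xmon_omult_cst[OF A_upd_dec[OF assms(1)] uB(1) assms(3)] sub_eq_0_iff[of \<alpha> "prm i"] that by simp
  then show ?thesis
    using assms uB n xmon_omult_cst[OF assms(1) uB(2) assms(3)]
    by (auto simp: D\<^sub>H_xmon omult_scale_left Y_cases Y_disjoint)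
qed

text \<open>The last assumption sets aside an odd component of \<open>E\<close> acting on a
  coefficient that is constant in the even variables. Where the lemma is applied, either \<alpha> is
  no unit vector or those components have zero constant part.\<close>

lemma omult_der_D\<^sub>H_cst:
  assumes "\<alpha> \<in> A" "u \<in> B0" "E \<in> W_even" "i \<in> Y" "j \<in> Y"
    and "i \<in> Y1 \<and> j \<in> Y0 \<and> \<alpha> = eps (prm j) \<longrightarrow> (\<forall>v. E i (0, v) = 0)"
  shows "(E i \<star> der i (D\<^sub>H (xmon \<alpha> u) j)) (0, v) =
    (if i \<in> Y0 then
       if j \<in> Y0 then if \<alpha> = eps i + eps (prm j) then \<tau> (prm j) * ml u (cst (E i)) v else 0
       else if \<alpha> = eps i \<and> j \<in> u then reord_sign {j} (u - {j}) * ml (u - {j}) (cst (E i)) v else 0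
     else if j \<in> Y1 \<and> \<alpha> = 0 \<and> i \<noteq> j \<and> i \<in> u \<and> j \<in> u
     then reord_sign {j} (u - {j}) * reord_sign {i} (u - {j} - {i}) * ml (u - {j} - {i}) (cst (E i)) v else 0)"
proof -
  note E = W_even_O_par[OF assms(3,4)]
  note EO = O_par_O_set[OF E]
  have uB: "u \<in> B" "u - {k} \<in> B" "u - {k} - {l} \<in> B" for k l
    using B0_B[OF assms(2)] by (auto intro: B_subset)
  have ev: "even (card u)" "finite u" using assms(2) B_finite by (auto simp: B0_def)
  show ?thesis
  proof (cases "i \<in> Y0")
    case i: True
    have *: "E i \<star> xmon \<beta> w = xmon \<beta> w \<star> E i" if "\<beta> \<in> A" "w \<in> B" for \<beta> w
      using omult_xmon_right[OF E that] i by simp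
    show ?thesis
    proof (cases "j \<in> Y0")
      case True
      let ?l = "prm j"
      let ?\<beta> = "\<alpha>(?l := \<alpha> ?l - 1)"
      have l: "?l \<in> Y0" using True by (rule prm_simps)
      have eq: "\<alpha> ?l \<noteq> 0 \<and> ?\<beta> i \<noteq> 0 \<and> ?\<beta>(i := ?\<beta> i - 1) = 0 \<longleftrightarrow> \<alpha> = eps i + eps ?l"
      proof
        assume "\<alpha> ?l \<noteq> 0 \<and> ?\<beta> i \<noteq> 0 \<and> ?\<beta>(i := ?\<beta> i - 1) = 0"
        then have l0: "\<alpha> ?l \<noteq> 0" and \<beta>: "?\<beta> = eps i" using sub_eq_0_iff[of ?\<beta> i] by auto
        have "\<alpha> = ?\<beta> + eps ?l" by (rule ext) (use l0 in auto)
        then show "\<alpha> = eps i + eps ?l" unfolding \<beta> .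
      qed (auto simp: fun_eq_iff)
      have \<beta>A: "?\<beta> \<in> A" using assms(1) by (rule A_upd_dec)
      have "(E i \<star> der i (D\<^sub>H (xmon \<alpha> u) j)) (0, v) =
        (if \<alpha> ?l \<noteq> 0 \<and> ?\<beta> i \<noteq> 0 then \<tau> ?l * (xmon (?\<beta>(i := ?\<beta> i - 1)) u \<star> E i) (0, v) else 0)"
        using True Y_disjoint(1)[OF True] i uB \<beta>A assms(1,2) A_upd_dec[OF \<beta>A, of i]
        by (simp add: D\<^sub>H_xmon der_oscale der_xmon0 omult_scale_right * del: fun_upd_apply)
      also have "\<dots> = (if \<alpha> ?l \<noteq> 0 \<and> ?\<beta> i \<noteq> 0 \<and> ?\<beta>(i := ?\<beta> i - 1) = 0 then \<tau> ?l * ml u (cst (E i)) v else 0)"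
        unfolding xmon_omult_cst[OF A_upd_dec[OF \<beta>A, of i] uB(1) EO] by (simp del: fun_upd_apply)
      finally show ?thesis unfolding eq using True i by simp
    next
      case False
      then have j: "j \<in> Y1" using assms(5) by (simp add: Y_cases)
      have "(E i \<star> der i (D\<^sub>H (xmon \<alpha> u) j)) (0, v) =
        (if j \<in> u \<and> \<alpha> i \<noteq> 0 then reord_sign {j} (u - {j}) * (xmon (\<alpha>(i := \<alpha> i - 1)) (u - {j}) \<star> E i) (0, v) else 0)"
        using False i j uB assms(1,2) A_upd_dec[OF assms(1), of i]
        by (simp add: D\<^sub>H_xmon der_oscale der_xmon0 omult_scale_right * del: fun_upd_apply)
      also have "\<dots> = (if j \<in> u \<and> \<alpha> i \<noteq> 0 \<and> \<alpha>(i := \<alpha> i - 1) = 0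
          then reord_sign {j} (u - {j}) * ml (u - {j}) (cst (E i)) v else 0)"
        unfolding xmon_omult_cst[OF A_upd_dec[OF assms(1), of i] uB(2) EO] by (simp del: fun_upd_apply)
      also have "\<dots> = (if \<alpha> = eps i \<and> j \<in> u
          then reord_sign {j} (u - {j}) * ml (u - {j}) (cst (E i)) v else 0)"
        using sub_eq_0_iff[of \<alpha> i] by auto
      finally show ?thesis using False i by simp
    qed
  next
    case False
    then have i: "i \<in> Y1" using assms(4) by (simp add: Y_cases)
    have Ei: "E i \<in> O_par 1" using E i by simp
    show ?thesis
    proof (cases "j \<in> Y0")
      case True
      let ?l = "prm j"
      let ?\<beta> = "\<alpha>(?l := \<alpha> ?l - 1)"
      have \<beta>A: "?\<beta> \<in> A" using assms(1) by (rule A_upd_dec)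
      have "(E i \<star> der i (D\<^sub>H (xmon \<alpha> u) j)) (0, v) =
        (if \<alpha> ?l \<noteq> 0 \<and> i \<in> u then \<tau> ?l * (reord_sign {i} (u - {i}) * ((-1) ^ card (u - {i}) *
           (xmon ?\<beta> (u - {i}) \<star> E i) (0, v))) else 0)"
        using True Y_disjoint(1)[OF True] i uB \<beta>A assms(1,2)
        by (simp add: D\<^sub>H_xmon der_oscale der_xmon1 omult_scale_right omult_xmon_right[OF Ei] del: fun_upd_apply)
      also have "\<dots> = 0"
      proof (cases "\<alpha> = eps ?l")
        case True
        then show ?thesis using assms(6) i \<open>j \<in> Y0\<close> uB \<beta>A EO
          by (simp add: xmon_omult_cst del: fun_upd_apply)
      next
        case False
        then show ?thesis using sub_eq_0_iff[of \<alpha> ?l] uB \<beta>A EO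
          by (auto simp: xmon_omult_cst simp del: fun_upd_apply)
      qed
      finally show ?thesis using i True by (simp add: Y_disjoint)
    next
      case False
      then have j: "j \<in> Y1" using assms(5) by (simp add: Y_cases)
      have c: "card (u - {j} - {i}) = card u - 2" if "i \<noteq> j" "i \<in> u" "j \<in> u"
        using that ev by (simp add: card_Diff_singleton)
      have "even (card (u - {j} - {i}))" if "i \<noteq> j" "i \<in> u" "j \<in> u"
        unfolding c[OF that] using ev by simp
      then have "(E i \<star> der i (D\<^sub>H (xmon \<alpha> u) j)) (0, v) =
        (if j \<in> u \<and> i \<in> u \<and> i \<noteq> j then reord_sign {j} (u - {j}) * (reord_sign {i} (u - {j} - {i}) *
           (xmon \<alpha> (u - {j} - {i}) \<star> E i) (0, v)) else 0)"
        using False i j uB assms(1,2)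
        by (auto simp add: D\<^sub>H_xmon der_oscale der_xmon1 omult_scale_right omult_xmon_right[OF Ei])
      then show ?thesis using i j uB EO assms(1) by (auto simp: xmon_omult_cst Y_disjoint)
    qed
  qed
qed

definition bk :: "(nat \<Rightarrow> nat) \<Rightarrow> nat set \<Rightarrow> 'a::field witt \<Rightarrow> nat \<Rightarrow> nat set \<Rightarrow> 'a"
  where "bk \<alpha> u E j v = bracket (D\<^sub>H (xmon \<alpha> u)) E j (0, v)"

lemma bk_sum:
  assumes "\<alpha> \<in> A" "u \<in> B0" "E \<in> W_even"
  shows "bk \<alpha> u E j v = (if j \<in> Y then
      (\<Sum>i\<in>Y. (D\<^sub>H (xmon \<alpha> u) i \<star> der i (E j)) (0, v)) - (\<Sum>i\<in>Y. (E i \<star> der i (D\<^sub>H (xmon \<alpha> u) j)) (0, v)) else 0)"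
  unfolding bk_def bracket_even[OF D\<^sub>H_W_even[OF O_par_xmon_B0[OF assms(1,2)]] assms(3)]
  by (simp add: sum_subtractf sum_fun_apply)

lemma bk_outside:
  assumes "\<alpha> \<in> A" "u \<in> B0" "E \<in> W_even" "j \<notin> Y"
  shows "bk \<alpha> u E j v = 0"
  using assms by (simp add: bk_sum)

lemma bk_zero_right:
  assumes "\<alpha> \<in> A" "u \<in> B0"
  shows "bk \<alpha> u 0 j v = (0 :: 'a::field)"
proof -
  have "(0 :: 'a witt) \<in> W_even" by (rule W_evenI) auto
  from bk_sum[OF assms this, of j v] show ?thesis by simp
qed

lemma sum_Y: "sum f Y = sum f Y0 + sum f Y1"
  unfolding Y_def by (rule sum.union_disjoint) (auto dest: Y_disjoint)

text \<open>From degree 2 on, the coefficients of \<open>D\<^sub>H (xmon \<alpha> u)\<close> have no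
  constant part, so only \<open>E\<close> acting on them remains. One derivative reaches a constant
  only from a coefficient linear in the even variables, that is, for quadratic \<alpha>.\<close>

lemma bk_degree_ge2:
  assumes "\<alpha> \<in> A" "u \<in> B0" "E \<in> W_even" "sum \<alpha> Y0 \<ge> 2"
  shows "bk \<alpha> u E j v = (if j \<in> Y0 then
    - (\<Sum>i\<in>Y0. if \<alpha> = eps i + eps (prm j) then \<tau> (prm j) * ml u (cst (E i)) v else 0) else 0)"
proof (cases "j \<in> Y")
  case True
  have n: "\<alpha> \<noteq> 0" "\<And>i. i \<in> Y0 \<Longrightarrow> \<alpha> \<noteq> eps i"
    using assms(4) by auto
  have n2: "\<alpha> \<noteq> eps (prm i)" if "i \<in> Y0" for i using n(2)[OF prm_simps(1)[OF that]] .
  have O: "der i (E j) \<in> O_set" if "i \<in> Y" for i by (rule der_O_set[OF that W_even_O_set[OF assms(3)]])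
  have 1: "(\<Sum>i\<in>Y. (D\<^sub>H (xmon \<alpha> u) i \<star> der i (E j)) (0, v)) = 0"
    by (rule sum.neutral) (auto simp: D\<^sub>H_omult_cst[OF assms(1,2) O] n(1) dest: n2)
  have "(\<Sum>i\<in>Y. (E i \<star> der i (D\<^sub>H (xmon \<alpha> u) j)) (0, v)) =
      (\<Sum>i\<in>Y. if i \<in> Y0 \<and> j \<in> Y0 \<and> \<alpha> = eps i + eps (prm j) then \<tau> (prm j) * ml u (cst (E i)) v else 0)"
  proof (rule sum.cong, goal_cases)
    case (2 i)
    have "i \<in> Y1 \<and> j \<in> Y0 \<and> \<alpha> = eps (prm j) \<longrightarrow> (\<forall>v. E i (0, v) = 0)" using n2 by blast
    note eq = omult_der_D\<^sub>H_cst[OF assms(1-3) 2 True this, of v]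
    show ?case unfolding eq using n(1) n(2)[of i] by (cases "i \<in> Y0") simp_all
  qed simp
  also have "\<dots> = (if j \<in> Y0 then
      \<Sum>i\<in>Y0. if \<alpha> = eps i + eps (prm j) then \<tau> (prm j) * ml u (cst (E i)) v else 0 else 0)"
    unfolding sum_Y by (auto simp: Y_disjoint intro!: sum.cong sum.neutral)
  finally show ?thesis using True by (simp add: bk_sum[OF assms(1-3)] 1)
qed (use assms in \<open>simp add: bk_outside Y_cases\<close>)

text \<open>Now all coefficients have degree at least 2 in the even variables, and one derivative
  does not reach a constant. Most vanishing results below rest on this.\<close>

lemma bk_degree_ge3:
  assumes "\<alpha> \<in> A" "u \<in> B0" "E \<in> W_even" "sum \<alpha> Y0 \<ge> 3"
  shows "bk \<alpha> u E j v = 0"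
proof -
  have "sum (eps i + eps (prm j)) Y0 \<le> 2" for i
    by (simp add: sum.distrib)
  then have "\<alpha> \<noteq> eps i + eps (prm j)" for i using assms(4)
    by (metis (no_types, lifting) Suc_1 eval_nat_numeral(3) not_less_eq_eq)
  then show ?thesis using bk_degree_ge2[of \<alpha> u E j v] assms by simp
qed

lemma bk_two:
  assumes "eps a + eps b \<in> A" "u \<in> B0" "E \<in> W_even" "a \<in> Y0" "b \<in> Y0"
  shows "bk (eps a + eps b) u E j v =
    - (if j = prm b then \<tau> b * ml u (cst (E a)) v else 0)
    - (if a \<noteq> b \<and> j = prm a then \<tau> a * ml u (cst (E b)) v else 0)"
proof -
  have s: "sum (eps a + eps b) Y0 \<ge> 2"
    using assms(4,5) by (simp add: sum.distrib)
  have "(\<Sum>i\<in>Y0. if eps a + eps b = eps i + eps (prm j) then \<tau> (prm j) * ml u (cst (E i)) v else 0)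
    = (if j = prm b then \<tau> b * ml u (cst (E a)) v else 0)
    + (if a \<noteq> b \<and> j = prm a then \<tau> a * ml u (cst (E b)) v else 0)" (is "?L = _") if j: "j \<in> Y0"
  proof -
    have "?L = (\<Sum>i\<in>Y0. (if i = a then if j = prm b then \<tau> b * ml u (cst (E a)) v else 0 else 0)
      + (if i = b then if a \<noteq> b \<and> j = prm a then \<tau> a * ml u (cst (E b)) v else 0 else 0))"
    proof (rule sum.cong, goal_cases)
      case (2 i)
      have "prm j = b \<longleftrightarrow> j = prm b" "prm j = a \<longleftrightarrow> j = prm a" using prm_eq_iff j assms by auto
      then show ?case unfolding ee_add_eq by auto
    qed simp
    then show ?thesis using assms(4,5) by (simp add: sum.distrib)
  qed
  moreover have "j \<in> Y0" if "j = prm a \<or> j = prm b" using that assms prm_simps(1) by auto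
  ultimately show ?thesis unfolding bk_degree_ge2[OF assms(1-3) s] by auto
qed

lemma bk_one:
  assumes "eps a \<in> A" "u \<in> B0" "E \<in> W_even" "a \<in> Y0" "\<And>k v. k \<in> Y1 \<Longrightarrow> E k (0, v) = 0"
  shows "bk (eps a) u E j v =
    \<tau> a * ml u (\<lambda>v. E j (eps (prm a), v)) v
    - (if j \<in> u then reord_sign {j} (u - {j}) * ml (u - {j}) (cst (E a)) v else 0)"
proof (cases "j \<in> Y")
  case True
  have O: "der i (E j) \<in> O_set" if "i \<in> Y" for i by (rule der_O_set[OF that W_even_O_set[OF assms(3)]])
  have uY: "j \<in> u \<Longrightarrow> j \<in> Y1" using B0_B[OF assms(2)] by (auto simp: B_def)
  have pa: "prm a \<in> Y0" "prm (prm a) = a" using assms(4) prm_simps by (auto simp: Y_def)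
  have not2: "eps a \<noteq> eps i + eps (prm j)" for i
  proof
    assume eq: "eps a = eps i + eps (prm j)"
    show False using fun_cong[OF eq, of i] fun_cong[OF eq, of "prm j"] by (auto split: if_splits)
  qed
  have 1: "(\<Sum>i\<in>Y. (D\<^sub>H (xmon (eps a) u) i \<star> der i (E j)) (0, v)) =
      (\<Sum>i\<in>Y. if i = prm a then \<tau> a * ml u (cst (der (prm a) (E j))) v else 0)"
  proof (rule sum.cong, goal_cases)
    case (2 i)
    have "a = prm i \<longleftrightarrow> i = prm a" if "i \<in> Y0" using prm_eq_iff[OF that assms(4)] by auto
    then show ?case using 2 pa Y_disjoint by (auto simp: D\<^sub>H_omult_cst[OF assms(1,2) O])
  qed simp
  have d: "cst (der (prm a) (E j)) = (\<lambda>v. E j (eps (prm a), v))"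
  proof
    fix v
    have "(0::nat \<Rightarrow> nat)(prm a := Suc (0 (prm a))) = eps (prm a)" by (simp add: fun_eq_iff)
    then show "der (prm a) (E j) (0, v) = E j (eps (prm a), v)"
      unfolding der_apply0[OF pa(1) W_even_O_set[OF assms(3)]] by simp
  qed
  have 2: "(\<Sum>i\<in>Y. (E i \<star> der i (D\<^sub>H (xmon (eps a) u) j)) (0, v)) =
      (\<Sum>i\<in>Y. if i = a then if j \<in> u then reord_sign {j} (u - {j}) * ml (u - {j}) (cst (E a)) v else 0 else 0)"
  proof (rule sum.cong, goal_cases)
    case (2 i)
    have "j \<in> u \<Longrightarrow> j \<notin> Y0" "i = a \<Longrightarrow> i \<in> Y0" using uY Y_disjoint assms(4) by auto
    moreover have "i \<in> Y1 \<and> j \<in> Y0 \<and> eps a = eps (prm j) \<longrightarrow> (\<forall>v. E i (0, v) = 0)"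
      using assms(5) by blast
    note eq = omult_der_D\<^sub>H_cst[of "eps a" u E i j v, OF assms(1-3) 2 True this]
    ultimately show ?case unfolding eq using not2[of i] by auto
  qed simp
  have "a \<in> Y" "prm a \<in> Y" using assms(4) pa by (auto simp: Y_def)
  then show ?thesis using True unfolding bk_sum[OF assms(1-3)] 1 2 d by simp
next
  case False
  have "j \<notin> u" using B0_B[OF assms(2)] False by (auto simp: B_def Y_def)
  moreover have "E j = 0" using W_even_outside[OF assms(3) False] .
  ultimately show ?thesis using assms False by (simp add: bk_outside)
qed

lemma bk_zero:
  assumes "u \<in> B0" "E \<in> W_even"
  shows "bk 0 u E j v = (\<Sum>k\<in>u. reord_sign {k} (u - {k}) * ml (u - {k}) (cst (der k (E j))) v)
    - (if j \<in> u then \<Sum>k\<in>u - {j}. reord_sign {j} (u - {j}) * reord_sign {k} (u - {j} - {k}) *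
         ml (u - {j} - {k}) (cst (E k)) v else 0)"
proof (cases "j \<in> Y")
  case True
  have O: "der i (E j) \<in> O_set" if "i \<in> Y" for i by (rule der_O_set[OF that W_even_O_set[OF assms(2)]])
  have uY: "u \<subseteq> Y1" "finite u" using B0_B[OF assms(1)] B_finite by (auto simp: B_def)
  have not2: "0 \<noteq> eps i + eps (prm j)" for i by (auto simp: fun_eq_iff)
  have 1: "(\<Sum>i\<in>Y. (D\<^sub>H (xmon 0 u) i \<star> der i (E j)) (0, v)) =
      (\<Sum>i\<in>Y. if i \<in> u then reord_sign {i} (u - {i}) * ml (u - {i}) (cst (der i (E j))) v else 0)"
  proof (rule sum.cong, goal_cases)
    case (2 i)
    show ?case using 2 uY Y_disjoint
      by (auto simp: D\<^sub>H_omult_cst[OF zero_in_A(1) assms(1) O])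
  qed simp
  have 2: "(\<Sum>i\<in>Y. (E i \<star> der i (D\<^sub>H (xmon 0 u) j)) (0, v)) =
      (\<Sum>i\<in>Y. if i \<in> u - {j} then if j \<in> u then reord_sign {j} (u - {j}) * reord_sign {i} (u - {j} - {i}) *
         ml (u - {j} - {i}) (cst (E i)) v else 0 else 0)"
  proof (rule sum.cong, goal_cases)
    case (2 i)
    have "(E i \<star> der i (D\<^sub>H (xmon 0 u) j)) (0, v) =
    (if i \<in> Y0 then
       if j \<in> Y0 then if 0 = eps i + eps (prm j) then \<tau> (prm j) * ml u (cst (E i)) v else 0
       else if 0 = eps i \<and> j \<in> u then reord_sign {j} (u - {j}) * ml (u - {j}) (cst (E i)) v else 0
     else if j \<in> Y1 \<and> (0::nat\<Rightarrow>nat) = 0 \<and> i \<noteq> j \<and> i \<in> u \<and> j \<in> u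
     then reord_sign {j} (u - {j}) * reord_sign {i} (u - {j} - {i}) * ml (u - {j} - {i}) (cst (E i)) v else 0)"
      by (rule omult_der_D\<^sub>H_cst[OF zero_in_A(1) assms 2 True]) simp
    then show ?case using 2 uY True not2[of i] Y_disjoint by (auto simp: Y_cases)
  qed simp
  have 3: "(\<Sum>i\<in>Y. if i \<in> w then f i else 0) = sum f w" if "w \<subseteq> u" for w and f :: "nat \<Rightarrow> 'a"
  proof -
    have "Y \<inter> w = w" using uY that by (auto simp: Y_def)
    then show ?thesis using sum.inter_restrict[of Y f w] by simp
  qed
  show ?thesis using True unfolding bk_sum[OF zero_in_A(1) assms] 1 2
    using 3[of u] 3[of "u - {j}"] by simp
next
  case False
  have "j \<notin> u" using B0_B[OF assms(1)] False by (auto simp: B_def Y_def)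
  moreover have "E j = 0" using W_even_outside[OF assms(2) False] .
  ultimately show ?thesis using assms False by (simp add: bk_outside)
qed

lemma xmon_mult_eq:
  assumes "\<alpha> + \<beta> = \<gamma>" "\<gamma> \<in> A" "u \<inter> w = {}"
  shows "xmon_mult \<alpha> u \<beta> w = oscale (of_nat (bin \<gamma> \<alpha>) * reord_sign u w) (xmon \<gamma> (u \<union> w) :: 'a::field sup)"
proof -
  have 1: "(\<lambda>i. \<alpha> i + \<beta> i) = \<gamma>" using assms(1) by (auto simp: fun_eq_iff)
  have "\<gamma> i = \<alpha> i + \<beta> i" for i using assms(1) by auto
  then have 2: "(\<Prod>i\<in>Y0. (\<alpha> i + \<beta> i) choose \<alpha> i) = bin \<gamma> \<alpha>" by (simp add: bin_def)
  show ?thesis unfolding xmon_mult_def 1 2 using assms(2,3) by simp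
qed

lemma bin_ee: "a \<in> Y0 \<Longrightarrow> bin \<gamma> (ee a k) = \<gamma> a choose k"
proof -
  assume a: "a \<in> Y0"
  have "bin \<gamma> (ee a k) = (\<Prod>i\<in>Y0. if i = a then \<gamma> a choose k else 1)"
    unfolding bin_def by (rule prod.cong) auto
  then show ?thesis using a by simp
qed

lemma ee_in_A: "a \<in> Y0 \<Longrightarrow> c \<le> \<pi> a \<Longrightarrow> ee a c \<in> A"
  by (auto simp: A_def)

lemma sum_eps [simp]: "a \<in> Y0 \<Longrightarrow> sum (eps a) Y0 = 1"
  by simp_all

text \<open>An odd contraction removes one common index of \<open>u\<close> and \<open>w\<close>,
  and the product still vanishes if another is left. The last assumption says that
  \<open>u \<inter> w\<close> is not a singleton, so all odd contractions drop out.\<close>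

lemma pb_xmon_Y0:
  assumes "\<alpha> \<in> A" "u \<in> B" "\<beta> \<in> A" "w \<in> B" "\<And>k. k \<in> u \<inter> w \<Longrightarrow> u \<inter> w - {k} \<noteq> {}"
  shows "pb (xmon \<alpha> u) (xmon \<beta> w) =
    (\<Sum>i\<in>Y0. oscale (\<tau> i) (der i (xmon \<alpha> u) \<star> der (prm i) (xmon \<beta> w :: 'a::field sup)))"
proof -
  have "oscale (\<tau> k) (der k (xmon \<alpha> u) \<star> der (prm k) (xmon \<beta> w)) = (0 :: 'a sup)" if k: "k \<in> Y1" for k
  proof -
    have "xmon_mult \<alpha> (u - {k}) \<beta> (w - {k}) = (0 :: 'a sup)" if "k \<in> u" "k \<in> w"
    proof -
      have "(u - {k}) \<inter> (w - {k}) \<noteq> {}" using assms(5)[of k] that by blast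
      then show ?thesis by (simp add: xmon_mult_def)
    qed
    then show ?thesis using k assms B_subset[of u "u - {k}"] B_subset[of w "w - {k}"]
      by (auto simp: prm_simps der_xmon1 omult_scale_left omult_scale_right omult_xmon_xmon)
  qed
  then have "(\<Sum>k\<in>Y1. oscale (\<tau> k) (der k (xmon \<alpha> u) \<star> der (prm k) (xmon \<beta> w))) = (0 :: 'a sup)"
    by (intro sum.neutral) blast
  then show ?thesis unfolding pb_def sum_Y by simp
qed

lemma pb_ee:
  assumes "ee a c \<in> A" "u \<in> B" "\<beta> \<in> A" "w \<in> B" "\<And>k. k \<in> u \<inter> w \<Longrightarrow> u \<inter> w - {k} \<noteq> {}" "a \<in> Y0" "c > 0"
  shows "pb (xmon (ee a c) u) (xmon \<beta> w) =
    oscale (\<tau> a) (xmon (ee a (c - 1)) u \<star> der (prm a) (xmon \<beta> w :: 'a::field sup))"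
proof -
  have *: "(ee a c)(a := c - 1) = ee a (c - 1)" by (simp add: fun_eq_iff)
  have pbY0: "pb (xmon (ee a c) u) (xmon \<beta> w) = (\<Sum>i\<in>Y0.
      oscale (\<tau> i) (der i (xmon (ee a c) u) \<star> der (prm i) (xmon \<beta> w :: 'a sup)))"
    by (rule pb_xmon_Y0) (use assms in auto)
  have "pb (xmon (ee a c) u) (xmon \<beta> w) =
    (\<Sum>i\<in>Y0. if i = a then oscale (\<tau> a) (xmon (ee a (c - 1)) u \<star> der (prm a) (xmon \<beta> w)) else (0 :: 'a sup))"
    unfolding pbY0
    by (rule sum.cong) (use assms * in \<open>auto simp: der_xmon0\<close>)
  then show ?thesis using assms(6) by simp
qed

lemma pb_eps_ee:
  assumes "eps a + ee b c \<in> A" "\<beta> \<in> A" "w \<in> B" "a \<in> Y0" "b \<in> Y0" "a \<noteq> b" "c > 0"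
  shows "pb (xmon (eps a + ee b c) {}) (xmon \<beta> w) =
    oscale (\<tau> a) (xmon (ee b c) {} \<star> der (prm a) (xmon \<beta> w :: 'a::field sup)) +
    oscale (\<tau> b) (xmon (eps a + ee b (c - 1)) {} \<star> der (prm b) (xmon \<beta> w))"
proof -
  have 1: "(eps a + ee b c)(a := 0) = ee b c" using assms(6) by (auto simp: fun_eq_iff)
  have 2: "(eps a + ee b c)(b := c - Suc 0) = eps a + ee b (c - 1)" using assms(6) by (auto simp: fun_eq_iff)
  have pbY0: "pb (xmon (eps a + ee b c) {}) (xmon \<beta> w) = (\<Sum>i\<in>Y0.
      oscale (\<tau> i) (der i (xmon (eps a + ee b c) {}) \<star> der (prm i) (xmon \<beta> w :: 'a sup)))"
    by (rule pb_xmon_Y0) (use assms in auto)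
  have "pb (xmon (eps a + ee b c) {}) (xmon \<beta> w) = (\<Sum>i\<in>Y0.
      (if i = a then oscale (\<tau> a) (xmon (ee b c) {} \<star> der (prm a) (xmon \<beta> w)) else 0) +
      (if i = b then oscale (\<tau> b) (xmon (eps a + ee b (c - 1)) {} \<star> der (prm b) (xmon \<beta> w)) else (0 :: 'a sup)))"
    unfolding pbY0
    by (rule sum.cong) (use assms 1 2 in \<open>auto simp: der_xmon0\<close>)
  then show ?thesis using assms(4,5) by (simp add: sum.distrib)
qed

lemma O_deg_oscale: "f \<in> O_deg k \<Longrightarrow> oscale c f \<in> O_deg k"
  by (simp add: O_deg_iff)

lemma O_deg_zero: "0 \<in> O_deg k"
  by (simp add: O_deg_iff)

lemma xmon_in_O_deg: "\<alpha> \<in> A \<Longrightarrow> u \<in> B \<Longrightarrow> int (sum \<alpha> Y0 + card u) = k \<Longrightarrow> xmon \<alpha> u \<in> O_deg k"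
  by (auto simp: O_deg_iff xmon_def)

lemma W_degI:
  assumes "\<And>j. j \<in> Y \<Longrightarrow> D j \<in> O_deg (k + 1)" "\<And>j. j \<notin> Y \<Longrightarrow> D j = 0"
  shows "D \<in> W_deg k"
proof -
  have "D = (\<Sum>j\<in>Y. vf (D j) j)"
  proof
    fix i
    have "(\<Sum>j\<in>Y. vf (D j) j) i = (\<Sum>j\<in>Y. vf (D j) j i)" by (rule sum_fun_apply)
    also have "\<dots> = (\<Sum>j\<in>Y. if i = j then D i else 0)"
      by (rule sum.cong) (auto simp: vf_def)
    finally show "D i = (\<Sum>j\<in>Y. vf (D j) j) i" using assms(2) by simp
  qed
  also have "\<dots> \<in> W_deg k"
    unfolding W_deg_def by (intro wvec.span_sum wvec.span_base) (use assms(1) in blast)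
  finally show ?thesis .
qed

lemma D\<^sub>H_xmon_W_deg:
  assumes "\<alpha> \<in> A" "u \<in> B0"
  shows "D\<^sub>H (xmon \<alpha> u) \<in> W_deg (int (sum \<alpha> Y0 + card u) - 2)"
proof (rule W_degI)
  fix j
  have uB: "u \<in> B" "u - {j} \<in> B" using B0_B[OF assms(2)] by (auto intro: B_subset)
  let ?k = "int (sum \<alpha> Y0 + card u) - 2 + 1"
  have 1: "xmon (\<alpha>(i := \<alpha> i - 1)) u \<in> O_deg ?k" if "i \<in> Y0" "\<alpha> i \<noteq> 0" for i
  proof (rule xmon_in_O_deg[OF A_upd_dec[OF assms(1)] uB(1)])
    have "sum \<alpha> Y0 = \<alpha> i + sum \<alpha> (Y0 - {i})" "sum (\<alpha>(i := \<alpha> i - 1)) Y0 = \<alpha> i - 1 + sum \<alpha> (Y0 - {i})"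
      using that by (simp_all add: sum.remove)
    then show "int (sum (\<alpha>(i := \<alpha> i - 1)) Y0 + card u) = ?k" using that(2) by linarith
  qed
  have 2: "xmon \<alpha> (u - {j}) \<in> O_deg ?k" if "j \<in> u"
  proof (rule xmon_in_O_deg[OF assms(1) uB(2)])
    have "card u = Suc (card (u - {j}))"
      using card_Suc_Diff1[OF B_finite[OF uB(1)] that] by simp
    then show "int (sum \<alpha> Y0 + card (u - {j})) = ?k" by linarith
  qed
  show "D\<^sub>H (xmon \<alpha> u) j \<in> O_deg ?k"
    unfolding D\<^sub>H_xmon[OF assms]
    using 1[of "prm j", THEN O_deg_oscale] 2[THEN O_deg_oscale] prm_simps(1)[of j]
    by (auto simp: O_deg_zero)
next
  fix j assume "j \<notin> Y"
  then show "D\<^sub>H (xmon \<alpha> u) j = 0" by (auto simp: D\<^sub>H_xmon[OF assms] Y_cases)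
qed

text \<open>The indices of \<open>N_monos\<close>. The pair \<open>(0, {})\<close> is among them
  (see \<open>idx_zero\<close>), with value 0 by \<open>D\<^sub>H_one\<close>.\<close>

definition idx :: "(nat \<Rightarrow> nat) \<Rightarrow> nat set \<Rightarrow> bool"
  where "idx \<alpha> u \<longleftrightarrow> \<alpha> \<in> A \<and> u \<in> B0 \<and> (\<alpha>, u) \<noteq> (\<pi>, \<omega>) \<and> (\<alpha>, u) \<noteq> (\<pi>, {})"

lemma idxD: "idx \<alpha> u \<Longrightarrow> \<alpha> \<in> A" "idx \<alpha> u \<Longrightarrow> u \<in> B0" "idx \<alpha> u \<Longrightarrow> u \<in> B"
  by (auto simp: idx_def B0_def)

text \<open>Both excluded pairs have exponent \<pi>, so one coordinate below the top
  suffices.\<close>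

lemma idx_less: "\<alpha> \<in> A \<Longrightarrow> u \<in> B0 \<Longrightarrow> \<alpha> i < \<pi> i \<Longrightarrow> idx \<alpha> u"
  by (auto simp: idx_def)

lemma idx_le: "idx \<alpha> u \<Longrightarrow> \<alpha> i \<le> \<pi> i"
  by (auto simp: idx_def A_def)

lemma D\<^sub>H_N: "idx \<alpha> u \<Longrightarrow> D\<^sub>H (xmon \<alpha> u) \<in> N"
  unfolding N_def N_monos_def idx_def by (rule wvec.span_base) blast

lemma N_closed: "x \<in> N \<Longrightarrow> wscale c x \<in> N" "x \<in> N \<Longrightarrow> y \<in> N \<Longrightarrow> x + y \<in> N" "0 \<in> N"
  by (auto simp: N_def wvec.span_scale wvec.span_add wvec.span_zero)

lemma D\<^sub>H_zero [simp]: "D\<^sub>H 0 = 0"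
  using D\<^sub>H_oscale[of 0 0] by simp

lemma D\<^sub>H_one: "D\<^sub>H (xmon 0 {}) = 0"
  by (rule ext) (auto simp: D\<^sub>H_xmon)

lemma D\<^sub>H_der:
  fixes f :: "'a::field sup"
  assumes "f \<in> O_par 0" "i \<in> Y0"
  shows "der i f \<in> O_par 0" "bracket (pd i) (D\<^sub>H f) = D\<^sub>H (der i f)"
proof -
  have i: "i \<in> Y" using assms(2) by (simp add: Y_def)
  show d: "der i f \<in> O_par 0" using der_O_par[OF i assms(1)] assms(2) by simp
  have "der i (der (prm j) f) = der (prm j) (der i f)" if "j \<in> Y" for j
    using der_commute[OF i prm_simps(3)[OF that] O_par_O_set[OF assms(1)]] assms(2) by simp
  then show "bracket (pd i) (D\<^sub>H f) = D\<^sub>H (der i f)"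
    unfolding bracket_pd[OF assms(2) D\<^sub>H_W_even[OF assms(1)]] fun_eq_iff[of "\<lambda>j. der i (D\<^sub>H f j)"]
    by (simp add: D\<^sub>H_even assms(1) d der_oscale)
qed

end

subsection \<open>The constant parts of a derivation and their support\<close>

locale ham_der = ham_field p m n t field_type
  for p m n :: nat and t :: "nat \<Rightarrow> nat" and field_type :: "'a::field itself" +
  fixes \<phi> :: "'a witt \<Rightarrow> 'a witt"
  assumes \<phi>_Der: "\<phi> \<in> Der"
    and \<phi>_vanish: "\<forall>x\<in>N_deg (-1). \<forall>y\<in>N_deg 0. \<phi> (x + y) = 0"
begin

lemma \<phi>_W_even: "x \<in> N \<Longrightarrow> \<phi> x \<in> W_even"
  and \<phi>_add: "x \<in> N \<Longrightarrow> y \<in> N \<Longrightarrow> \<phi> (x + y) = \<phi> x + \<phi> y"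
  and \<phi>_scale: "x \<in> N \<Longrightarrow> \<phi> (wscale c x) = wscale c (\<phi> x)"
  and \<phi>_bracket: "x \<in> N \<Longrightarrow> y \<in> N \<Longrightarrow> \<phi> (bracket x y) = bracket x (\<phi> y) - bracket y (\<phi> x)"
  using \<phi>_Der unfolding Der_def by blast+

lemma \<phi>_zero [simp]: "\<phi> 0 = 0"
  using \<phi>_add[OF N_closed(3) N_closed(3)] by simp

definition ps :: "(nat \<Rightarrow> nat) \<Rightarrow> nat set \<Rightarrow> 'a witt"
  where "ps \<alpha> u = \<phi> (D\<^sub>H (xmon \<alpha> u))"

text \<open>The constant part of \<open>\<phi> (D\<^sub>H (x\<^sup>(\<^sup>\<alpha>\<^sup>) x\<^sup>u))\<close>; it determines \<open>\<phi>\<close> since \<open>\<phi>\<close> commutes with the \<open>\<partial>\<^sub>i\<close>, \<open>i \<in> Y0\<close>.\<close>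
definition cc :: "(nat \<Rightarrow> nat) \<Rightarrow> nat set \<Rightarrow> nat \<Rightarrow> nat set \<Rightarrow> 'a"
  where "cc \<alpha> u j v = ps \<alpha> u j (0, v)"

lemma ps_W_even: "idx \<alpha> u \<Longrightarrow> ps \<alpha> u \<in> W_even"
  unfolding ps_def by (intro \<phi>_W_even D\<^sub>H_N)

lemma cc_outside:
  assumes "idx \<alpha> u" "j \<notin> Y \<or> v \<notin> B"
  shows "cc \<alpha> u j v = 0"
proof (cases "j \<in> Y")
  case True
  then show ?thesis using W_even_O_set[OF ps_W_even[OF assms(1)], of j] assms by (simp add: cc_def O_set_iff)
next
  case False
  from W_even_outside[OF ps_W_even[OF assms(1)] this] show ?thesis by (simp add: cc_def)
qed

lemma cc_parity:
  assumes "idx \<alpha> u" "cc \<alpha> u j v \<noteq> 0"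
  shows "card v mod 2 = \<mu> j"
proof -
  have j: "j \<in> Y" using cc_outside assms by blast
  show ?thesis using W_even_O_par[OF ps_W_even[OF assms(1)] j] assms(2)
    unfolding cc_def O_par_iff by blast
qed

text \<open>The zero element lies in every graded piece, so the hypothesis on sums gives vanishing
  on each of the two pieces.\<close>

lemma ps_vanish:
  assumes "idx \<alpha> u" "sum \<alpha> Y0 + card u \<in> {1, 2}"
  shows "ps \<alpha> u = 0"
proof -
  have z: "(0 :: 'a witt) \<in> N_deg k" for k
    by (simp add: N_deg_def N_closed W_deg_def wvec.span_zero)
  have "D\<^sub>H (xmon \<alpha> u :: 'a sup) \<in> N_deg (int (sum \<alpha> Y0 + card u) - 2)"
    unfolding N_deg_def using D\<^sub>H_N[OF assms(1)] D\<^sub>H_xmon_W_deg[OF idxD(1,2)[OF assms(1)]] by (rule IntI)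
  moreover have "int (sum \<alpha> Y0 + card u) - 2 = -1 \<or> int (sum \<alpha> Y0 + card u) - 2 = 0"
    using assms(2) by (elim insertE emptyE) linarith+
  ultimately consider "D\<^sub>H (xmon \<alpha> u) \<in> (N_deg (-1) :: 'a witt set)" | "D\<^sub>H (xmon \<alpha> u) \<in> (N_deg 0 :: 'a witt set)" by metis
  then show ?thesis
  proof cases
    case 1
    then have "\<phi> (D\<^sub>H (xmon \<alpha> u) + 0) = 0" using \<phi>_vanish z by blast
    then show ?thesis by (simp add: ps_def)
  next
    case 2
    then have "\<phi> (0 + D\<^sub>H (xmon \<alpha> u)) = 0" using \<phi>_vanish z by blast
    then show ?thesis by (simp add: ps_def)
  qed
qed

lemma ps_one: "ps 0 {} = 0"
  by (simp add: ps_def D\<^sub>H_one)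

lemma ee_less_\<pi>: "a \<in> Y0 \<Longrightarrow> ee a c (prm a) < \<pi> (prm a)"
  using \<pi>_ge[of "prm a"] prm_simps by simp

lemma idx_ee: "a \<in> Y0 \<Longrightarrow> c \<le> \<pi> a \<Longrightarrow> u \<in> B0 \<Longrightarrow> idx (ee a c) u"
  by (rule idx_less[OF ee_in_A _ ee_less_\<pi>])

lemma eps_eq_ee: "eps a = ee a 1"
  by (simp add: fun_eq_iff)

lemma idx_eps: "a \<in> Y0 \<Longrightarrow> u \<in> B0 \<Longrightarrow> idx (eps a) u"
  unfolding eps_eq_ee using \<pi>_ge[of a] by (intro idx_ee) auto

lemma idx_zero: "u \<in> B0 \<Longrightarrow> idx 0 u"
proof (rule idx_less[of _ _ 1])
  have "1 \<in> Y0" using m1 by (simp add: Y0_def)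
  from \<pi>_ge[OF this] show "0 1 < \<pi> 1" by simp
qed simp_all

text \<open>Up to sign \<partial>_i is \<open>D\<^sub>H\<close> of x_{i'}, which \<phi> kills; the
  derivation rule then says that \<phi> commutes with ad \<partial>_i.\<close>

lemma der_ps:
  assumes "idx \<alpha> u" "i \<in> Y0"
  shows "der i (ps \<alpha> u j) = (if \<alpha> i = 0 then 0 else ps (\<alpha>(i := \<alpha> i - 1)) u j)"
proof -
  let ?i = "prm i"
  have i: "?i \<in> Y0" "prm ?i = i" using assms(2) prm_simps by (auto simp: Y_def)
  have pd: "D\<^sub>H (xmon (eps ?i) {}) = wscale (\<tau> ?i) (pd i :: 'a witt)"
  proof
    fix j
    have e: "(eps ?i)(?i := eps ?i ?i - 1) = (\<lambda>_. 0)" by (auto simp: fun_eq_iff)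
    have n: "j \<in> Y0 \<and> eps ?i (prm j) \<noteq> 0 \<longleftrightarrow> j = i" using prm_eq_iff[of j ?i] i assms(2) by auto
    show "D\<^sub>H (xmon (eps ?i) {}) j = wscale (\<tau> ?i) (pd i :: 'a witt) j"
      unfolding D\<^sub>H_xmon[of "eps ?i" "{}", OF idxD(1,2)[OF idx_eps[OF i(1) B0_empty]]] n
      using e by (auto simp: pd_def vf_def simp del: eps_apply)
  qed
  then have pd2: "pd i = wscale (\<tau> ?i) (D\<^sub>H (xmon (eps ?i) {}) :: 'a witt)"
    using \<tau>_sq[of ?i, where 'a = 'a] by simp
  have pN: "(pd i :: 'a witt) \<in> N" unfolding pd2 by (intro N_closed D\<^sub>H_N idx_eps i B0_empty)
  have p0: "\<phi> (pd i) = 0"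
    using ps_vanish[OF idx_eps[OF i(1) B0_empty]] i unfolding pd2
    by (simp add: \<phi>_scale D\<^sub>H_N idx_eps i flip: ps_def)
  note xN = D\<^sub>H_N[OF assms(1)]
  have xW: "(D\<^sub>H (xmon \<alpha> u) :: 'a witt) \<in> W_even"
    by (intro D\<^sub>H_W_even O_par_xmon_B0 idxD[OF assms(1)])
  have z: "bracket x (0 :: 'a witt) = 0" if x: "x = D\<^sub>H (xmon \<alpha> u)" for x
  proof
    fix j
    have "(0 :: 'a witt) \<in> W_even" by (rule W_evenI) auto
    from bracket_even[OF xW this, of j] show "bracket x (0 :: 'a witt) j = 0 j" by (simp add: x)
  qed
  have "\<phi> (bracket (pd i) (D\<^sub>H (xmon \<alpha> u))) = bracket (pd i) (ps \<alpha> u)"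
    using \<phi>_bracket[OF pN xN] p0 z by (simp add: ps_def)
  also have "bracket (pd i) (D\<^sub>H (xmon \<alpha> u)) = (D\<^sub>H (der i (xmon \<alpha> u)) :: 'a witt)"
    by (intro D\<^sub>H_der O_par_xmon_B0 idxD[OF assms(1)] assms(2))
  finally have "\<phi> (D\<^sub>H (der i (xmon \<alpha> u))) j = der i (ps \<alpha> u j)"
    unfolding bracket_pd[OF assms(2) ps_W_even[OF assms(1)]] by simp
  then show ?thesis using assms idxD[OF assms(1)] by (auto simp: der_xmon0 ps_def)
qed

lemma idx_dec:
  assumes "idx \<alpha> u" "i \<in> Y0" "\<alpha> i \<noteq> 0"
  shows "idx (\<alpha>(i := \<alpha> i - 1)) u"
  using idx_less[of "\<alpha>(i := \<alpha> i - 1)" u i] A_upd_dec idxD[OF assms(1)] idx_le[OF assms(1), of i] assms(3)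
  by simp

text \<open>Taylor's formula for divided powers: the coefficient at \<gamma> is the constant term
  after applying \<partial>^\<gamma>, which \<open>der_ps\<close> moves into the argument.\<close>

lemma ps_coeff:
  assumes "idx \<alpha> u"
  shows "ps \<alpha> u j (\<gamma>, v) = (if \<gamma> \<le> \<alpha> then cc (\<alpha> - \<gamma>) u j v else 0)"
  using assms
proof (induction "sum \<gamma> Y0" arbitrary: \<alpha> \<gamma>)
  case 0
  have O: "ps \<alpha> u j \<in> O_set" by (rule W_even_O_set[OF ps_W_even[OF 0(2)]])
  show ?case
  proof (cases "\<gamma> = 0")
    case True
    have "(0 :: nat \<Rightarrow> nat) \<le> \<alpha>" "\<alpha> - 0 = \<alpha>" by (auto simp: le_fun_def fun_eq_iff)
    then have "ps \<alpha> u j (0, v) = (if 0 \<le> \<alpha> then cc (\<alpha> - 0) u j v else 0)" by (simp add: cc_def)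
    then show ?thesis unfolding True .
  next
    case False
    have "\<gamma> \<notin> A"
    proof
      assume "\<gamma> \<in> A"
      then have "\<gamma> x = 0" for x using 0(1) A_outside[of \<gamma> x] by (cases "x \<in> Y0") auto
      with False show False by (simp add: fun_eq_iff)
    qed
    moreover have "\<not> \<gamma> \<le> \<alpha>" using \<open>\<gamma> \<notin> A\<close> A_down idxD(1)[OF 0(2)] by blast
    ultimately show ?thesis using O by (simp add: O_set_iff)
  qed
next
  case (Suc x)
  then obtain i where i: "i \<in> Y0" "\<gamma> i \<noteq> 0"
    by (metis Suc_neq_Zero sum.neutral)
  let ?\<gamma> = "\<gamma>(i := \<gamma> i - 1)" and ?\<alpha> = "\<alpha>(i := \<alpha> i - 1)"
  have O: "ps \<alpha> u j \<in> O_set" by (rule W_even_O_set[OF ps_W_even[OF Suc(3)]])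
  have \<gamma>: "?\<gamma>(i := Suc (?\<gamma> i)) = \<gamma>" using i by (simp add: fun_eq_iff)
  have "ps \<alpha> u j (\<gamma>, v) = der i (ps \<alpha> u j) (?\<gamma>, v)"
    unfolding der_apply0[OF i(1) O] \<gamma> ..
  also have "\<dots> = (if \<alpha> i = 0 then 0 else ps ?\<alpha> u j (?\<gamma>, v))"
    unfolding der_ps[OF Suc(3) i(1)] by simp
  also have "\<dots> = (if \<gamma> \<le> \<alpha> then cc (\<alpha> - \<gamma>) u j v else 0)"
  proof (cases "\<alpha> i = 0")
    case True
    then have "\<not> \<gamma> i \<le> \<alpha> i" using i(2) by simp
    then have "\<not> \<gamma> \<le> \<alpha>" by (auto simp: le_fun_def)
    then show ?thesis using True by simp
  next
    case False
    have "x = sum ?\<gamma> Y0"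
    proof -
      have "sum \<gamma> Y0 = \<gamma> i + sum \<gamma> (Y0 - {i})" "sum ?\<gamma> Y0 = \<gamma> i - 1 + sum \<gamma> (Y0 - {i})"
        using i(1) by (simp_all add: sum.remove)
      then show ?thesis using Suc(2) i(2) by linarith
    qed
    from Suc(1)[OF this idx_dec[OF Suc(3) i(1) False]]
    have "ps ?\<alpha> u j (?\<gamma>, v) = (if ?\<gamma> \<le> ?\<alpha> then cc (?\<alpha> - ?\<gamma>) u j v else 0)" .
    moreover have "?\<alpha> - ?\<gamma> = \<alpha> - \<gamma>" using False i(2) by (auto simp: fun_eq_iff)
    moreover have "?\<gamma> x \<le> ?\<alpha> x \<longleftrightarrow> \<gamma> x \<le> \<alpha> x" for x using False i(2) by (cases "x = i") auto
    then have "?\<gamma> \<le> ?\<alpha> \<longleftrightarrow> \<gamma> \<le> \<alpha>" unfolding le_fun_def by blast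
    ultimately show ?thesis using False by simp
  qed
  finally show ?case .
qed

lemma ps_coeff_eps:
  assumes "idx \<alpha> u"
  shows "ps \<alpha> u j (eps a, v) = (if \<alpha> a = 0 then 0 else cc (\<alpha>(a := \<alpha> a - 1)) u j v)"
proof -
  have "eps a \<le> \<alpha> \<longleftrightarrow> \<alpha> a \<noteq> 0" by (auto simp: le_fun_def split: if_splits)
  moreover have "\<alpha> - eps a = \<alpha>(a := \<alpha> a - 1)" by (auto simp: fun_eq_iff)
  ultimately show ?thesis unfolding ps_coeff[OF assms] by simp
qed

section \<open>Brackets with powers of one even variable\<close>

lemma cc_pb:
  assumes "idx \<alpha> u" "idx \<beta> w"
  shows "\<phi> (D\<^sub>H (pb (xmon \<alpha> u) (xmon \<beta> w))) j (0, v) = bk \<alpha> u (ps \<beta> w) j v - bk \<beta> w (ps \<alpha> u) j v"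
proof -
  have "bracket (D\<^sub>H (xmon \<alpha> u)) (D\<^sub>H (xmon \<beta> w)) = D\<^sub>H (pb (xmon \<alpha> u) (xmon \<beta> w :: 'a sup))"
    using assms by (intro bracket_D\<^sub>H O_par_xmon_B0) (auto dest: idxD)
  from \<phi>_bracket[OF D\<^sub>H_N[OF assms(1)] D\<^sub>H_N[OF assms(2)], unfolded this]
  show ?thesis by (simp add: bk_def ps_def)
qed

lemma \<phi>_scaled:
  assumes "idx \<gamma> w"
  shows "\<phi> (D\<^sub>H (oscale c (xmon \<gamma> w))) j (0, v) = c * cc \<gamma> w j v"
  using assms by (simp add: D\<^sub>H_oscale \<phi>_scale D\<^sub>H_N cc_def ps_def)

lemma \<phi>_scaled2:
  assumes "idx \<gamma> w" "idx \<gamma>' w'"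
  shows "\<phi> (D\<^sub>H (oscale c (xmon \<gamma> w) + oscale c' (xmon \<gamma>' w'))) j (0, v) = c * cc \<gamma> w j v + c' * cc \<gamma>' w' j v"
  using assms by (simp add: D\<^sub>H_add D\<^sub>H_oscale \<phi>_add \<phi>_scale D\<^sub>H_N N_closed cc_def ps_def)

text \<open>\<open>\<beta>\<close> is the partner of x_a^(k+1) in a bracket that returns \<gamma>:
  contracting a with a' takes one off the power and removes the extra unit at a'. The bound at a'
  keeps \<open>\<beta>\<close> in \<open>A\<close>.\<close>

lemma shift_props:
  assumes "idx \<gamma> w" "a \<in> Y0" "1 \<le> k" "k \<le> \<gamma> a" "\<gamma> (prm a) < \<pi> (prm a)"
  defines "\<beta> \<equiv> \<gamma>(a := \<gamma> a - k, prm a := Suc (\<gamma> (prm a)))"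
  shows "idx \<beta> w" "sum \<beta> Y0 + k = sum \<gamma> Y0 + 1"
proof -
  have pa: "prm a \<in> Y0" "prm a \<noteq> a" using assms(2) prm_simps by auto
  have "\<beta> \<in> A" using idx_le[OF assms(1)] assms(5)
    unfolding A_def \<beta>_def by (auto intro: le_trans[OF diff_le_self])
  then show "idx \<beta> w"
    using idx_less[of \<beta> w a] idxD[OF assms(1)] idx_le[OF assms(1), of a] assms(3,4) pa by (simp add: \<beta>_def)
  have "\<beta> i + ee a k i = \<gamma> i + eps (prm a) i" for i using assms(4) pa by (simp add: \<beta>_def)
  then have "(\<Sum>i\<in>Y0. \<beta> i + ee a k i) = (\<Sum>i\<in>Y0. \<gamma> i + eps (prm a) i)" by simp
  then show "sum \<beta> Y0 + k = sum \<gamma> Y0 + 1" unfolding sum.distrib using assms(2) pa by simp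
qed

text \<open>For k = 1 the power is quadratic and killed by \<phi>, which gives
  \<open>cc_shift1\<close>; for larger k both brackets can lose their constant part, which gives
  \<open>cc_high\<close>.\<close>

lemma cc_shift:
  assumes "idx \<gamma> w" "a \<in> Y0" "1 \<le> k" "k \<le> \<gamma> a" "Suc k \<le> \<pi> a" "\<gamma> (prm a) < \<pi> (prm a)"
  defines "\<beta> \<equiv> \<gamma>(a := \<gamma> a - k, prm a := Suc (\<gamma> (prm a)))"
  shows "\<tau> a * of_nat (\<gamma> a choose k) * cc \<gamma> w j v =
    bk (ee a (Suc k)) {} (ps \<beta> w) j v - bk \<beta> w (ps (ee a (Suc k)) {}) j v"
proof -
  have pa: "prm a \<in> Y0" "prm a \<noteq> a" using assms(2) prm_simps by auto
  have \<beta>: "idx \<beta> w" unfolding \<beta>_def using assms by (intro shift_props) auto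
  have f: "idx (ee a (Suc k)) {}" using assms by (intro idx_ee) auto
  have "\<beta>(prm a := \<beta> (prm a) - 1) = \<gamma>(a := \<gamma> a - k)" using pa by (auto simp: \<beta>_def fun_eq_iff)
  then have d: "der (prm a) (xmon \<beta> w) = (xmon (\<gamma>(a := \<gamma> a - k)) w :: 'a sup)"
    using der_xmon0[OF idxD(1,3)[OF \<beta>] pa(1), where 'a = 'a] pa by (simp add: \<beta>_def)
  have g: "\<gamma>(a := \<gamma> a - k) \<in> A" using idxD(1)[OF assms(1)] by (rule A_down) (auto simp: le_fun_def)
  have e: "ee a k + \<gamma>(a := \<gamma> a - k) = \<gamma>" using assms(4) by (auto simp: fun_eq_iff)
  have x: "xmon (ee a k) {} \<star> xmon (\<gamma>(a := \<gamma> a - k)) w = (oscale (of_nat (\<gamma> a choose k)) (xmon \<gamma> w) :: 'a sup)"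
    using omult_xmon_xmon[of "ee a k" "{}" "\<gamma>(a := \<gamma> a - k)" w, where 'a = 'a]
      xmon_mult_eq[OF e idxD(1)[OF assms(1)], of "{}" w, where 'a = 'a] assms g idxD[OF assms(1)]
    by (simp add: ee_in_A bin_ee)
  have "pb (xmon (ee a (Suc k)) {}) (xmon \<beta> w) =
      oscale (\<tau> a) (xmon (ee a (Suc k - 1)) {} \<star> der (prm a) (xmon \<beta> w :: 'a sup))"
    by (rule pb_ee) (use f \<beta> assms(2) in \<open>auto dest: idxD\<close>)
  then have "pb (xmon (ee a (Suc k)) {}) (xmon \<beta> w) =
      (oscale (\<tau> a * of_nat (\<gamma> a choose k)) (xmon \<gamma> w) :: 'a sup)" by (simp add: d x)
  then show ?thesis using cc_pb[OF f \<beta>, of j v] \<phi>_scaled[OF assms(1), of "\<tau> a * of_nat (\<gamma> a choose k)" j v] by simp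
qed

lemma ee_2: "ee a 2 = eps a + eps a"
  by (auto simp: fun_eq_iff)

lemma bk_ee2:
  assumes "idx \<beta> w" "a \<in> Y0" "v \<in> B"
  shows "bk (ee a 2) {} (ps \<beta> w) j v = - (if j = prm a then \<tau> a * cc \<beta> w a v else 0)"
proof -
  have "eps a + eps a \<in> A" using ee_in_A[OF assms(2), of 2] \<pi>_ge[OF assms(2)] by (simp add: ee_2)
  from bk_two[of a a "{}" "ps \<beta> w" j v, OF this B0_empty ps_W_even[OF assms(1)] assms(2) assms(2)]
  show ?thesis using assms(3) by (simp add: ee_2 cc_def ml_empty)
qed

lemma ps_ee2: "a \<in> Y0 \<Longrightarrow> ps (ee a 2) {} = 0"
  using \<pi>_ge[of a] by (intro ps_vanish idx_ee) simp_all

text \<open>\<open>D\<^sub>H\<close> of x_a^(2) has degree 0, so \<phi> commutes with it, and on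
  constant parts it only sends \<partial>_a to a multiple of \<partial>_{a'}. Hence only the
  component a' survives when p does not divide \<gamma>_a.\<close>

lemma cc_shift1:
  assumes "idx \<gamma> w" "a \<in> Y0" "1 \<le> \<gamma> a" "\<gamma> (prm a) < \<pi> (prm a)"
  shows "of_nat (\<gamma> a) * cc \<gamma> w j v =
    - (if j = prm a then cc (\<gamma>(a := \<gamma> a - 1, prm a := Suc (\<gamma> (prm a)))) w a v else 0)"
proof (cases "v \<in> B")
  case True
  let ?\<beta> = "\<gamma>(a := \<gamma> a - 1, prm a := Suc (\<gamma> (prm a)))"
  have \<beta>: "idx ?\<beta> w" by (rule shift_props) (use assms in auto)
  have h: "\<tau> a * of_nat (\<gamma> a choose 1) * cc \<gamma> w j v =
    bk (ee a (Suc 1)) {} (ps ?\<beta> w) j v - bk ?\<beta> w (ps (ee a (Suc 1)) {}) j v"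
    using \<pi>_ge[OF assms(2)] assms by (intro cc_shift) auto
  have "\<tau> a * (of_nat (\<gamma> a) * cc \<gamma> w j v) = \<tau> a * - (if j = prm a then cc ?\<beta> w a v else 0)"
    using h[unfolded Suc_1 bk_ee2[OF \<beta> assms(2) True, of j] ps_ee2[OF assms(2)]
        bk_zero_right[OF idxD(1,2)[OF \<beta>], of j v, where 'a = 'a]]
    by (simp add: mult.assoc del: fun_upd_apply)
  then show ?thesis by (simp only: mult_cancel_left \<tau>_nonzero simp_thms)
next
  case False
  have \<beta>: "idx (\<gamma>(a := \<gamma> a - 1, prm a := Suc (\<gamma> (prm a)))) w" by (rule shift_props) (use assms in auto)
  show ?thesis using False cc_outside[OF \<beta>, of a v] cc_outside[OF assms(1), of j v] by simp
qed

text \<open>Without x_{a'} the monomial Poisson commutes with x_a^(2), so the left side of the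
  derivation rule is zero.\<close>

lemma cc_partner_zero:
  assumes "idx \<beta> w" "a \<in> Y0" "\<beta> (prm a) = 0"
  shows "cc \<beta> w a v = 0"
proof (cases "v \<in> B")
  case True
  have pa: "prm a \<in> Y0" using assms(2) prm_simps by auto
  have f: "idx (ee a 2) {}" using assms \<pi>_ge[OF assms(2)] by (intro idx_ee) auto
  have "der (prm a) (xmon \<beta> w) = (0 :: 'a sup)"
    using der_xmon0[OF idxD(1,3)[OF assms(1)] pa, where 'a = 'a] assms(3) by simp
  moreover have "pb (xmon (ee a 2) {}) (xmon \<beta> w) =
      oscale (\<tau> a) (xmon (ee a (2 - 1)) {} \<star> der (prm a) (xmon \<beta> w :: 'a sup))"
    by (rule pb_ee) (use f assms in \<open>auto dest: idxD\<close>)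
  ultimately have "pb (xmon (ee a 2) {}) (xmon \<beta> w) = (0 :: 'a sup)" by simp
  with cc_pb[OF f assms(1), of "prm a" v] show ?thesis
    using bk_ee2[OF assms(1,2) True, of "prm a"] ps_ee2[OF assms(2)] bk_zero_right[of \<beta> w "prm a" v, where 'a = 'a] idxD[OF assms(1)]
    by simp
qed (use cc_outside[OF assms(1)] in simp)

lemma cc_single:
  assumes "idx \<gamma> w" "a \<in> Y0" "\<not> p dvd \<gamma> a" "\<gamma> (prm a) < \<pi> (prm a)" "j \<noteq> prm a"
  shows "cc \<gamma> w j v = 0"
proof -
  have "1 \<le> \<gamma> a" using assms(3) by (cases "\<gamma> a") auto
  from cc_shift1[OF assms(1,2) this assms(4), of j v] show ?thesis using assms(3,5) by (simp add: of_nat_eq_0)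
qed

lemma prm_inj: "a \<in> Y0 \<Longrightarrow> b \<in> Y0 \<Longrightarrow> prm a = prm b \<longleftrightarrow> a = b"
  using prm_simps(4) by (metis Y_cases)

text \<open>The two indices would force \<open>j\<close> to be both a' and b'.\<close>

lemma cc_double:
  assumes "idx \<gamma> w" "a \<in> Y0" "\<not> p dvd \<gamma> a" "\<gamma> (prm a) < \<pi> (prm a)"
    "b \<in> Y0" "\<not> p dvd \<gamma> b" "\<gamma> (prm b) < \<pi> (prm b)" "a \<noteq> b"
  shows "cc \<gamma> w j v = 0"
  using cc_single[OF assms(1-4), of j v] cc_single[OF assms(1,5-7), of j v] prm_inj[OF assms(2,5)] assms(8) by auto

text \<open>\<pi>_i is -1 modulo p, whereas x + d is 0 or 1 modulo p, and p > 3.\<close>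

lemma dvd_add_ne_\<pi>:
  assumes "p dvd x" "i \<in> Y0" "d \<le> 1"
  shows "x + d \<noteq> \<pi> i"
proof
  assume "x + d = \<pi> i"
  then have "x + Suc d = p ^ t i" using Suc_\<pi>[OF assms(2)] by simp
  moreover have "p dvd p ^ t i" using t_pos assms(2) by simp
  ultimately have "p dvd Suc d" using assms(1) by (metis dvd_add_right_iff)
  then show False using assms(3) p3 by (auto dest!: dvd_imp_le)
qed

lemma dvd_less_\<pi>:
  assumes "p dvd x" "i \<in> Y0" "x \<le> \<pi> i"
  shows "x + 2 \<le> \<pi> i"
  using dvd_add_ne_\<pi>[OF assms(1,2), of 0] dvd_add_ne_\<pi>[OF assms(1,2), of 1] assms(3) by linarith

lemma not_dvd_Suc: "p dvd x \<Longrightarrow> \<not> p dvd Suc x"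
  using dvd_diff_nat[of p "Suc x" x] p3 by auto

text \<open>In the component a', moving one unit from a to a' leaves the residues \<gamma>_a - 1 and
  1, both nonzero, so \<open>cc_double\<close> kills the shifted term in
  \<open>cc_shift1\<close>.\<close>

lemma cc_triple:
  assumes "idx \<gamma> w" "a \<in> Y0" "\<not> p dvd \<gamma> a" "\<gamma> a mod p \<noteq> 1" "p dvd \<gamma> (prm a)"
  shows "cc \<gamma> w j v = 0"
proof (cases "j = prm a")
  case True
  let ?\<beta> = "\<gamma>(a := \<gamma> a - 1, prm a := Suc (\<gamma> (prm a)))"
  have pa: "prm a \<in> Y0" "prm a \<noteq> a" "prm (prm a) = a" using assms(2) prm_simps by (auto simp: Y_def)
  have b: "\<gamma> (prm a) + 2 \<le> \<pi> (prm a)" by (rule dvd_less_\<pi>[OF assms(5) pa(1) idx_le[OF assms(1)]])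
  have pos: "1 \<le> \<gamma> a" using assms(3) by (cases "\<gamma> a") auto
  have \<beta>: "idx ?\<beta> w" by (rule shift_props) (use assms pos b in auto)
  have 1: "\<not> p dvd \<gamma> a - 1"
  proof
    assume "p dvd \<gamma> a - 1"
    then obtain q where "\<gamma> a = p * q + 1" using pos by (metis dvdE le_add_diff_inverse2)
    then show False using assms(4) p3 by (simp add: mod_Suc)
  qed
  have 2: "\<not> p dvd Suc (\<gamma> (prm a))"
    using assms(5) by (rule not_dvd_Suc)
  have z: "cc ?\<beta> w a v = 0"
    by (rule cc_double[of _ _ a "prm a"])
      (use \<beta> 1 2 pa b assms(2) idx_le[OF assms(1), of a] pos in auto)
  have "\<gamma> (prm a) < \<pi> (prm a)" using b by simp
  then show ?thesis using cc_shift1[OF assms(1,2) pos, of j v, unfolded z] assms(3) by (simp add: of_nat_eq_0)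
next
  case False
  have pa: "prm a \<in> Y0" using assms(2) prm_simps by auto
  show ?thesis using False dvd_less_\<pi>[OF assms(5) pa idx_le[OF assms(1)]] by (intro cc_single[OF assms(1-3)]) auto
qed

section \<open>Brackets of two factors of degree at least 3, and the support\<close>

text \<open>The factors have degrees k + 1 and |\<gamma>| + 1 - k in the even variables. The
  assumptions make both at least 3, so \<open>bk_degree_ge3\<close> removes both brackets.\<close>

lemma cc_high:
  assumes "idx \<gamma> w" "a \<in> Y0" "2 \<le> k" "k \<le> \<gamma> a" "Suc k \<le> \<pi> a" "\<gamma> (prm a) < \<pi> (prm a)"
    "k + 2 \<le> sum \<gamma> Y0" "of_nat (\<gamma> a choose k) \<noteq> (0::'a)"
  shows "cc \<gamma> w j v = 0"
proof -
  let ?\<beta> = "\<gamma>(a := \<gamma> a - k, prm a := Suc (\<gamma> (prm a)))"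
  have k: "1 \<le> k" using assms(3) by simp
  note \<beta> = shift_props[OF assms(1,2) k assms(4,6)]
  have f: "idx (ee a (Suc k)) {}" using assms by (intro idx_ee) auto
  have "bk (ee a (Suc k)) {} (ps ?\<beta> w) j v = 0"
    by (rule bk_degree_ge3) (use idxD[OF f] ps_W_even[OF \<beta>(1)] assms in auto)
  moreover have "bk ?\<beta> w (ps (ee a (Suc k)) {}) j v = 0"
    by (rule bk_degree_ge3) (use idxD[OF \<beta>(1)] ps_W_even[OF f] \<beta>(2) assms in auto)
  ultimately show ?thesis using cc_shift[OF assms(1,2) k assms(4-6), of j v] assms(8) by simp
qed

lemma two_choose_two: "2 * (x choose 2) = x * (x - 1)"
proof -
  have "even (x * (x - 1))" by (cases x) auto
  then show ?thesis by (simp add: choose_two)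
qed

text \<open>Modulo p these are (-1)(-2)/2 = 1 and (-2)(-3)/2 = 3, nonzero since p > 3.\<close>

lemma choose_two_\<pi>:
  assumes "i \<in> Y0"
  shows "of_nat (\<pi> i choose 2) \<noteq> (0::'a)" "of_nat ((\<pi> i - 1) choose 2) \<noteq> (0::'a)"
proof -
  have g: "\<pi> i \<ge> 4" by (rule \<pi>_ge[OF assms])
  have small: "of_nat 2 \<noteq> (0::'a)" "of_nat 3 \<noteq> (0::'a)" using p3 of_nat_small[of 2] of_nat_small[of 3] by auto
  then have six: "(2 * 3 :: 'a) \<noteq> 0" unfolding mult_eq_0_iff by simp
  have "of_nat (2 * (\<pi> i choose 2)) = (of_nat (\<pi> i) * (of_nat (\<pi> i) - 1) :: 'a)"
    unfolding two_choose_two using g by (simp add: of_nat_diff)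
  then have "2 * of_nat (\<pi> i choose 2) = (2 :: 'a)" by (simp add: of_nat_\<pi>[OF assms])
  then show "of_nat (\<pi> i choose 2) \<noteq> (0::'a)" using small by auto
  have "of_nat (2 * ((\<pi> i - 1) choose 2)) = ((of_nat (\<pi> i) - 1) * (of_nat (\<pi> i) - 2) :: 'a)"
    unfolding two_choose_two using g by (simp add: of_nat_diff)
  then have "2 * of_nat ((\<pi> i - 1) choose 2) = (2 * 3 :: 'a)" by (simp add: of_nat_\<pi>[OF assms])
  then show "of_nat ((\<pi> i - 1) choose 2) \<noteq> (0::'a)" using six by (metis mult_zero_right)
qed

lemma sum_ge_two:
  fixes \<gamma> :: "nat \<Rightarrow> nat"
  assumes "a \<in> Y0" "b \<in> Y0" "a \<noteq> b"
  shows "\<gamma> a + \<gamma> b \<le> sum \<gamma> Y0"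
proof -
  have "\<gamma> a + \<gamma> b = sum \<gamma> {a, b}" using assms(3) by simp
  also have "\<dots> \<le> sum \<gamma> Y0" by (rule sum_mono2) (use assms in auto)
  finally show ?thesis .
qed

lemma sum_ge_one: "a \<in> Y0 \<Longrightarrow> \<gamma> a \<le> sum \<gamma> Y0" for \<gamma> :: "nat \<Rightarrow> nat"
  by (rule member_le_sum) auto

lemma cc_half_top:
  assumes "idx \<gamma> w" "a \<in> Y0" "\<gamma> a = \<pi> a" "\<gamma> (prm a) < \<pi> (prm a)"
  shows "cc \<gamma> w j v = 0"
  using \<pi>_ge[OF assms(2)] sum_ge_one[OF assms(2), of \<gamma>] choose_two_\<pi>[OF assms(2)] assms
  by (intro cc_high[OF assms(1,2), of 2]) auto

text \<open>With \<gamma>_l and \<gamma>_{l'} both maximal, the shift of \<open>cc_shift\<close> at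
  l leaves \<open>A\<close>. The pair i, i' carries the contraction instead, while x_l^(\<pi>_l) and
  x_{l'}^(\<pi>_{l'}), one in each factor, keep both degrees large.\<close>

lemma cc_mixed:
  assumes "idx \<gamma> w" "l \<in> Y0" "\<gamma> l = \<pi> l" "\<gamma> (prm l) = \<pi> (prm l)"
    "i \<in> Y0" "\<gamma> i < \<pi> i" "\<gamma> (prm i) < \<pi> (prm i)"
  shows "cc \<gamma> w j v = 0"
proof -
  let ?i = "prm i" and ?l = "prm l"
  have pr: "?i \<in> Y0" "?l \<in> Y0" "?i \<noteq> i" "?l \<noteq> l" "prm ?i = i" "prm ?l = l"
    using assms(2,5) prm_simps by (auto simp: Y_def)
  have ne: "i \<noteq> l" "i \<noteq> ?l" "?i \<noteq> l" "?i \<noteq> ?l" using assms by auto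
  have ge: "\<pi> l \<ge> 4" "\<pi> ?l \<ge> 4" "\<pi> i \<ge> 4" "\<pi> ?i \<ge> 4" using \<pi>_ge assms pr by auto
  let ?\<beta> = "\<gamma>(l := 0, i := Suc (\<gamma> i))"
  \<comment> \<open>The by-product of contracting l with l'. Its exponent at l is \<pi>_l - 1, so
    \<open>cc_high\<close> with k = 2 disposes of it.\<close>
  let ?\<gamma> = "\<gamma>(l := \<pi> l - 1, ?l := \<pi> ?l - 1, i := Suc (\<gamma> i), ?i := Suc (\<gamma> ?i))"
  let ?f = "eps ?i + ee l (\<pi> l)"
  have w: "w \<in> B0" "w \<in> B" using idxD[OF assms(1)] by auto
  have le: "\<gamma> x \<le> \<pi> x" for x by (rule idx_le[OF assms(1)])
  have \<beta>: "idx ?\<beta> w" by (rule idx_less[of _ _ l]) (use w le assms ne ge in \<open>auto simp: A_def\<close>)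
  have \<gamma>2: "idx ?\<gamma> w" by (rule idx_less[of _ _ l]) (use w le assms ne ge pr in \<open>auto simp: A_def le_diff_conv\<close>)
  have f: "idx ?f {}" by (rule idx_less[of _ _ ?l]) (use assms ne ge pr in \<open>auto simp: A_def\<close>)
  have e1: "?\<beta>(i := ?\<beta> i - 1) = \<gamma>(l := 0)" using ne by (auto simp: fun_eq_iff)
  have e2: "?\<beta>(?l := ?\<beta> ?l - 1) = \<gamma>(l := 0, i := Suc (\<gamma> i), ?l := \<pi> ?l - 1)"
    using ne pr assms by (auto simp: fun_eq_iff)
  have A1: "\<gamma>(l := 0) \<in> A" "?\<beta>(?l := \<pi> ?l - 1) \<in> A" "ee l (\<pi> l) \<in> A" "eps ?i + ee l (\<pi> l - 1) \<in> A"
    using le assms ne ge pr by (auto simp: A_def)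
  have s1: "ee l (\<pi> l) + \<gamma>(l := 0) = \<gamma>" using assms by (auto simp: fun_eq_iff)
  have s2: "eps ?i + ee l (\<pi> l - 1) + ?\<beta>(?l := \<pi> ?l - 1) = ?\<gamma>"
    using ne pr assms by (auto simp: fun_eq_iff)
  have d1: "der i (xmon ?\<beta> w) = (xmon (\<gamma>(l := 0)) w :: 'a sup)"
    using der_xmon0[OF idxD(1,3)[OF \<beta>] assms(5), where 'a = 'a] e1 by simp
  have d2: "der ?l (xmon ?\<beta> w) = (xmon (?\<beta>(?l := \<pi> ?l - 1)) w :: 'a sup)"
    using der_xmon0[OF idxD(1,3)[OF \<beta>] pr(2), where 'a = 'a] e2 ne pr ge assms by simp
  have x1: "xmon (ee l (\<pi> l)) {} \<star> xmon (\<gamma>(l := 0)) w = (xmon \<gamma> w :: 'a sup)"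
    using omult_xmon_xmon[OF A1(3) empty_in_B A1(1) w(2), where 'a = 'a]
      xmon_mult_eq[OF s1 idxD(1)[OF assms(1)], of "{}" w, where 'a = 'a] assms by (simp add: bin_ee)
  have x2: "xmon (eps ?i + ee l (\<pi> l - 1)) {} \<star> xmon (?\<beta>(?l := \<pi> ?l - 1)) w =
      (oscale (of_nat (bin ?\<gamma> (eps ?i + ee l (\<pi> l - 1)))) (xmon ?\<gamma> w) :: 'a sup)"
    using omult_xmon_xmon[OF A1(4) empty_in_B A1(2) w(2), where 'a = 'a]
      xmon_mult_eq[OF s2 idxD(1)[OF \<gamma>2], of "{}" w, where 'a = 'a] by simp
  let ?c = "\<tau> l * of_nat (bin ?\<gamma> (eps ?i + ee l (\<pi> l - 1))) :: 'a"
  have "pb (xmon ?f {}) (xmon ?\<beta> w) =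
    oscale (\<tau> ?i) (xmon (ee l (\<pi> l)) {} \<star> der (prm ?i) (xmon ?\<beta> w :: 'a sup)) +
    oscale (\<tau> l) (xmon (eps ?i + ee l (\<pi> l - 1)) {} \<star> der ?l (xmon ?\<beta> w))"
    by (rule pb_eps_ee) (use idxD[OF f] idxD[OF \<beta>] pr assms(2) ne ge in auto)
  also have "\<dots> = oscale (\<tau> ?i) (xmon \<gamma> w) + oscale ?c (xmon ?\<gamma> w)"
    unfolding pr(5) d1 d2 x1 x2 by simp
  finally have "\<tau> ?i * cc \<gamma> w j v + ?c * cc ?\<gamma> w j v = bk ?f {} (ps ?\<beta> w) j v - bk ?\<beta> w (ps ?f {}) j v"
    using cc_pb[OF f \<beta>, of j v] \<phi>_scaled2[OF assms(1) \<gamma>2, of "\<tau> ?i" ?c j v] by simp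
  moreover have "bk ?f {} (ps ?\<beta> w) j v = 0"
    by (rule bk_degree_ge3)
      (use idxD[OF f] ps_W_even[OF \<beta>] sum_ge_two[OF pr(1) assms(2) ne(3), of ?f] ge ne in auto)
  moreover have "bk ?\<beta> w (ps ?f {}) j v = 0"
    by (rule bk_degree_ge3)
      (use idxD[OF \<beta>] ps_W_even[OF f] sum_ge_one[OF pr(2), of ?\<beta>] ge ne pr assms in auto)
  moreover have "cc ?\<gamma> w j v = 0"
    by (rule cc_high[OF \<gamma>2 assms(2), of 2])
      (use ne pr ge choose_two_\<pi>[OF assms(2)] sum_ge_two[OF assms(2) pr(2) pr(4)[symmetric], of ?\<gamma>] in auto)
  ultimately show ?thesis by simp
qed

text \<open>\<open>x\<^sup>(\<^sup>\<pi>\<^sup>) x\<^sup>u\<close> is reached only through the odd part of the Poisson bracket, contracting \<open>x\<^sub>l\<close> with \<open>l \<notin> u\<close>.\<close>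

lemma cc_top:
  assumes "idx \<pi> u"
  shows "cc \<pi> u j v = 0"
proof -
  have u: "u \<in> B0" "u \<in> B" "u \<noteq> {}" "u \<noteq> \<omega>" "even (card u)" "finite u" "u \<subseteq> Y1"
    using assms idxD[OF assms] B_finite by (auto simp: idx_def B0_def B_def)
  then obtain k l where kl: "k \<in> u" "l \<in> Y1" "l \<notin> u" unfolding \<omega>_def by blast
  have k: "k \<in> Y1" "k \<noteq> l" using kl u by auto
  let ?u = "u - {k}"
  have a: "1 \<in> Y0" using m1 by (simp add: Y0_def)
  have b: "2 \<in> Y0" using m1 by (simp add: Y0_def)
  have ge: "\<pi> 1 \<ge> 4" "\<pi> 2 \<ge> 4" using \<pi>_ge[OF a] \<pi>_ge[OF b] by auto
  \<comment> \<open>Splitting \<pi> along one coordinate makes the binomial factor 1 and leaves both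
    factors with degree at least 3.\<close>
  let ?\<alpha> = "ee 1 (\<pi> 1)" and ?\<beta> = "\<pi>(1 := 0)"
  have cu: "card (insert l ?u) = card u"
    using kl u card_Suc_Diff1[of u k] by simp
  have B: "{k, l} \<in> B0" "insert l ?u \<in> B0" "{k} \<in> B" "?u \<in> B"
    using kl k u cu by (auto simp: B0_def B_def)
  have f: "idx ?\<alpha> {k, l}" using a B by (intro idx_ee) auto
  have g: "idx ?\<beta> (insert l ?u)" by (rule idx_less[of _ _ 1]) (use B ge in \<open>auto simp: A_def\<close>)
  have s: "?\<alpha> + ?\<beta> = \<pi>" by (auto simp: fun_eq_iff)
  let ?c = "reord_sign {l} {k} * reord_sign {l} ?u * reord_sign {k} ?u :: 'a"
  \<comment> \<open>An even contraction leaves \<open>l\<close> in both exterior factors.\<close>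
  have "oscale (\<tau> i) (der i (xmon ?\<alpha> {k, l}) \<star> der (prm i) (xmon ?\<beta> (insert l ?u))) = (0 :: 'a sup)"
    if i: "i \<in> Y0" for i
  proof -
    have "xmon_mult \<alpha> {k, l} \<beta> (insert l ?u) = (0 :: 'a sup)" for \<alpha> \<beta> by (simp add: xmon_mult_def)
    then show ?thesis using i prm_simps(1)[OF i] idxD[OF f] idxD[OF g]
        A_upd_dec[OF idxD(1)[OF f], of i] A_upd_dec[OF idxD(1)[OF g], of "prm i"]
      by (simp add: der_xmon0 omult_xmon_xmon del: ee_apply fun_upd_apply)
  qed
  then have 1: "(\<Sum>i\<in>Y0. oscale (\<tau> i) (der i (xmon ?\<alpha> {k, l}) \<star> der (prm i) (xmon ?\<beta> (insert l ?u)))) = (0 :: 'a sup)"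
    by (intro sum.neutral) blast
  have "oscale (\<tau> i) (der i (xmon ?\<alpha> {k, l}) \<star> der (prm i) (xmon ?\<beta> (insert l ?u))) =
      (if i = l then oscale ?c (xmon \<pi> u) else (0 :: 'a sup))" if i: "i \<in> Y1" for i
  proof (cases "i = l")
    case True
    have "{k, l} - {l} = {k}" "insert l ?u - {l} = ?u" using kl k by auto
    moreover have "xmon_mult ?\<alpha> {k} ?\<beta> ?u = (oscale (reord_sign {k} ?u) (xmon \<pi> u) :: 'a sup)"
      using xmon_mult_eq[OF s idxD(1)[OF assms], of "{k}" ?u, where 'a = 'a] a kl by (simp add: bin_ee insert_absorb)
    ultimately show ?thesis using True i kl k B idxD[OF f] idxD[OF g]
      by (simp add: der_xmon1 prm_simps \<tau>_simps omult_scale_left omult_scale_right omult_xmon_xmon mult_ac)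
  next
    case False
    then show ?thesis using i kl k idxD[OF f] idxD[OF g] by (auto simp: der_xmon1 prm_simps)
  qed
  then have "(\<Sum>i\<in>Y1. oscale (\<tau> i) (der i (xmon ?\<alpha> {k, l}) \<star> der (prm i) (xmon ?\<beta> (insert l ?u)))) =
      (\<Sum>i\<in>Y1. if i = l then oscale ?c (xmon \<pi> u) else (0 :: 'a sup))"
    by (intro sum.cong) auto
  then have "pb (xmon ?\<alpha> {k, l}) (xmon ?\<beta> (insert l ?u)) = (oscale ?c (xmon \<pi> u) :: 'a sup)"
    unfolding pb_def sum_Y 1 using kl by simp
  then have "?c * cc \<pi> u j v = bk ?\<alpha> {k, l} (ps ?\<beta> (insert l ?u)) j v - bk ?\<beta> (insert l ?u) (ps ?\<alpha> {k, l}) j v"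
    using cc_pb[OF f g, of j v] \<phi>_scaled[OF assms, of ?c j v] by simp
  moreover have "bk ?\<alpha> {k, l} (ps ?\<beta> (insert l ?u)) j v = 0"
    by (rule bk_degree_ge3) (use idxD[OF f] ps_W_even[OF g] sum_ge_one[OF a, of ?\<alpha>] ge in auto)
  moreover have "bk ?\<beta> (insert l ?u) (ps ?\<alpha> {k, l}) j v = 0"
    by (rule bk_degree_ge3) (use idxD[OF g] ps_W_even[OF f] sum_ge_one[OF b, of ?\<beta>] ge in auto)
  ultimately show ?thesis by simp
qed

text \<open>A maximal coordinate forces its partner to be maximal by \<open>cc_half_top\<close>,
  then every coordinate by \<open>cc_mixed\<close>, and \<gamma> = \<pi> is excluded by
  \<open>cc_top\<close>.\<close>

lemma cc_below_\<pi>: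
  assumes "idx \<gamma> w" "cc \<gamma> w j v \<noteq> 0" "i \<in> Y0"
  shows "\<gamma> i < \<pi> i"
proof (rule ccontr)
  assume "\<not> \<gamma> i < \<pi> i"
  then have i: "\<gamma> i = \<pi> i" using idx_le[OF assms(1), of i] by simp
  have half: "\<gamma> (prm l) = \<pi> (prm l)" if "l \<in> Y0" "\<gamma> l = \<pi> l" for l
    using cc_half_top[OF assms(1) that] assms(2) idx_le[OF assms(1), of "prm l"] by (metis nat_less_le)
  have "\<gamma> l = \<pi> l" if l: "l \<in> Y0" for l
  proof (rule ccontr)
    assume ne: "\<gamma> l \<noteq> \<pi> l"
    have "\<gamma> (prm l) \<noteq> \<pi> (prm l)" using half[of "prm l"] ne l prm_simps by (metis Y_cases)
    then show False using cc_mixed[OF assms(1,3) i half[OF assms(3) i] l] ne idx_le[OF assms(1)] assms(2)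
      by (metis nat_less_le)
  qed
  moreover have "\<gamma> l = \<pi> l" if "l \<notin> Y0" for l
    using A_outside[OF idxD(1)[OF assms(1)] that] that by (simp add: \<pi>_def)
  ultimately have "\<gamma> = \<pi>" by (auto simp: fun_eq_iff)
  then show False using cc_top assms by simp
qed

text \<open>A coordinate that p does not divide is unique by \<open>cc_double\<close>, is 1 modulo p
  by \<open>cc_triple\<close>, and determines \<open>j\<close> by \<open>cc_single\<close>;
  \<open>cc_below_\<pi>\<close> supplies the room that these require.\<close>

lemma cc_support:
  assumes "idx \<gamma> w" "cc \<gamma> w j v \<noteq> 0"
  shows "(j \<in> Y1 \<and> (\<forall>i\<in>Y0. p dvd \<gamma> i)) \<or>
    (\<exists>l\<in>Y0. j = prm l \<and> \<gamma> l mod p = 1 \<and> (\<forall>i\<in>Y0 - {l}. p dvd \<gamma> i))"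
proof (cases "\<forall>i\<in>Y0. p dvd \<gamma> i")
  case True
  have "j \<notin> Y0"
  proof
    assume j: "j \<in> Y0"
    let ?j = "prm j"
    have pj: "?j \<in> Y0" "?j \<noteq> j" "prm ?j = j" using j prm_simps by (auto simp: Y_def)
    have pos: "\<gamma> ?j \<noteq> 0" using cc_partner_zero[OF assms(1) j] assms(2) by metis
    have b: "\<gamma> j + 2 \<le> \<pi> j" "\<gamma> ?j + 2 \<le> \<pi> ?j" using dvd_less_\<pi>[of "\<gamma> j" j] dvd_less_\<pi>[of "\<gamma> ?j" ?j] True pj j idx_le[OF assms(1)]
      by simp_all
    \<comment> \<open>Moving one unit from j' to j makes both residues nonzero, so
      \<open>cc_double\<close> kills this term, while \<open>cc_shift1\<close> moves the unit back
      to the given coefficient.\<close>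
    let ?\<gamma> = "\<gamma>(j := Suc (\<gamma> j), ?j := \<gamma> ?j - 1)"
    have \<gamma>: "idx ?\<gamma> w" by (rule idx_less[of _ _ j])
        (use idx_le[OF assms(1)] b pj idxD[OF assms(1)] in \<open>auto simp: A_def le_diff_conv le_SucI\<close>)
    have 1: "\<not> p dvd Suc (\<gamma> j)" using True j by (simp add: not_dvd_Suc)
    have 2: "\<not> p dvd \<gamma> ?j - 1"
    proof
      assume "p dvd \<gamma> ?j - 1"
      moreover have "p dvd \<gamma> ?j" using True pj by blast
      ultimately have "p dvd \<gamma> ?j - (\<gamma> ?j - 1)" by (rule dvd_diff_nat[rotated])
      then show False using pos p3 by simp
    qed
    have 0: "cc ?\<gamma> w ?j v = 0"
      by (rule cc_double[OF \<gamma>, of j ?j]) (use 1 2 b pj j in auto)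
    have e: "?\<gamma>(j := ?\<gamma> j - 1, ?j := Suc (?\<gamma> ?j)) = \<gamma>" using pj pos by (auto simp: fun_eq_iff)
    have "of_nat (?\<gamma> j) * cc ?\<gamma> w ?j v = - (if ?j = ?j then cc (?\<gamma>(j := ?\<gamma> j - 1, ?j := Suc (?\<gamma> ?j))) w j v else 0)"
      by (rule cc_shift1[OF \<gamma> j]) (use b pj in auto)
    then show False unfolding e 0 using assms(2) by simp
  qed
  moreover have "j \<in> Y" using cc_outside assms by blast
  ultimately show ?thesis using True by (auto simp: Y_cases)
next
  case False
  then obtain l where l: "l \<in> Y0" "\<not> p dvd \<gamma> l" by blast
  have lt: "\<gamma> (prm i) < \<pi> (prm i)" if "i \<in> Y0" for i
    using cc_below_\<pi>[OF assms prm_simps(1)[OF that]] .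
  have other: "p dvd \<gamma> i" if "i \<in> Y0 - {l}" for i
    using cc_double[OF assms(1) l lt[OF l(1)], of i j v] that lt[of i] assms(2) by auto
  have "j = prm l" using cc_single[OF assms(1) l lt[OF l(1)]] assms(2) by blast
  moreover have "\<gamma> l mod p = 1"
    using cc_triple[OF assms(1) l] other[of "prm l"] prm_simps(1,5)[OF l(1)] assms(2) by blast
  ultimately show ?thesis using l other by blast
qed

end

section \<open>Rotations of the exterior variables, and the surviving exponents\<close>

context ham
begin

text \<open>\<open>dl k\<close> is \<open>\<partial>\<^sub>k\<close> and \<open>rot k l\<close> is \<open>D\<^sub>H (x\<^sub>k x\<^sub>l)\<close>, both acting on constant parts.\<close>

definition dl :: "nat \<Rightarrow> (nat set \<Rightarrow> 'a::field) \<Rightarrow> nat set \<Rightarrow> 'a"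
  where "dl k F v = (if k \<in> v then 0 else reord_sign {k} v * F (insert k v))"

definition rot :: "nat \<Rightarrow> nat \<Rightarrow> (nat set \<Rightarrow> 'a::field) \<Rightarrow> nat set \<Rightarrow> 'a"
  where "rot k l F v = reord_sign {k} {l} * ml {l} (dl k F) v + reord_sign {l} {k} * ml {k} (dl l F) v"

lemma rot_commute: "rot k l F v = rot l k F v"
  by (simp add: rot_def add.commute)

lemma rot_eval:
  assumes "k \<noteq> l" "v \<in> B" "l \<in> v" "k \<notin> v"
  shows "rot k l F v =
    reord_sign {k} {l} * reord_sign {k} (v - {l}) * reord_sign {l} (v - {l}) * F (insert k (v - {l}))"
  using assms by (simp add: rot_def ml_def dl_def)

lemma rot_same:
  assumes "k \<in> v \<longleftrightarrow> l \<in> v" "k \<noteq> l"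
  shows "rot k l F v = 0"
  using assms by (auto simp: rot_def ml_def dl_def)

text \<open>The rotation carries x^w to a multiple of the monomial with \<open>k\<close> replaced by
  \<open>l\<close>, and no other monomial lands there. So an invariant has no monomial that contains
  \<open>k\<close> and misses \<open>l\<close>.\<close>

lemma rot_zeroD:
  assumes "\<And>v. v \<in> B \<Longrightarrow> rot k l F v = (0::'a::field)" "k \<in> w" "l \<notin> w" "w \<in> B" "l \<in> Y1"
  shows "F w = 0"
proof -
  let ?v = "insert l (w - {k})"
  have v: "?v \<in> B" using assms by (auto simp: B_def)
  have "k \<noteq> l" "k \<notin> ?v" "insert k (?v - {l}) = w" using assms by auto
  then show ?thesis using assms(1)[OF v] rot_eval[of k l ?v F] v by simp
qed

lemma rot_scale: "rot k l (\<lambda>v. c * F v) v = c * rot k l F v"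
  by (simp add: rot_def ml_def dl_def algebra_simps)

lemma reord_sign_swap: "k \<noteq> l \<Longrightarrow> reord_sign {l} {k} = (- reord_sign {k} {l} :: 'a::field)"
  using reord_sign_commute[of "{k}" "{l}", where 'a = 'a] by simp

lemma reord_sign_even:
  assumes "finite u" "finite v" "u \<inter> v = {}" "even (card u)"
  shows "reord_sign v u = (reord_sign u v :: 'a::field)"
  using reord_sign_commute[OF assms(1-3), where 'a = 'a] assms(4) by simp

lemma pair_B0: "k \<in> Y1 \<Longrightarrow> l \<in> Y1 \<Longrightarrow> k \<noteq> l \<Longrightarrow> {k, l} \<in> B0"
  by (auto simp: B0_def B_def)

lemma \<omega>_B [simp]: "\<omega> \<in> B" by (simp add: \<omega>_def B_def)

lemma B0_Un:
  assumes "u \<in> B0" "w \<in> B0" "u \<inter> w = {}"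
  shows "u \<union> w \<in> B0"
  using assms B_finite by (auto simp: B0_def B_Un card_Un_disjoint)

end

context ham_der
begin

lemma one_Y0: "1 \<in> Y0" "2 \<in> Y0" "2 \<noteq> prm 1"
  using m1 by (auto simp: Y0_def prm_def)

lemma \<omega>_nonempty: "\<omega> \<noteq> {}"
  using n3 by (simp add: \<omega>_def Y1_def)

definition Dp :: "(nat \<Rightarrow> nat) set"
  where "Dp = {ee r (p ^ s) |r s. r \<in> Y0 \<and> 1 \<le> s \<and> s < t r}"

lemma power_le_\<pi>: "r \<in> Y0 \<Longrightarrow> s < t r \<longleftrightarrow> p ^ s \<le> \<pi> r"
  using Suc_\<pi>[of r] p3 power_strict_increasing_iff[of p s "t r"] less_Suc_eq_le[of "p ^ s" "\<pi> r"] by simp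

lemma Dl_dvd: "\<delta> \<in> insert 0 Dp \<Longrightarrow> p dvd \<delta> i"
  by (auto simp: Dp_def)

lemma Dl_A: "\<delta> \<in> insert 0 Dp \<Longrightarrow> \<delta> \<in> A"
  using power_le_\<pi> by (auto simp: Dp_def intro!: ee_in_A)

lemma Dl_bound: "\<delta> \<in> insert 0 Dp \<Longrightarrow> i \<in> Y0 \<Longrightarrow> \<delta> i + 2 \<le> \<pi> i"
  using Dl_dvd Dl_A by (intro dvd_less_\<pi>) (auto simp: A_def)

lemma Dp_sum: "\<delta> \<in> Dp \<Longrightarrow> sum \<delta> Y0 \<ge> 3"
proof -
  assume "\<delta> \<in> Dp"
  then obtain r s where rs: "\<delta> = ee r (p ^ s)" "r \<in> Y0" "1 \<le> s" by (auto simp: Dp_def)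
  have "p ^ 1 \<le> p ^ s" using rs(3) p3 by (intro power_increasing) auto
  then show ?thesis using rs p3 by simp
qed

lemma idx_Dl:
  assumes "\<delta> \<in> insert 0 Dp" "u \<in> B0"
  shows "idx \<delta> u" "l \<in> Y0 \<Longrightarrow> idx (\<delta> + eps l) u"
    "l \<in> Y0 \<Longrightarrow> q \<in> Y0 \<Longrightarrow> l \<noteq> q \<Longrightarrow> idx (\<delta> + eps l + eps q) u"
proof -
  have A: "\<delta> i \<le> \<pi> i" for i using Dl_A[OF assms(1)] by (simp add: A_def)
  have b: "\<delta> i + 2 \<le> \<pi> i" if "i \<in> Y0" for i by (rule Dl_bound[OF assms(1) that])
  show "idx \<delta> u" by (rule idx_less[of _ _ 1]) (use b[of 1] Dl_A assms one_Y0 in auto)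
  show "idx (\<delta> + eps l) u" if l: "l \<in> Y0"
    by (rule idx_less[of _ _ l]) (use b[of l] A assms l in \<open>auto simp: A_def\<close>)
  show "idx (\<delta> + eps l + eps q) u" if l: "l \<in> Y0" "q \<in> Y0" "l \<noteq> q"
    by (rule idx_less[of _ _ l]) (use b[of l] b[of q] A assms l in \<open>auto simp: A_def\<close>)
qed

lemma cc_two_units:
  assumes "idx \<gamma> w" "a \<in> Y0" "b \<in> Y0" "a \<noteq> b" "\<not> p dvd \<gamma> a" "\<not> p dvd \<gamma> b"
  shows "cc \<gamma> w j v = 0"
  using cc_support[OF assms(1), of j v] assms by blast

text \<open>All entries of \<delta> are 0 modulo p, so the residues of these exponents are known and
  \<open>cc_support\<close> decides.\<close>

lemma cc_Dl:
  assumes "\<delta> \<in> insert 0 Dp" "u \<in> B0"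
  shows "j \<notin> Y1 \<Longrightarrow> cc \<delta> u j v = 0"
    "l \<in> Y0 \<Longrightarrow> j \<noteq> prm l \<Longrightarrow> cc (\<delta> + eps l) u j v = 0"
    "l \<in> Y0 \<Longrightarrow> q \<in> Y0 \<Longrightarrow> l \<noteq> q \<Longrightarrow> cc (\<delta> + eps l + eps q) u j v = 0"
proof -
  have d: "p dvd \<delta> i" "\<delta> i mod p \<noteq> 1" "\<not> p dvd Suc (\<delta> i)" for i
    using Dl_dvd[OF assms(1), of i] not_dvd_Suc by auto
  show "cc \<delta> u j v = 0" if "j \<notin> Y1"
    using cc_support[OF idx_Dl(1)[OF assms], of j v] d that by blast
  show "cc (\<delta> + eps l) u j v = 0" if l: "l \<in> Y0" "j \<noteq> prm l"
  proof (rule ccontr)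
    assume "cc (\<delta> + eps l) u j v \<noteq> 0"
    from cc_support[OF idx_Dl(2)[OF assms l(1)] this]
    show False
    proof (elim disjE conjE bexE)
      assume "\<forall>i\<in>Y0. p dvd (\<delta> + eps l) i"
      then show False using d(3)[of l] l(1) by force
    next
      fix l' assume "j = prm l'" "(\<delta> + eps l) l' mod p = 1"
      then show False using l d(2)[of l'] by (cases "l' = l") auto
    qed
  qed
  show "cc (\<delta> + eps l + eps q) u j v = 0" if l: "l \<in> Y0" "q \<in> Y0" "l \<noteq> q"
    by (rule cc_two_units[OF idx_Dl(3)[OF assms l] l]) (use d l in auto)
qed

text \<open>If the p-divisible part \<delta> is neither 0 nor a single p^s \<epsilon>_r, then
  \<open>cc_high\<close> applies with k the largest power of p not exceeding some \<delta>_r > 0: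
  the rest of \<delta> is nonzero and makes the second factor large enough.\<close>

lemma cc_cases:
  assumes "idx \<gamma> u" "cc \<gamma> u j v \<noteq> 0"
  shows "\<exists>\<delta>\<in>insert 0 Dp. (\<gamma> = \<delta> \<and> j \<in> Y1) \<or> (\<exists>l\<in>Y0. \<gamma> = \<delta> + eps l \<and> j = prm l)"
proof -
  have key: "\<delta> \<in> insert 0 Dp" if \<delta>: "\<And>i. p dvd \<delta> i" "\<And>i. \<delta> i \<le> \<gamma> i" "\<And>i. \<gamma> i \<le> Suc (\<delta> i)" for \<delta>
  proof (rule ccontr)
    assume n: "\<delta> \<notin> insert 0 Dp"
    then obtain r where r: "\<delta> r \<noteq> 0" by (auto simp: fun_eq_iff)
    have rY: "r \<in> Y0" using A_outside[OF idxD(1)[OF assms(1)], of r] \<delta>(2)[of r] r by (cases "r \<in> Y0") auto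
    obtain s where s: "p ^ s \<le> \<delta> r" "\<delta> r < p ^ (s + 1)"
      using ex_power_ivl1[of p "\<delta> r"] p3 r by auto
    have "p \<le> \<delta> r" using \<delta>(1)[of r] r by (auto dest: dvd_imp_le)
    then have s1: "1 \<le> s" using s(2) by (cases s) auto
    have ps2: "2 \<le> p ^ s"
      using power_increasing[OF s1, of p] p3 by simp
    have lt: "\<gamma> r < \<pi> r" "\<gamma> (prm r) < \<pi> (prm r)" using cc_below_\<pi>[OF assms] rY prm_simps(1) by auto
    have st: "s < t r" unfolding power_le_\<pi>[OF rY] using s(1) \<delta>(2)[of r] lt(1) by linarith
    then have ne: "\<delta> \<noteq> ee r (p ^ s)" using n rY s1 by (auto simp: Dp_def)
    \<comment> \<open>What remains of \<delta> without p^s \<epsilon>_r. A nonzero entry of it is at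
      least p, which covers the 2 that \<open>cc_high\<close> asks for beyond p^s.\<close>
    let ?\<rho> = "\<delta>(r := \<delta> r - p ^ s)"
    have d\<rho>: "p dvd ?\<rho> i" for i using \<delta>(1) s1 by (auto intro!: dvd_diff_nat)
    have "?\<rho> \<noteq> 0"
    proof
      assume "?\<rho> = 0"
      then have z: "?\<rho> i = 0" for i by simp
      have "\<delta> i = ee r (p ^ s) i" for i using z[of i] s(1) by (cases "i = r") auto
      with ne show False by (simp add: fun_eq_iff)
    qed
    then obtain q where q: "?\<rho> q \<noteq> 0" by (auto simp: fun_eq_iff)
    have qY: "q \<in> Y0" using A_outside[OF idxD(1)[OF assms(1)], of q] \<delta>(2)[of q] q rY
      by (cases "q \<in> Y0") (auto split: if_splits)
    have "p \<le> ?\<rho> q" using d\<rho>[of q] q by (auto dest: dvd_imp_le)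
    also have "\<dots> \<le> sum ?\<rho> Y0" by (rule sum_ge_one[OF qY])
    finally have "p \<le> sum ?\<rho> Y0" .
    moreover have "sum ?\<rho> Y0 + p ^ s = sum \<delta> Y0"
    proof -
      have "sum \<delta> Y0 = \<delta> r + sum \<delta> (Y0 - {r})" "sum ?\<rho> Y0 = \<delta> r - p ^ s + sum \<delta> (Y0 - {r})"
        using rY by (simp_all add: sum.remove)
      then show ?thesis using s(1) by linarith
    qed
    moreover have "sum \<delta> Y0 \<le> sum \<gamma> Y0" by (rule sum_mono) (rule \<delta>(2))
    ultimately have sum: "p ^ s + 2 \<le> sum \<gamma> Y0" using p3 by linarith
    \<comment> \<open>\<gamma>_r may exceed \<delta>_r by 1; reaching the next power of p would make
      \<delta>_r + 1 divisible by p.\<close>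
    have "\<gamma> r \<noteq> p ^ Suc s"
    proof
      assume "\<gamma> r = p ^ Suc s"
      then have "Suc (\<delta> r) = p ^ Suc s" using \<delta>(3)[of r] s(2) by simp
      then show False using not_dvd_Suc[OF \<delta>(1)[of r]] by simp
    qed
    then have "\<gamma> r < p ^ Suc s" using \<delta>(3)[of r] s(2) by simp
    then have "of_nat (\<gamma> r choose p ^ s) \<noteq> (0::'a)"
      using s(1) \<delta>(2)[of r] by (intro binomial_prime_power_neq_0[OF prime_p char]) auto
    then have "cc \<gamma> u j v = 0"
      using s(1) \<delta>(2)[of r] lt ps2 sum by (intro cc_high[OF assms(1) rY]) auto
    with assms(2) show False by simp
  qed
  have out: "\<gamma> i = 0" if "i \<notin> Y0" for i by (rule A_outside[OF idxD(1)[OF assms(1)] that])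
  from cc_support[OF assms] show ?thesis
  proof (elim disjE conjE bexE)
    assume j: "j \<in> Y1" and d: "\<forall>i\<in>Y0. p dvd \<gamma> i"
    have "\<gamma> \<in> insert 0 Dp"
    proof (rule key)
      show "p dvd \<gamma> i" for i using d out[of i] by (cases "i \<in> Y0") auto
    qed auto
    then show ?thesis using j by blast
  next
    fix l assume l: "l \<in> Y0" "j = prm l" "\<gamma> l mod p = 1" and d: "\<forall>i\<in>Y0 - {l}. p dvd \<gamma> i"
    let ?\<delta> = "\<gamma>(l := \<gamma> l - 1)"
    have pos: "\<gamma> l \<noteq> 0" using l(3) by (metis mod_0 zero_neq_one)
    have dl: "p dvd \<gamma> l - 1" using l(3) by (metis dvd_minus_mod)
    have "?\<delta> \<in> insert 0 Dp"
    proof (rule key)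
      show "p dvd ?\<delta> i" for i using d out[of i] dl by (cases "i \<in> Y0") auto
    qed auto
    moreover have "\<gamma> = ?\<delta> + eps l" using pos by (auto simp: fun_eq_iff)
    ultimately show ?thesis using l by blast
  qed
qed

subsection \<open>The \<open>Y\<^sub>0\<close>-components\<close>

text \<open>\<open>D\<^sub>H\<close> of x_{l'} x_q has degree 0, so \<phi> commutes with it. Up to
  signs and a by-product without constant part in the component q', it replaces \<epsilon>_l by
  \<epsilon>_q in the argument and sends \<partial>_{l'} to \<partial>_{q'} in the value.\<close>

lemma cc_link:
  assumes "\<delta> \<in> insert 0 Dp" "u \<in> B0" "l \<in> Y0" "q \<in> Y0" "q \<noteq> l" "q \<noteq> prm l"
  shows "\<tau> q * cc (\<delta> + eps q) u (prm q) v = \<tau> l * cc (\<delta> + eps l) u (prm l) v"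
proof (cases "v \<in> B")
  case vB: True
  let ?l = "prm l" and ?q = "prm q"
  have pr: "?l \<in> Y0" "?q \<in> Y0" "?l \<noteq> l" "?q \<noteq> q" "prm ?l = l" using assms prm_simps by (auto simp: Y_def)
  have ne: "?l \<noteq> q" "?q \<noteq> l" "?q \<noteq> ?l" using assms prm_inj prm_simps(4)[of q] by (auto simp: Y_def)
  have d: "p dvd \<delta> i" "\<not> p dvd Suc (\<delta> i)" for i
    using Dl_dvd[OF assms(1), of i] not_dvd_Suc by auto
  note ii = idx_Dl[OF assms(1,2)]
  let ?\<beta> = "\<delta> + eps l" and ?f = "eps ?l + ee q 1"
  have \<beta>: "idx ?\<beta> u" by (rule ii(2)[OF assms(3)])
  have f: "idx ?f {}"
    using idx_Dl(3)[of 0 "{}" ?l q] pr(1) assms(4) ne(1) by (simp add: eps_eq_ee)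
  have e1: "?\<beta>(l := ?\<beta> l - 1) = \<delta>" by (auto simp: fun_eq_iff)
  have s1: "ee q 1 + \<delta> = \<delta> + eps q" by (auto simp: fun_eq_iff)
  have "of_nat (\<delta> q) = (0::'a)" using d(1) by (simp add: of_nat_eq_0)
  then have b1: "of_nat (bin (\<delta> + eps q) (ee q 1)) = (1::'a)" using assms(4) by (simp add: bin_ee)
  have q1: "ee q 1 \<in> A" using assms(4) \<pi>_ge[of q] by (intro ee_in_A) auto
  have x1: "xmon (ee q 1) {} \<star> xmon \<delta> u = (xmon (\<delta> + eps q) u :: 'a sup)"
    using omult_xmon_xmon[OF q1 empty_in_B idxD(1,3)[OF ii(1)], where 'a = 'a]
      xmon_mult_eq[OF s1 idxD(1)[OF ii(2)[OF assms(4)]], of "{}" u, where 'a = 'a] b1 by simp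
  have d1: "der l (xmon ?\<beta> u) = (xmon \<delta> u :: 'a sup)"
    using der_xmon0[OF idxD(1,3)[OF \<beta>] assms(3), where 'a = 'a] unfolding e1 by simp
  \<comment> \<open>The by-product of contracting q with q'. Either it vanishes, recorded with c = 0
    and the dummy exponent 0, or its entries at l' and q' are both nonzero modulo p and
    \<open>cc_two_units\<close> applies.\<close>
  have rest: "\<exists>c \<gamma>. idx \<gamma> u \<and> cc \<gamma> u ?q v = 0 \<and>
      xmon (eps ?l + ee q (1 - 1)) {} \<star> der ?q (xmon ?\<beta> u) = (oscale c (xmon \<gamma> u) :: 'a sup)"
  proof (cases "\<delta> ?q = 0")
    case True
    then have "der ?q (xmon ?\<beta> u) = (0 :: 'a sup)"
      using der_xmon0[OF idxD(1,3)[OF \<beta>] pr(2), where 'a = 'a] ne by simp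
    then have "xmon (eps ?l + ee q (1 - 1)) {} \<star> der ?q (xmon ?\<beta> u) = (oscale 0 (xmon 0 u) :: 'a sup)"
      by simp
    moreover have "idx 0 u" "cc 0 u ?q v = 0"
      using idx_zero[OF assms(2)] cc_Dl(1)[of 0 u ?q v] assms(2) pr(2) Y_disjoint(1) by auto
    ultimately show ?thesis by blast
  next
    case False
    let ?\<epsilon> = "?\<beta>(?q := ?\<beta> ?q - 1)"
    let ?\<gamma> = "eps ?l + ?\<epsilon>"
    have b: "\<delta> i + 2 \<le> \<pi> i" if "i \<in> Y0" for i by (rule Dl_bound[OF assms(1) that])
    have le: "\<delta> i \<le> \<pi> i" for i using Dl_A[OF assms(1)] by (simp add: A_def)
    have \<gamma>: "idx ?\<gamma> u"
      by (rule idx_less[of _ _ l])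
        (use b[of l] b[of ?l] b[of ?q] le assms pr ne in \<open>auto simp: A_def le_diff_conv intro: le_trans[OF diff_le_self]\<close>)
    have "\<not> p dvd \<delta> ?q - 1"
    proof
      assume "p dvd \<delta> ?q - 1"
      from dvd_diff_nat[OF d(1)[of ?q] this] have "p dvd 1" using False by simp
      then show False using p3 by simp
    qed
    then have "cc ?\<gamma> u ?q v = 0"
      by (intro cc_two_units[OF \<gamma> pr(1,2) ne(3)[symmetric]]) (use d(2) ne pr in auto)
    moreover have "xmon (eps ?l) {} \<star> xmon ?\<epsilon> u =
        (oscale (of_nat (bin ?\<gamma> (eps ?l))) (xmon ?\<gamma> u) :: 'a sup)"
      using omult_xmon_xmon[OF idxD(1)[OF idx_eps[OF pr(1) B0_empty]] empty_in_B A_upd_dec[OF idxD(1)[OF \<beta>]] idxD(3)[OF \<beta>], where 'a = 'a]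
        xmon_mult_eq[OF refl idxD(1)[OF \<gamma>], of "{}" u, where 'a = 'a] by simp
    moreover have "der ?q (xmon ?\<beta> u) = (xmon ?\<epsilon> u :: 'a sup)"
      using der_xmon0[OF idxD(1,3)[OF \<beta>] pr(2), where 'a = 'a] False by simp
    ultimately show ?thesis using \<gamma> by (intro exI[of _ "of_nat (bin ?\<gamma> (eps ?l))"] exI[of _ ?\<gamma>]) simp
  qed
  then obtain c \<gamma> where \<gamma>: "idx \<gamma> u" "cc \<gamma> u ?q v = 0"
    "xmon (eps ?l + ee q (1 - 1)) {} \<star> der ?q (xmon ?\<beta> u) = (oscale c (xmon \<gamma> u) :: 'a sup)" by blast
  have "pb (xmon ?f {}) (xmon ?\<beta> u) =
    oscale (\<tau> ?l) (xmon (ee q 1) {} \<star> der (prm ?l) (xmon ?\<beta> u :: 'a sup)) +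
    oscale (\<tau> q) (xmon (eps ?l + ee q (1 - 1)) {} \<star> der ?q (xmon ?\<beta> u))"
    by (rule pb_eps_ee) (use idxD[OF f] idxD[OF \<beta>] pr assms(4) ne in auto)
  also have "\<dots> = oscale (\<tau> ?l) (xmon (\<delta> + eps q) u) + oscale (\<tau> q * c) (xmon \<gamma> u)"
    unfolding pr(5) d1 x1 \<gamma>(3) by simp
  finally have "\<tau> ?l * cc (\<delta> + eps q) u ?q v + \<tau> q * c * cc \<gamma> u ?q v =
      bk ?f {} (ps ?\<beta> u) ?q v - bk ?\<beta> u (ps ?f {}) ?q v"
    using cc_pb[OF f \<beta>, of ?q v] \<phi>_scaled2[OF ii(2)[OF assms(4)] \<gamma>(1), of "\<tau> ?l" "\<tau> q * c" ?q v] by simp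
  moreover have "ps ?f {} = 0"
    using ps_vanish[OF f] pr assms by (simp add: sum.distrib)
  moreover have "bk ?f {} (ps ?\<beta> u) ?q v = - (\<tau> q * cc ?\<beta> u ?l v)"
    using bk_two[of ?l q "{}" "ps ?\<beta> u" ?q v] idxD(1)[OF f] ps_W_even[OF \<beta>] pr assms ne vB
    by (simp add: eps_eq_ee cc_def ml_empty)
  ultimately have "\<tau> ?l * cc (\<delta> + eps q) u ?q v = - (\<tau> q * cc ?\<beta> u ?l v)"
    using \<gamma>(2) bk_zero_right[OF idxD(1,2)[OF \<beta>], of ?q v, where 'a = 'a] by simp
  then have "\<tau> l * cc (\<delta> + eps q) u ?q v = \<tau> q * cc ?\<beta> u ?l v"
    using \<tau>_simps(2)[OF assms(3), where 'a = 'a] by simp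
  then have "\<tau> q * \<tau> l * (\<tau> l * cc (\<delta> + eps q) u ?q v) = \<tau> q * \<tau> l * (\<tau> q * cc ?\<beta> u ?l v)" by simp
  moreover have "\<tau> q * \<tau> l * (\<tau> l * x) = \<tau> q * x" "\<tau> q * \<tau> l * (\<tau> q * x) = \<tau> l * x" for x :: 'a
    by (simp_all add: \<tau>_def)
  ultimately show ?thesis by simp
qed (use assms cc_outside idx_Dl(2)[OF assms(1,2)] in simp)

text \<open>The coefficient \<open>e\<close> in \<open>cc (\<delta> + \<epsilon>\<^sub>l) u = \<tau> l e \<partial>\<^bsub>l'\<^esub>\<close>; it does not depend on \<open>l \<in> Y0\<close>, and \<open>l = 1\<close> is an arbitrary choice.\<close>
definition ef :: "(nat \<Rightarrow> nat) \<Rightarrow> nat set \<Rightarrow> nat set \<Rightarrow> 'a"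
  where "ef \<delta> u v = \<tau> 1 * cc (\<delta> + eps 1) u (prm 1) v"

text \<open>\<open>cc_link\<close> does not relate l to l', so l = 1' is reached through the index
  2, which lies outside the pair 1, 1' because m > 1.\<close>

lemma cc_ef:
  assumes "\<delta> \<in> insert 0 Dp" "u \<in> B0" "l \<in> Y0"
  shows "cc (\<delta> + eps l) u (prm l) v = \<tau> l * ef \<delta> u v"
proof -
  have "\<tau> l * cc (\<delta> + eps l) u (prm l) v = ef \<delta> u v"
  proof (cases "l = 1 \<or> l = prm 1")
    case False
    then show ?thesis using cc_link[OF assms(1,2) one_Y0(1) assms(3), of v] by (simp add: ef_def)
  next
    case True
    then show ?thesis
    proof
      assume l: "l = prm 1"
      have p1: "prm (prm 1) = 1" using one_Y0 prm_simps(4) by (simp add: Y_def)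
      have "\<tau> 2 * cc (\<delta> + eps 2) u (prm 2) v = ef \<delta> u v"
        using cc_link[OF assms(1,2) one_Y0(1,2), of v] one_Y0(3) by (simp add: ef_def)
      moreover have "\<tau> 2 * cc (\<delta> + eps 2) u (prm 2) v = \<tau> l * cc (\<delta> + eps l) u (prm l) v"
        by (rule cc_link[OF assms(1-3) one_Y0(2)]) (use l p1 one_Y0(3) in auto)
      ultimately show ?thesis by simp
    qed (simp add: ef_def)
  qed
  then have "\<tau> l * (\<tau> l * cc (\<delta> + eps l) u (prm l) v) = \<tau> l * ef \<delta> u v" by simp
  then show ?thesis by (simp add: \<tau>_sq flip: mult.assoc)
qed

lemma ef_outside: "\<delta> \<in> insert 0 Dp \<Longrightarrow> u \<in> B0 \<Longrightarrow> v \<notin> B \<Longrightarrow> ef \<delta> u v = 0"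
  using cc_outside[OF idx_Dl(2)] one_Y0 by (simp add: ef_def)

lemma pb_eps:
  assumes "idx \<beta> w" "u \<in> B0" "i \<in> Y0" "\<beta> (prm i) \<noteq> 0" "\<And>k. k \<in> u \<inter> w \<Longrightarrow> u \<inter> w - {k} \<noteq> {}"
  shows "pb (xmon (eps i) u) (xmon \<beta> w) = (if u \<inter> w = {}
    then oscale (\<tau> i * reord_sign u w) (xmon (\<beta>(prm i := \<beta> (prm i) - 1)) (u \<union> w)) else (0 :: 'a sup))"
proof -
  let ?\<gamma> = "\<beta>(prm i := \<beta> (prm i) - 1)"
  have \<gamma>: "?\<gamma> \<in> A" by (rule A_upd_dec[OF idxD(1)[OF assms(1)]])
  have pi: "prm i \<in> Y0" using assms(3) prm_simps by auto
  have d: "der (prm i) (xmon \<beta> w) = (xmon ?\<gamma> w :: 'a sup)"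
    using der_xmon0[OF idxD(1,3)[OF assms(1)] pi, where 'a = 'a] assms(4) by simp
  have "0 + ?\<gamma> = ?\<gamma>" by simp
  then have "xmon_mult 0 u ?\<gamma> w = (if u \<inter> w = {} then oscale (reord_sign u w) (xmon ?\<gamma> (u \<union> w)) else (0 :: 'a sup))"
    using xmon_mult_eq[of 0 ?\<gamma> ?\<gamma> u w, where 'a = 'a] \<gamma> by (simp add: xmon_mult_def)
  then have "xmon 0 u \<star> xmon ?\<gamma> w = (if u \<inter> w = {} then oscale (reord_sign u w) (xmon ?\<gamma> (u \<union> w)) else (0 :: 'a sup))"
    using omult_xmon_xmon[OF zero_in_A(1) B0_B[OF assms(2)] \<gamma> idxD(3)[OF assms(1)], where 'a = 'a] by simp
  moreover have "pb (xmon (ee i 1) u) (xmon \<beta> w) =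
      oscale (\<tau> i) (xmon (ee i (1 - 1)) u \<star> der (prm i) (xmon \<beta> w :: 'a sup))"
    by (rule pb_ee) (use assms idx_eps[OF assms(3,2)] in \<open>auto simp: eps_eq_ee dest: idxD\<close>)
  ultimately show ?thesis unfolding d by (simp add: eps_eq_ee)
qed

lemma bk_eps:
  assumes "idx \<beta> w" "u \<in> B0" "i \<in> Y0" "\<And>k v. k \<in> Y1 \<Longrightarrow> cc \<beta> w k v = 0" "\<beta> (prm i) \<noteq> 0"
  shows "bk (eps i) u (ps \<beta> w) j v = \<tau> i * ml u (cc (\<beta>(prm i := \<beta> (prm i) - 1)) w j) v
    - (if j \<in> u then reord_sign {j} (u - {j}) * ml (u - {j}) (cc \<beta> w i) v else 0)"
proof -
  have "bk (eps i) u (ps \<beta> w) j v = \<tau> i * ml u (\<lambda>v. ps \<beta> w j (eps (prm i), v)) v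
    - (if j \<in> u then reord_sign {j} (u - {j}) * ml (u - {j}) (cst (ps \<beta> w i)) v else 0)"
    by (rule bk_one) (use assms idx_eps[OF assms(3,2)] ps_W_even[OF assms(1)] in \<open>auto simp: cc_def dest: idxD\<close>)
  moreover have "(\<lambda>v. ps \<beta> w j (eps (prm i), v)) = cc (\<beta>(prm i := \<beta> (prm i) - 1)) w j"
    using ps_coeff_eps[OF assms(1), of j "prm i"] assms(5) by (simp add: fun_eq_iff)
  moreover have "cst (ps \<beta> w i) = cc \<beta> w i" by (simp add: fun_eq_iff cc_def)
  ultimately show ?thesis by simp
qed

lemma bk_zero_ps:
  assumes "idx \<beta> w" "u \<in> B0"
  shows "bk 0 u (ps \<beta> w) j v = (\<Sum>k\<in>u. reord_sign {k} (u - {k}) * ml (u - {k}) (dl k (cc \<beta> w j)) v)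
    - (if j \<in> u then \<Sum>k\<in>u - {j}. reord_sign {j} (u - {j}) * reord_sign {k} (u - {j} - {k}) *
         ml (u - {j} - {k}) (cc \<beta> w k) v else 0)"
proof -
  have uY: "k \<in> u \<Longrightarrow> k \<in> Y1" for k using B0_B[OF assms(2)] by (auto simp: B_def)
  note O = W_even_O_set[OF ps_W_even[OF assms(1)]]
  have "cst (der k (ps \<beta> w j)) = dl k (cc \<beta> w j)" if "k \<in> u" for k
    using der_apply1[OF uY[OF that] O] by (simp add: fun_eq_iff dl_def cc_def)
  moreover have "cst (ps \<beta> w k) = cc \<beta> w k" for k by (simp add: fun_eq_iff cc_def)
  ultimately show ?thesis using bk_zero[OF assms(2) ps_W_even[OF assms(1)], of j v] by simp
qed

lemma bk_pair:
  assumes "idx \<beta> w" "k \<in> Y1" "l \<in> Y1" "k \<noteq> l" "v \<in> B"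
  shows "bk 0 {k, l} (ps \<beta> w) j v = rot k l (cc \<beta> w j) v
    - (if j = k then reord_sign {k} {l} * cc \<beta> w l v else if j = l then reord_sign {l} {k} * cc \<beta> w k v else 0)"
proof -
  have s: "{k, l} - {k} = {l}" "{k, l} - {l} = {k}" "{l} - {k} = {l}" "{k} - {l} = {k}" using assms(4) by auto
  have 1: "(\<Sum>i\<in>{k, l}. reord_sign {i} ({k, l} - {i}) * ml ({k, l} - {i}) (dl i (cc \<beta> w j)) v) = rot k l (cc \<beta> w j) v"
    using assms(4) by (simp add: rot_def s)
  have 2: "(if j \<in> {k, l} then \<Sum>i\<in>{k, l} - {j}. reord_sign {j} ({k, l} - {j}) * reord_sign {i} ({k, l} - {j} - {i}) *
         ml ({k, l} - {j} - {i}) (cc \<beta> w i) v else 0) =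
    (if j = k then reord_sign {k} {l} * cc \<beta> w l v else if j = l then reord_sign {l} {k} * cc \<beta> w k v else 0)"
    using assms(4,5) by (auto simp: s ml_empty)
  show ?thesis unfolding bk_zero_ps[OF assms(1) pair_B0[OF assms(2-4)]] 1 2 ..
qed

text \<open>x^u has no even variables, so it Poisson commutes with every monomial whose exterior
  part is disjoint from \<open>u\<close>.\<close>

lemma bracket_x_u:
  assumes "idx \<beta> w" "u \<in> B0" "u \<inter> w = {}"
  shows "bk 0 u (ps \<beta> w) j v = bk \<beta> w (ps 0 u) j v"
proof -
  have "pb (xmon 0 u) (xmon \<beta> w) = (\<Sum>i\<in>Y0. oscale (\<tau> i) (der i (xmon 0 u) \<star> der (prm i) (xmon \<beta> w :: 'a sup)))"
    by (rule pb_xmon_Y0) (use assms idxD[OF assms(1)] B0_B in auto)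
  also have "\<dots> = 0"
    by (rule sum.neutral) (use B0_B[OF assms(2)] in \<open>simp add: der_xmon0\<close>)
  finally show ?thesis using cc_pb[OF idx_zero[OF assms(2)] assms(1), of j v] by simp
qed

subsection \<open>The operators \<open>\<partial>\<^sub>r\<^bsup>p^s\<^esup>\<close> with \<open>s > 0\<close>\<close>

text \<open>An exponent from \<open>Dp\<close> has degree at least p > 3, so these elements act on
  any value without leaving a constant part.\<close>

lemma bk_Dp:
  assumes "\<delta> \<in> Dp" "u \<in> B0" "idx \<alpha> w"
  shows "bk \<delta> u (ps \<alpha> w) j v = 0" "l \<in> Y0 \<Longrightarrow> bk (\<delta> + eps l) u (ps \<alpha> w) j v = 0"
    "l \<in> Y0 \<Longrightarrow> q \<in> Y0 \<Longrightarrow> l \<noteq> q \<Longrightarrow> bk (\<delta> + eps l + eps q) u (ps \<alpha> w) j v = 0"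
proof -
  have \<delta>: "\<delta> \<in> insert 0 Dp" using assms(1) by simp
  note ii = idx_Dl[OF \<delta> assms(2)]
  show "bk \<delta> u (ps \<alpha> w) j v = 0"
    by (rule bk_degree_ge3) (use ii(1) assms ps_W_even Dp_sum in \<open>auto dest: idxD\<close>)
  show "bk (\<delta> + eps l) u (ps \<alpha> w) j v = 0" if "l \<in> Y0"
    by (rule bk_degree_ge3) (use ii(2)[OF that] assms ps_W_even Dp_sum[OF assms(1)] in \<open>auto dest: idxD simp: sum.distrib\<close>)
  show "bk (\<delta> + eps l + eps q) u (ps \<alpha> w) j v = 0" if "l \<in> Y0" "q \<in> Y0" "l \<noteq> q"
    by (rule bk_degree_ge3) (use ii(3)[OF that] assms ps_W_even Dp_sum[OF assms(1)] in \<open>auto dest: idxD simp: sum.distrib\<close>)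
qed

text \<open>The bracket of x_1 x^u with x^(\<delta>+\<epsilon>_{1'}+\<epsilon>_2) is
  x^(\<delta>+\<epsilon>_2) x^u up to sign. The second element contributes nothing by degree, and
  the first multiplies constant parts by x^u. The spare \<epsilon>_2 makes e visible in the
  component 2'.\<close>

lemma Dp_ef_mult:
  assumes "\<delta> \<in> Dp" "u \<in> B0"
  shows "ef \<delta> u v = ml u (ef \<delta> {}) v"
proof -
  have \<delta>: "\<delta> \<in> insert 0 Dp" using assms(1) by simp
  let ?i = "prm 1"
  have pi: "?i \<in> Y0" "prm ?i = 1" "?i \<noteq> 1" "?i \<noteq> 2" using one_Y0 prm_simps by (auto simp: Y_def)
  let ?\<beta> = "\<delta> + eps ?i + eps 2"
  have \<beta>: "idx ?\<beta> {}" by (rule idx_Dl(3)[OF \<delta> B0_empty pi(1) one_Y0(2) pi(4)])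
  have c0: "cc ?\<beta> {} k v = 0" for k v by (rule cc_Dl(3)[OF \<delta> B0_empty pi(1) one_Y0(2) pi(4)])
  have e: "?\<beta>(?i := ?\<beta> ?i - 1) = \<delta> + eps 2" using pi(4) by (auto simp: fun_eq_iff)
  have nz: "?\<beta> (prm 1) \<noteq> 0" by simp
  have 1: "pb (xmon (eps 1) u) (xmon ?\<beta> {}) = (oscale (\<tau> 1) (xmon (\<delta> + eps 2) u) :: 'a sup)"
  proof -
    have "pb (xmon (eps 1) u) (xmon ?\<beta> {}) = (if u \<inter> {} = {}
      then oscale (\<tau> 1 * reord_sign u {}) (xmon (?\<beta>(?i := ?\<beta> ?i - 1)) (u \<union> {})) else (0 :: 'a sup))"
      by (rule pb_eps[OF \<beta> assms(2) one_Y0(1) nz]) simp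
    then show ?thesis unfolding e by simp
  qed
  have "\<tau> 1 * cc (\<delta> + eps 2) u (prm 2) v = bk (eps 1) u (ps ?\<beta> {}) (prm 2) v"
    using cc_pb[OF idx_eps[OF one_Y0(1) assms(2)] \<beta>, of "prm 2" v, unfolded 1]
      \<phi>_scaled[OF idx_Dl(2)[OF \<delta> assms(2) one_Y0(2)], of "\<tau> 1" "prm 2" v]
      bk_Dp(3)[OF assms(1) B0_empty idx_eps[OF one_Y0(1) assms(2)] pi(1) one_Y0(2) pi(4)] by simp
  also have "\<dots> = \<tau> 1 * ml u (cc (\<delta> + eps 2) {} (prm 2)) v"
  proof -
    have "bk (eps 1) u (ps ?\<beta> {}) (prm 2) v = \<tau> 1 * ml u (cc (?\<beta>(?i := ?\<beta> ?i - 1)) {} (prm 2)) v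
      - (if prm 2 \<in> u then reord_sign {prm 2} (u - {prm 2}) * ml (u - {prm 2}) (cc ?\<beta> {} 1) v else 0)"
      by (rule bk_eps[OF \<beta> assms(2) one_Y0(1) _ nz]) (rule c0)
    moreover have "ml w (cc ?\<beta> {} 1) v = 0" for w unfolding ml_def c0 by simp
    ultimately show ?thesis unfolding e by simp
  qed
  finally have "cc (\<delta> + eps 2) u (prm 2) v = ml u (cc (\<delta> + eps 2) {} (prm 2)) v" by simp
  moreover have "cc (\<delta> + eps 2) {} (prm 2) = (\<lambda>v. \<tau> 2 * ef \<delta> {} v)"
    using cc_ef[OF \<delta> B0_empty one_Y0(2)] by (rule ext)
  ultimately have "\<tau> 2 * ef \<delta> u v = \<tau> 2 * ml u (ef \<delta> {}) v"
    unfolding cc_ef[OF \<delta> assms(2) one_Y0(2)] by (simp only: ml_scale)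
  then show ?thesis by simp
qed

text \<open>As for \<open>Dp_ef_mult\<close>, without the spare variable. The second summand appears
  because the value at \<delta>+\<epsilon>_{1'} has a component \<partial>_1, which differentiates
  the x_1 in the odd components of \<open>D\<^sub>H\<close> of x_1 x^u.\<close>

lemma Dp_cc_mult:
  assumes "\<delta> \<in> Dp" "u \<in> B0"
  shows "cc \<delta> u j v = ml u (cc \<delta> {} j) v
    + (if j \<in> u then reord_sign {j} (u - {j}) * ml (u - {j}) (ef \<delta> {}) v else 0)"
proof -
  have \<delta>: "\<delta> \<in> insert 0 Dp" using assms(1) by simp
  let ?i = "prm 1"
  have pi: "?i \<in> Y0" "prm ?i = 1" using one_Y0 prm_simps by (auto simp: Y_def)
  let ?\<beta> = "\<delta> + eps ?i"
  have \<beta>: "idx ?\<beta> {}" by (rule idx_Dl(2)[OF \<delta> B0_empty pi(1)])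
  have c0: "cc ?\<beta> {} k v = 0" if "k \<in> Y1" for k v
    using cc_Dl(2)[OF \<delta> B0_empty pi(1), of k v] that one_Y0(1) Y_disjoint(2)[OF that] unfolding pi(2) by metis
  have e: "?\<beta>(?i := ?\<beta> ?i - 1) = \<delta>" by (auto simp: fun_eq_iff)
  have nz: "?\<beta> (prm 1) \<noteq> 0" by simp
  have 1: "pb (xmon (eps 1) u) (xmon ?\<beta> {}) = (oscale (\<tau> 1) (xmon \<delta> u) :: 'a sup)"
  proof -
    have "pb (xmon (eps 1) u) (xmon ?\<beta> {}) = (if u \<inter> {} = {}
      then oscale (\<tau> 1 * reord_sign u {}) (xmon (?\<beta>(?i := ?\<beta> ?i - 1)) (u \<union> {})) else (0 :: 'a sup))"
      by (rule pb_eps[OF \<beta> assms(2) one_Y0(1) nz]) simp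
    then show ?thesis unfolding e by simp
  qed
  have c1: "cc ?\<beta> {} 1 = (\<lambda>v. - \<tau> 1 * ef \<delta> {} v)"
    using cc_ef[OF \<delta> B0_empty pi(1)] \<tau>_simps(2)[OF one_Y0(1), where 'a = 'a] unfolding pi(2) by (simp add: fun_eq_iff)
  have "\<tau> 1 * cc \<delta> u j v = bk (eps 1) u (ps ?\<beta> {}) j v"
    using cc_pb[OF idx_eps[OF one_Y0(1) assms(2)] \<beta>, of j v, unfolded 1]
      \<phi>_scaled[OF idx_Dl(1)[OF \<delta> assms(2)], of "\<tau> 1" j v]
      bk_Dp(2)[OF assms(1) B0_empty idx_eps[OF one_Y0(1) assms(2)] pi(1)] by simp
  also have "\<dots> = \<tau> 1 * (ml u (cc \<delta> {} j) v
    + (if j \<in> u then reord_sign {j} (u - {j}) * ml (u - {j}) (ef \<delta> {}) v else 0))"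
  proof -
    have "bk (eps 1) u (ps ?\<beta> {}) j v = \<tau> 1 * ml u (cc (?\<beta>(?i := ?\<beta> ?i - 1)) {} j) v
      - (if j \<in> u then reord_sign {j} (u - {j}) * ml (u - {j}) (cc ?\<beta> {} 1) v else 0)"
      by (rule bk_eps[OF \<beta> assms(2) one_Y0(1) _ nz]) (rule c0)
    then show ?thesis unfolding e c1 ml_scale by (cases "j \<in> u") (simp_all add: algebra_simps)
  qed
  finally show ?thesis by simp
qed

lemma Y1_other: "j \<in> Y1 \<Longrightarrow> \<exists>l\<in>Y1. l \<noteq> j \<and> l \<noteq> k"
proof -
  have "card {j, k} < card Y1" using n3 card_insert_le_m1[of 2 "{k}" j] by (simp add: Y1_def)
  then have "\<not> Y1 \<subseteq> {j, k}" using card_mono[of "{j, k}" Y1] by auto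
  then show ?thesis by blast
qed

text \<open>The rotations x_k x_l Poisson commute with x^(\<delta>+\<epsilon>_1), so e is rotation
  invariant, and \<open>rot_zeroD\<close> leaves only 1 and x^\<omega>.\<close>

lemma Dp_ef_empty:
  assumes "\<delta> \<in> Dp" "v \<noteq> {}" "v \<noteq> \<omega>"
  shows "ef \<delta> {} v = 0"
proof (cases "v \<in> B")
  case True
  have \<delta>: "\<delta> \<in> insert 0 Dp" using assms(1) by simp
  obtain k l where kl: "k \<in> v" "l \<in> Y1" "l \<notin> v" "k \<in> Y1"
    using True assms(2,3) by (auto simp: B_def \<omega>_def)
  then have ne: "k \<noteq> l" by auto
  note kl0 = pair_B0[OF kl(4,2) ne]
  let ?j = "prm 1"
  have j: "?j \<noteq> k" "?j \<noteq> l" using prm_simps(1)[OF one_Y0(1)] kl Y_disjoint by auto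
  note \<beta> = idx_Dl(2)[OF \<delta> B0_empty one_Y0(1)]
  have cc: "cc (\<delta> + eps 1) {} ?j = (\<lambda>v. \<tau> 1 * ef \<delta> {} v)"
    using cc_ef[OF \<delta> B0_empty one_Y0(1)] by (rule ext)
  have "rot k l (ef \<delta> {}) x = 0" if x: "x \<in> B" for x
  proof -
    have "bk 0 {k, l} (ps (\<delta> + eps 1) {}) ?j x = 0"
      unfolding bracket_x_u[OF \<beta> kl0 Int_empty_right] by (rule bk_Dp(2)[OF assms(1) B0_empty idx_zero[OF kl0] one_Y0(1)])
    then have "rot k l (cc (\<delta> + eps 1) {} ?j) x = 0"
      using bk_pair[OF \<beta> kl(4,2) ne x, of ?j] j by simp
    then show ?thesis unfolding cc rot_scale by simp
  qed
  then show ?thesis using rot_zeroD[OF _ kl(1,3) True kl(2)] by blast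
qed (use ef_outside assms in simp)

lemma Dp_inv:
  assumes "\<delta> \<in> Dp" "u \<in> B0"
  shows "bk 0 u (ps \<delta> {}) j v = 0"
proof -
  have \<delta>: "idx \<delta> {}" using assms(1) idx_Dl(1) by simp
  show ?thesis unfolding bracket_x_u[OF \<delta> assms(2) Int_empty_right]
    by (rule bk_Dp(1)[OF assms(1) B0_empty idx_zero[OF assms(2)]])
qed

lemma Dp_rot:
  assumes "\<delta> \<in> Dp" "k \<in> Y1" "l \<in> Y1" "k \<noteq> l" "v \<in> B"
  shows "j \<noteq> k \<Longrightarrow> j \<noteq> l \<Longrightarrow> rot k l (cc \<delta> {} j) v = 0"
    and "rot k l (cc \<delta> {} l) v = reord_sign {l} {k} * cc \<delta> {} k v"
proof -
  have \<delta>: "idx \<delta> {}" using assms(1) idx_Dl(1) by simp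
  note eq = bk_pair[OF \<delta> assms(2-5)] Dp_inv[OF assms(1) pair_B0[OF assms(2-4)]]
  show "rot k l (cc \<delta> {} j) v = 0" if "j \<noteq> k" "j \<noteq> l"
    using eq(1)[of j] eq(2)[of j v] that by simp
  show "rot k l (cc \<delta> {} l) v = reord_sign {l} {k} * cc \<delta> {} k v"
    using eq(1)[of l] eq(2)[of l v] assms(4) by simp
qed

lemma \<omega>_diff_B [simp]: "\<omega> - u \<in> B"
  by (auto simp: \<omega>_def B_def)

text \<open>Invariance of the component \<open>j\<close> under rotations avoiding \<open>j\<close>
  leaves the monomials 1, x_j, x^\<omega> and x^(\<omega> - {j}). Parity removes 1, and a rotation
  mixing the component \<open>j\<close> with another one removes x^\<omega>.\<close>

lemma Dp_cc_support:
  assumes "\<delta> \<in> Dp" "j \<in> Y1" "cc \<delta> {} j v \<noteq> 0"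
  shows "v = {j} \<or> v = \<omega> - {j}"
proof (rule ccontr)
  assume n: "\<not> (v = {j} \<or> v = \<omega> - {j})"
  have \<delta>: "idx \<delta> {}" using assms(1) idx_Dl(1) by simp
  have v: "v \<in> B" using cc_outside[OF \<delta>] assms(3) by blast
  have "v \<noteq> {}" using cc_parity[OF \<delta> assms(3)] assms(2) by auto
  then have k: "\<exists>k\<in>Y1. k \<in> v \<and> k \<noteq> j" using n v by (auto simp: B_def)
  have "v \<noteq> \<omega>"
  proof
    assume v\<omega>: "v = \<omega>"
    obtain l where l: "l \<in> Y1" "l \<noteq> j" using Y1_other[OF assms(2)] by blast
    have "rot j l (cc \<delta> {} l) v = 0" by (rule rot_same) (use v\<omega> l assms(2) in \<open>auto simp: \<omega>_def\<close>)
    then show False using Dp_rot(2)[OF assms(1,2) l(1) l(2)[symmetric] v] assms(3) by simp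
  qed
  then have "\<exists>l\<in>Y1. l \<notin> v \<and> l \<noteq> j" using n v by (auto simp: B_def \<omega>_def)
  then obtain k l where kl: "k \<in> Y1" "k \<in> v" "k \<noteq> j" "l \<in> Y1" "l \<notin> v" "l \<noteq> j" using k by blast
  then have "cc \<delta> {} j v = 0"
    using rot_zeroD[of k l "cc \<delta> {} j" v] Dp_rot(1)[OF assms(1) kl(1,4)] v by metis
  then show False using assms(3) by simp
qed

text \<open>With \<open>Dp_cc_co_single\<close>, the rotations mixing the components
  \<open>k\<close> and \<open>l\<close> leave one scalar for each of the two monomial types, that
  is, multiples of \<Gamma>' and of \<open>D\<^sub>H\<close> of x^\<omega>.\<close>

lemma Dp_cc_single:
  assumes "\<delta> \<in> Dp" "k \<in> Y1" "l \<in> Y1"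
  shows "cc \<delta> {} k {k} = cc \<delta> {} l {l}"
proof (cases "k = l")
  case False
  have "{k} \<in> B" using assms by (simp add: B_def)
  then show ?thesis
    using Dp_rot(2)[OF assms False, of "{k}"] rot_eval[of l k "{k}" "cc \<delta> {} l"] False
    by (simp add: rot_commute[of k l])
qed simp

lemma Dp_cc_co_single:
  assumes "\<delta> \<in> Dp" "k \<in> Y1" "l \<in> Y1"
  shows "reord_sign {k} (\<omega> - {k}) * cc \<delta> {} k (\<omega> - {k}) = reord_sign {l} (\<omega> - {l}) * cc \<delta> {} l (\<omega> - {l})"
proof (cases "k = l")
  case False
  let ?W = "\<omega> - {k} - {l}"
  have W: "\<omega> - {k} = insert l ?W" "\<omega> - {l} = insert k ?W" "finite ?W"
    using False assms by (auto simp: \<omega>_def)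
  have s: "reord_sign {k} (insert l ?W) = (reord_sign {k} {l} * reord_sign {k} ?W :: 'a)"
    "reord_sign {l} (insert k ?W) = (reord_sign {l} {k} * reord_sign {l} ?W :: 'a)"
    by (rule reord_sign_insert_right; use W(3) in simp)+
  have "rot k l (cc \<delta> {} l) (\<omega> - {k}) =
      reord_sign {k} {l} * reord_sign {k} ?W * reord_sign {l} ?W * cc \<delta> {} l (insert k ?W)"
    by (rule rot_eval) (use False assms in \<open>auto simp: \<omega>_def B_def\<close>)
  then have "reord_sign {l} {k} * cc \<delta> {} k (\<omega> - {k}) =
      reord_sign {k} {l} * reord_sign {k} ?W * reord_sign {l} ?W * cc \<delta> {} l (\<omega> - {l})"
    using Dp_rot(2)[OF assms False \<omega>_diff_B[of "{k}"]] W(2) by simp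
  then have "reord_sign {l} {k} * (reord_sign {l} {k} * cc \<delta> {} k (\<omega> - {k})) =
      reord_sign {l} {k} * (reord_sign {k} {l} * reord_sign {k} ?W * reord_sign {l} ?W * cc \<delta> {} l (\<omega> - {l}))"
    by simp
  then have "cc \<delta> {} k (\<omega> - {k}) =
      reord_sign {l} {k} * (reord_sign {k} {l} * reord_sign {k} ?W * reord_sign {l} ?W * cc \<delta> {} l (\<omega> - {l}))"
    unfolding reord_sign_sq' .
  then have "reord_sign {k} (\<omega> - {k}) * cc \<delta> {} k (\<omega> - {k}) =
      (reord_sign {k} {l} * reord_sign {k} {l}) * (reord_sign {k} ?W * reord_sign {k} ?W) *
      (reord_sign {l} {k} * reord_sign {l} ?W * cc \<delta> {} l (\<omega> - {l}))"
    unfolding s(1)[folded W(1)] by (simp only: mult_ac)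
  then show ?thesis unfolding reord_sign_sq s(2)[folded W(2)] by simp
qed simp

text \<open>This is the step that needs \<open>n > 3\<close>: bracketing with \<open>|u| = 4\<close> removes \<open>\<Gamma>'\<close>.\<close>

lemma Dp_cc_single_0:
  assumes "\<delta> \<in> Dp" "j \<in> Y1"
  shows "cc \<delta> {} j {j} = 0"
proof -
  have \<delta>: "idx \<delta> {}" using assms(1) idx_Dl(1) by simp
  have "4 \<le> card Y1" using n3 by (simp add: Y1_def)
  then have "3 \<le> card (Y1 - {j})" using assms(2) by simp
  then obtain w where w: "w \<subseteq> Y1 - {j}" "card w = 3" "finite w" by (rule obtain_subset_with_card_n)
  let ?u = "insert j w"
  let ?s = "reord_sign {j} w :: 'a" and ?t = "cc \<delta> {} j {j}"
  have jw: "j \<notin> w" "?u - {j} = w" using w by auto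
  have u: "?u \<in> B0" "w \<in> B" using w assms(2) jw by (auto simp: B0_def B_def)
  have fin: "finite ?u" using w by simp
  have "(\<Sum>k\<in>?u. reord_sign {k} (?u - {k}) * ml (?u - {k}) (dl k (cc \<delta> {} j)) w) =
      (\<Sum>k\<in>?u. if k = j then ?s * ?t else 0)"
  proof (rule sum.cong, goal_cases)
    case (2 k)
    have "\<not> ?u - {k} \<subseteq> w" if "k \<noteq> j" using that jw by auto
    then show ?case using u jw by (auto simp: ml_def dl_def)
  qed simp
  then have 1: "(\<Sum>k\<in>?u. reord_sign {k} (?u - {k}) * ml (?u - {k}) (dl k (cc \<delta> {} j)) w) = ?s * ?t"
    using fin by simp
  have "(\<Sum>k\<in>?u - {j}. reord_sign {j} (?u - {j}) * reord_sign {k} (?u - {j} - {k}) *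
         ml (?u - {j} - {k}) (cc \<delta> {} k) w) = (\<Sum>k\<in>w. ?s * ?t)"
    unfolding jw(2)
  proof (rule sum.cong, goal_cases)
    case (2 k)
    have "even (card (w - {k}))" using 2 w by simp
    then have "reord_sign (w - {k}) {k} = (reord_sign {k} (w - {k}) :: 'a)"
      using reord_sign_even[of "w - {k}" "{k}", where 'a = 'a] w by simp
    moreover have "w - (w - {k}) = {k}" using 2 by auto
    moreover have "cc \<delta> {} k {k} = ?t" by (rule Dp_cc_single[OF assms(1)]) (use 2 w assms in auto)
    ultimately have "reord_sign {k} (w - {k}) * ml (w - {k}) (cc \<delta> {} k) w = ?t"
      using u(2) reord_sign_sq'[of "{k}" "w - {k}" ?t] by (simp add: ml_def)
    then show ?case by (simp add: mult.assoc)
  qed simp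
  then have 2: "(\<Sum>k\<in>?u - {j}. reord_sign {j} (?u - {j}) * reord_sign {k} (?u - {j} - {k}) *
         ml (?u - {j} - {k}) (cc \<delta> {} k) w) = 3 * (?s * ?t)" using w(2) by simp
  \<comment> \<open>The derivative of x_j counts once, and each of the three indices of
    \<open>w\<close> counts once with the opposite sign. For |u| = 2 the count would be 1 - 1, which
    gives nothing.\<close>
  have "?s * ?t - 3 * (?s * ?t) = 0"
    using bk_zero_ps[OF \<delta> u(1), of j w] Dp_inv[OF assms(1) u(1), of j w] unfolding 1 2 by simp
  then have "of_nat 2 * (?s * ?t) = 0" by (simp add: algebra_simps)
  moreover have "of_nat 2 \<noteq> (0::'a)" using p3 by (intro of_nat_small) auto
  ultimately show ?thesis by simp
qed

text \<open>The scalar of \<open>D\<^sub>H\<close> of x^\<omega> in g. The sign undoes the one in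
  that element, and 2m + 1 is an arbitrary index by \<open>Dp_cc_co_single\<close>.\<close>

definition lamf :: "(nat \<Rightarrow> nat) \<Rightarrow> 'a"
  where "lamf \<delta> = reord_sign {2 * m + 1} (\<omega> - {2 * m + 1}) * cc \<delta> {} (2 * m + 1) (\<omega> - {2 * m + 1})"

lemma first_Y1: "2 * m + 1 \<in> Y1" "2 * m + 2 \<in> Y1"
  using n3 by (auto simp: Y1_def)

lemma Dp_cc_empty:
  assumes "\<delta> \<in> Dp" "j \<in> Y1"
  shows "cc \<delta> {} j v = (if v = \<omega> - {j} then reord_sign {j} (\<omega> - {j}) * lamf \<delta> else 0)"
proof (cases "v = \<omega> - {j}")
  case True
  have "lamf \<delta> = reord_sign {j} (\<omega> - {j}) * cc \<delta> {} j (\<omega> - {j})"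
    unfolding lamf_def by (rule Dp_cc_co_single[OF assms(1) first_Y1(1) assms(2)])
  then show ?thesis using True by (simp add: reord_sign_sq')
next
  case False
  then show ?thesis using Dp_cc_support[OF assms, of v] Dp_cc_single_0[OF assms] by auto
qed

lemma Dp_e:
  assumes "\<delta> \<in> Dp" "u \<in> B0"
  shows "ef \<delta> u v = (if v = u then ef \<delta> {} {} else 0) + (if u = {} \<and> v = \<omega> then ef \<delta> {} \<omega> else 0)"
proof -
  have uB: "u \<in> B" using assms(2) by (rule B0_B)
  have sub: "u \<subseteq> v" "v - u \<noteq> \<omega>" if "u \<subseteq> v" "v \<in> B" "u \<noteq> {}"
    using that by (auto simp: B_def \<omega>_def)
  show ?thesis
  proof (cases "v \<in> B \<and> u \<subseteq> v")
    case False
    then show ?thesis using uB unfolding Dp_ef_mult[OF assms] by (auto simp: ml_def)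
  next
    case True
    then have eq: "v - u = {} \<longleftrightarrow> v = u" by auto
    consider "v = u" | "v \<noteq> u" "u = {}" "v = \<omega>" | "v \<noteq> u" "v - u \<noteq> \<omega>" "\<not> (u = {} \<and> v = \<omega>)"
      using sub True by (cases "u = {}") auto
    then show ?thesis
    proof cases
      case 1
      then show ?thesis using uB \<omega>_nonempty unfolding Dp_ef_mult[OF assms] by (auto simp: ml_def)
    next
      case 2
      then show ?thesis unfolding Dp_ef_mult[OF assms] by (simp add: ml_def)
    next
      case 3
      then have "ef \<delta> {} (v - u) = 0" using eq by (intro Dp_ef_empty[OF assms(1)]) auto
      then show ?thesis using 3 unfolding Dp_ef_mult[OF assms] by (simp add: ml_def)
    qed
  qed
qed

lemma B0_two: "u \<in> B0 \<Longrightarrow> u \<noteq> {} \<Longrightarrow> card u \<ge> 2"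
  using B_finite[of u] by (cases "card u") (auto simp: B0_def elim: oddE)

text \<open>For nonempty \<open>u\<close> both contributions of \<omega> vanish: |u| is at least 2,
  so \<open>u\<close> meets \<omega> - {j}, and \<open>u - {j}\<close> is nonempty and annihilates
  x^\<omega>.\<close>

lemma Dp_g:
  assumes "\<delta> \<in> Dp" "u \<in> B0" "j \<in> Y1"
  shows "cc \<delta> u j v = (if j \<in> u \<and> v = u - {j} then reord_sign {j} (u - {j}) * ef \<delta> {} {} else 0)
    + (if u = {} \<and> v = \<omega> - {j} then reord_sign {j} (\<omega> - {j}) * lamf \<delta> else 0)"
proof (cases "u = {}")
  case True
  then show ?thesis using Dp_cc_empty[OF assms(1,3), of v] by simp
next
  case False
  have u: "u \<in> B" "finite u" "u \<subseteq> Y1" using B0_B[OF assms(2)] B_finite by (auto simp: B_def)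
  have c: "card u \<ge> 2" by (rule B0_two[OF assms(2) False])
  have "v - u \<noteq> \<omega> - {j}" if "u \<subseteq> v"
  proof
    assume eq: "v - u = \<omega> - {j}"
    have "u \<subseteq> {j}"
    proof
      fix x assume x: "x \<in> u"
      then have "x \<notin> \<omega> - {j}" unfolding eq[symmetric] by simp
      then show "x \<in> {j}" using x u by (auto simp: \<omega>_def)
    qed
    then show False using c card_mono[of "{j}" u] by simp
  qed
  then have 1: "ml u (cc \<delta> {} j) v = 0" by (auto simp: ml_def Dp_cc_empty[OF assms(1,3)])
  have 2: "ml (u - {j}) (ef \<delta> {}) v = (if v = u - {j} then ef \<delta> {} {} else 0)" if j: "j \<in> u"
  proof -
    have ne: "u - {j} \<noteq> {}"
    proof
      assume "u - {j} = {}"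
      then have "u \<subseteq> {j}" by auto
      then show False using c card_mono[of "{j}" u] by simp
    qed
    have uj: "u - {j} \<in> B" using u(1) by (rule B_subset) auto
    have "ef \<delta> {} (v - (u - {j})) = 0" if "u - {j} \<subseteq> v" "v \<noteq> u - {j}"
    proof (rule Dp_ef_empty[OF assms(1)])
      show "v - (u - {j}) \<noteq> {}" using that by auto
      show "v - (u - {j}) \<noteq> \<omega>" using ne u(3) by (auto simp: \<omega>_def)
    qed
    then show ?thesis using uj by (auto simp: ml_def)
  qed
  show ?thesis unfolding Dp_cc_mult[OF assms(1,2)] 1
  proof (cases "j \<in> u")
    case True
    show "0 + (if j \<in> u then reord_sign {j} (u - {j}) * ml (u - {j}) (ef \<delta> {}) v else 0) =
        (if j \<in> u \<and> v = u - {j} then reord_sign {j} (u - {j}) * ef \<delta> {} {} else 0) +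
        (if u = {} \<and> v = \<omega> - {j} then reord_sign {j} (\<omega> - {j}) * lamf \<delta> else 0)"
      unfolding 2[OF True] using False by simp
  qed (use False in simp)
qed

text \<open>For odd n, parity excludes x^\<omega> from the even components and x^(\<omega> - {j})
  from the odd ones.\<close>

lemma Dp_odd:
  assumes "\<delta> \<in> Dp" "odd n"
  shows "ef \<delta> {} \<omega> = 0" "lamf \<delta> = 0"
proof -
  have \<delta>: "\<delta> \<in> insert 0 Dp" using assms(1) by simp
  have c: "card \<omega> = n" "card (\<omega> - {2 * m + 1}) = n - 1" using first_Y1 by (auto simp: \<omega>_def Y1_def)
  show "ef \<delta> {} \<omega> = 0"
    using cc_parity[OF idx_Dl(2)[OF \<delta> B0_empty one_Y0(1)], of "prm 1" \<omega>] assms(2) c prm_simps(1)[OF one_Y0(1)]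
    by (auto simp: ef_def)
  show "lamf \<delta> = 0"
    using cc_parity[OF idx_Dl(1)[OF \<delta> B0_empty], of "2 * m + 1" "\<omega> - {2 * m + 1}"] assms(2) c first_Y1
    by (auto simp: lamf_def)
qed

subsection \<open>The operators of order zero and one\<close>

lemma zero_Dl: "0 \<in> insert 0 Dp" by simp

lemma cc_eps: "u \<in> B0 \<Longrightarrow> l \<in> Y0 \<Longrightarrow> cc (eps l) u (prm l) v = \<tau> l * ef 0 u v"
  using cc_ef[OF zero_Dl, of u l v] by simp

lemma cc_eps_other: "u \<in> B0 \<Longrightarrow> l \<in> Y0 \<Longrightarrow> j \<noteq> prm l \<Longrightarrow> cc (eps l) u j v = 0"
  using cc_Dl(2)[OF zero_Dl, of u l j v] by simp

lemma prod_g: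
  assumes "u \<in> B0" "w \<in> B0" "\<And>k. k \<in> u \<inter> w \<Longrightarrow> u \<inter> w - {k} \<noteq> {}"
  shows "(if u \<inter> w = {} then reord_sign u w * cc 0 (u \<union> w) j v else 0) =
    ml u (cc 0 w j) v + ml w (cc 0 u j) v
    + (if j \<in> u then reord_sign {j} (u - {j}) * ml (u - {j}) (ef 0 w) v else 0)
    + (if j \<in> w then reord_sign {j} (w - {j}) * ml (w - {j}) (ef 0 u) v else 0)"
proof -
  let ?i = "prm 1"
  have pi: "?i \<in> Y0" "prm ?i = 1" using one_Y0 prm_simps by (auto simp: Y_def)
  have e: "(eps ?i)(?i := eps ?i ?i - 1) = 0" "(eps 1)(prm ?i := eps 1 (prm ?i) - 1) = 0"
    unfolding pi(2) by (auto simp: fun_eq_iff)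
  note f = idx_eps[OF one_Y0(1) assms(1)] and g = idx_eps[OF pi(1) assms(2)]
  have nz: "eps ?i (prm 1) \<noteq> 0" "eps 1 (prm ?i) \<noteq> 0" unfolding pi(2) by simp_all
  have c0: "cc (eps ?i) w k v = 0" "cc (eps 1) u k v = 0" if "k \<in> Y1" for k v
    using that one_Y0 pi Y_disjoint cc_eps_other[OF assms(2) pi(1)] cc_eps_other[OF assms(1) one_Y0(1)] by metis+
  have t: "\<tau> ?i = (- \<tau> 1 :: 'a)" by (rule \<tau>_simps(2)[OF one_Y0(1)])
  have c1: "cc (eps ?i) w 1 = (\<lambda>v. - \<tau> 1 * ef 0 w v)" "cc (eps 1) u ?i = (\<lambda>v. \<tau> 1 * ef 0 u v)"
    using cc_eps[OF assms(2) pi(1)] cc_eps[OF assms(1) one_Y0(1)] unfolding pi(2) t by auto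
  have "pb (xmon (eps 1) u) (xmon (eps ?i) w) = (if u \<inter> w = {}
    then oscale (\<tau> 1 * reord_sign u w) (xmon ((eps ?i)(?i := eps ?i ?i - 1)) (u \<union> w)) else (0 :: 'a sup))"
    by (rule pb_eps[OF g assms(1) one_Y0(1) nz(1) assms(3)])
  then have "\<phi> (D\<^sub>H (pb (xmon (eps 1) u) (xmon (eps ?i) w))) j (0, v) =
      (if u \<inter> w = {} then \<tau> 1 * reord_sign u w * cc 0 (u \<union> w) j v else 0)"
    unfolding e using \<phi>_scaled[OF idx_zero[OF B0_Un[OF assms(1,2)]]] by auto
  moreover have "bk (eps 1) u (ps (eps ?i) w) j v = \<tau> 1 * ml u (cc ((eps ?i)(?i := eps ?i ?i - 1)) w j) v
    - (if j \<in> u then reord_sign {j} (u - {j}) * ml (u - {j}) (cc (eps ?i) w 1) v else 0)"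
    by (rule bk_eps[OF g assms(1) one_Y0(1) _ nz(1)]) (rule c0)
  moreover have "bk (eps ?i) w (ps (eps 1) u) j v = \<tau> ?i * ml w (cc ((eps 1)(prm ?i := eps 1 (prm ?i) - 1)) u j) v
    - (if j \<in> w then reord_sign {j} (w - {j}) * ml (w - {j}) (cc (eps 1) u ?i) v else 0)"
    by (rule bk_eps[OF f assms(2) pi(1) _ nz(2)]) (rule c0)
  ultimately have "(if u \<inter> w = {} then \<tau> 1 * reord_sign u w * cc 0 (u \<union> w) j v else 0) =
      \<tau> 1 * ml u (cc 0 w j) v - (if j \<in> u then reord_sign {j} (u - {j}) * (- \<tau> 1 * ml (u - {j}) (ef 0 w) v) else 0)
    - (- \<tau> 1 * ml w (cc 0 u j) v - (if j \<in> w then reord_sign {j} (w - {j}) * (\<tau> 1 * ml (w - {j}) (ef 0 u) v) else 0))"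
    using cc_pb[OF f g, of j v] unfolding e c1 ml_scale t by simp
  then have "\<tau> 1 * (if u \<inter> w = {} then reord_sign u w * cc 0 (u \<union> w) j v else 0) =
    \<tau> 1 * (ml u (cc 0 w j) v + ml w (cc 0 u j) v
    + (if j \<in> u then reord_sign {j} (u - {j}) * ml (u - {j}) (ef 0 w) v else 0)
    + (if j \<in> w then reord_sign {j} (w - {j}) * ml (w - {j}) (ef 0 u) v else 0))"
    by (cases "u \<inter> w = {}"; cases "j \<in> u"; cases "j \<in> w") (simp_all add: algebra_simps)
  then show ?thesis by simp
qed

text \<open>The bracket of x_1 x^u with x_{1'} x_2 x^w; as in \<open>Dp_ef_mult\<close>, the spare
  x_2 makes e visible in the component 2'.\<close>

lemma prod_e:
  assumes "u \<in> B0" "w \<in> B0" "u \<inter> w = {}"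
  shows "reord_sign u w * ef 0 (u \<union> w) v = ml u (ef 0 w) v + ml w (ef 0 u) v"
proof -
  let ?i = "prm 1" and ?j = "prm 2"
  have pi: "?i \<in> Y0" "prm ?i = 1" "?i \<noteq> 2" "?j \<in> Y0" using one_Y0 prm_simps by (auto simp: Y_def)
  have j: "?j \<noteq> ?i" "?j \<noteq> 1" using prm_inj[OF one_Y0(1,2)] pi prm_simps(4)[of 2] one_Y0 by (auto simp: Y_def)
  let ?\<beta> = "eps ?i + eps 2"
  note f = idx_eps[OF one_Y0(1) assms(1)]
  have g: "idx ?\<beta> w" using idx_Dl(3)[OF zero_Dl assms(2) pi(1) one_Y0(2) pi(3)] by simp
  have c0: "cc ?\<beta> w k v = 0" for k v using cc_Dl(3)[OF zero_Dl assms(2) pi(1) one_Y0(2) pi(3)] by simp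
  have e: "?\<beta>(?i := ?\<beta> ?i - 1) = eps 2" using pi by (auto simp: fun_eq_iff)
  have nz: "?\<beta> (prm 1) \<noteq> 0" by simp
  have ju: "?j \<notin> u" using pi(4) B0_B[OF assms(1)] Y_disjoint by (auto simp: B_def)
  have uw: "u \<union> w \<in> B0" by (rule B0_Un[OF assms])
  have "pb (xmon (eps 1) u) (xmon ?\<beta> w) = (if u \<inter> w = {}
    then oscale (\<tau> 1 * reord_sign u w) (xmon (?\<beta>(?i := ?\<beta> ?i - 1)) (u \<union> w)) else (0 :: 'a sup))"
    by (rule pb_eps[OF g assms(1) one_Y0(1) nz]) (use assms(3) in blast)
  then have "\<phi> (D\<^sub>H (pb (xmon (eps 1) u) (xmon ?\<beta> w))) ?j (0, v) = \<tau> 1 * reord_sign u w * cc (eps 2) (u \<union> w) ?j v"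
    unfolding e using \<phi>_scaled[OF idx_eps[OF one_Y0(2) uw]] assms(3) by simp
  moreover have "bk (eps 1) u (ps ?\<beta> w) ?j v = \<tau> 1 * ml u (cc (?\<beta>(?i := ?\<beta> ?i - 1)) w ?j) v
    - (if ?j \<in> u then reord_sign {?j} (u - {?j}) * ml (u - {?j}) (cc ?\<beta> w 1) v else 0)"
    by (rule bk_eps[OF g assms(1) one_Y0(1) _ nz]) (rule c0)
  moreover have "bk ?\<beta> w (ps (eps 1) u) ?j v =
    - (if ?j = prm 2 then \<tau> 2 * ml w (cst (ps (eps 1) u ?i)) v else 0)
    - (if ?i \<noteq> 2 \<and> ?j = prm ?i then \<tau> ?i * ml w (cst (ps (eps 1) u 2)) v else 0)"
    by (rule bk_two[OF idxD(1,2)[OF g] ps_W_even[OF f] pi(1) one_Y0(2)])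
  moreover have "cst (ps (eps 1) u ?i) = (\<lambda>v. \<tau> 1 * ef 0 u v)" "cc (eps 2) w ?j = (\<lambda>v. \<tau> 2 * ef 0 w v)"
    using cc_eps[OF assms(1) one_Y0(1)] cc_eps[OF assms(2) one_Y0(2)] by (auto simp: cc_def)
  ultimately have "\<tau> 1 * reord_sign u w * (\<tau> 2 * ef 0 (u \<union> w) v) =
      \<tau> 1 * (\<tau> 2 * ml u (ef 0 w) v) + \<tau> 2 * (\<tau> 1 * ml w (ef 0 u) v)"
    using cc_pb[OF f g, of ?j v] ju j unfolding e pi(2) cc_eps[OF uw one_Y0(2)] by (simp add: ml_scale)
  then have "(\<tau> 1 * \<tau> 2) * (reord_sign u w * ef 0 (u \<union> w) v) =
      (\<tau> 1 * \<tau> 2) * (ml u (ef 0 w) v + ml w (ef 0 u) v)" by (simp add: algebra_simps)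
  then show ?thesis by (simp only: mult_cancel_left mult_eq_0_iff \<tau>_nonzero simp_thms)
qed

lemma ps_pair: "k \<in> Y1 \<Longrightarrow> l \<in> Y1 \<Longrightarrow> k \<noteq> l \<Longrightarrow> ps 0 {k, l} = 0"
  using ps_vanish[OF idx_zero[OF pair_B0]] by simp

text \<open>\<phi> kills \<open>D\<^sub>H\<close> of x_k x_l, and this element commutes with that of
  x_1 x^w when \<open>w\<close> avoids both indices.\<close>

lemma rot_e0:
  assumes "w \<in> B0" "k \<in> Y1" "l \<in> Y1" "k \<noteq> l" "k \<notin> w" "l \<notin> w" "v \<in> B"
  shows "rot k l (ef 0 w) v = 0"
proof -
  let ?j = "prm 1"
  have j: "?j \<noteq> k" "?j \<noteq> l" using prm_simps(1)[OF one_Y0(1)] assms Y_disjoint by auto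
  note g = idx_eps[OF one_Y0(1) assms(1)]
  have cc: "cc (eps 1) w ?j = (\<lambda>v. \<tau> 1 * ef 0 w v)" using cc_eps[OF assms(1) one_Y0(1)] by (rule ext)
  have "{k, l} \<inter> w = {}" using assms by auto
  from bracket_x_u[OF g pair_B0[OF assms(2-4)] this, of ?j v]
  have "bk 0 {k, l} (ps (eps 1) w) ?j v = 0"
    using bk_zero_right[OF idxD(1,2)[OF g], where 'a = 'a] ps_pair[OF assms(2-4)] by simp
  then have "rot k l (cc (eps 1) w ?j) v = 0" using bk_pair[OF g assms(2-4,7), of ?j] j by simp
  then show ?thesis unfolding cc rot_scale by simp
qed

text \<open>\<phi> commutes with the rotation x_k x_l, which turns x_1 x^w into a multiple of the
  monomial with \<open>k\<close> replaced by \<open>l\<close>. The sign is the one in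
  \<open>rot_eval\<close>.\<close>

lemma rot_e:
  assumes "w \<in> B0" "k \<in> w" "l \<in> Y1" "l \<notin> w" "v \<in> B"
  shows "reord_sign {k} {l} * reord_sign {k} (w - {k}) * reord_sign {l} (w - {k}) * ef 0 (insert l (w - {k})) v
    = rot k l (ef 0 w) v"
proof -
  let ?j = "prm 1" and ?w = "insert l (w - {k})"
  have w: "w \<in> B" "finite w" using B0_B[OF assms(1)] B_finite by auto
  have k: "k \<in> Y1" "k \<noteq> l" using w assms by (auto simp: B_def)
  have j: "?j \<noteq> k" "?j \<noteq> l" using prm_simps(1)[OF one_Y0(1)] assms k Y_disjoint by auto
  note g = idx_eps[OF one_Y0(1) assms(1)] and kl = pair_B0[OF k(1) assms(3) k(2)]
  have "card ?w = card w" using assms(2,4) w card_Suc_Diff1[of w k] by simp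
  then have w': "?w \<in> B0" "w - {k} \<in> B" using assms w by (auto simp: B0_def B_def)
  let ?c = "reord_sign {k} {l} * reord_sign {k} (w - {k}) * reord_sign {l} (w - {k}) :: 'a"
  have s: "{k, l} - {k} = {l}" "0 + eps 1 = eps 1" using k(2) by auto
  have l: "{l} \<in> B" using assms(3) by (simp add: B_def)
  have 0: "oscale (\<tau> i) (der i (xmon 0 {k, l}) \<star> der (prm i) (xmon (eps 1) w)) = (0 :: 'a sup)" if "i \<in> Y0" for i
    using that B0_B[OF kl] by (simp add: der_xmon0)
  have x: "xmon 0 {l} \<star> xmon (eps 1) (w - {k}) = (oscale (reord_sign {l} (w - {k})) (xmon (eps 1) ?w) :: 'a sup)"
    using omult_xmon_xmon[OF zero_in_A(1) l idxD(1)[OF g] w'(2), where 'a = 'a]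
      xmon_mult_eq[OF s(2) idxD(1)[OF g], of "{l}" "w - {k}", where 'a = 'a] assms(4) by simp
  have 1: "oscale (\<tau> i) (der i (xmon 0 {k, l}) \<star> der (prm i) (xmon (eps 1) w)) =
      (if i = k then oscale ?c (xmon (eps 1) ?w) else (0 :: 'a sup))" if i: "i \<in> Y1" for i
  proof (cases "i = k")
    case True
    then show ?thesis using i k assms(2) x B0_B[OF kl] idxD[OF g] w(1) s(1)
      by (simp add: der_xmon1 prm_simps \<tau>_simps omult_scale_left omult_scale_right mult_ac)
  next
    case False
    then show ?thesis using i assms(4) B0_B[OF kl] idxD[OF g] by (auto simp: der_xmon1 prm_simps)
  qed
  have "pb (xmon 0 {k, l}) (xmon (eps 1) w) = (oscale ?c (xmon (eps 1) ?w) :: 'a sup)"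
    unfolding pb_def sum_Y using 0 1 k(1) by simp
  then have "?c * cc (eps 1) ?w ?j v = bk 0 {k, l} (ps (eps 1) w) ?j v"
    using cc_pb[OF idx_zero[OF kl] g, of ?j v] \<phi>_scaled[OF idx_eps[OF one_Y0(1) w'(1)], of ?c ?j v]
      bk_zero_right[OF idxD(1,2)[OF g], where 'a = 'a] ps_pair[OF k(1) assms(3) k(2)] by simp
  also have "\<dots> = rot k l (cc (eps 1) w ?j) v" using bk_pair[OF g k(1) assms(3) k(2) assms(5), of ?j] j by simp
  also have "cc (eps 1) w ?j = (\<lambda>v. \<tau> 1 * ef 0 w v)" using cc_eps[OF assms(1) one_Y0(1)] by (rule ext)
  finally show ?thesis unfolding cc_eps[OF w'(1) one_Y0(1)] rot_scale by (simp add: mult.assoc)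
qed

text \<open>x_a x_b squares to 0 and \<phi> kills \<open>D\<^sub>H\<close> of it, so the component
  \<open>a\<close> of \<open>prod_g\<close> reads 2 x_b e = 0 up to sign; this puts both indices
  into \<open>v\<close>. Rotations away from the pair then leave only the pair and \<omega>.\<close>

lemma e_pair_support:
  assumes "k \<in> Y1" "l \<in> Y1" "k \<noteq> l" "ef 0 {k, l} v \<noteq> 0"
  shows "v = {k, l} \<or> v = \<omega>"
proof -
  note kl = pair_B0[OF assms(1-3)]
  have v: "v \<in> B" using ef_outside[OF zero_Dl kl] assms(4) by blast
  have two: "of_nat 2 \<noteq> (0::'a)" using p3 by (intro of_nat_small) auto
  have in_v: "b \<in> v" if ab: "{a, b} = {k, l}" "a \<noteq> b" for a b
  proof (rule ccontr)
    assume b: "b \<notin> v"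
    have abY: "a \<in> Y1" "b \<in> Y1" using ab assms(1,2) by (auto simp: doubleton_eq_iff)
    note AB = pair_B0[OF abY ab(2)]
    have s: "{a, b} - {a} = {b}" "{a, b} \<inter> {a, b} \<noteq> {}" using ab(2) by auto
    have vb: "insert b v \<in> B" using v abY by (simp add: B_insert)
    have z: "ml {a, b} (cc 0 {a, b} a) x = 0" for x
      using ps_pair[OF abY ab(2)] by (simp add: ml_def cc_def)
    have "{a, b} \<inter> {a, b} - {x} \<noteq> {}" for x using ab(2) by auto
    from prod_g[OF AB AB this, of a "insert b v"]
    have "0 = reord_sign {a} {b} * ml {b} (ef 0 {a, b}) (insert b v)
        + reord_sign {a} {b} * ml {b} (ef 0 {a, b}) (insert b v)"
      by (simp only: z s Int_absorb insert_not_empty if_False insertI1 if_True add_0_left)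
    then have "of_nat 2 * (reord_sign {a} {b} * ml {b} (ef 0 {a, b}) (insert b v)) = 0"
      by (simp only: of_nat_numeral mult_2)
    then have "ml {b} (ef 0 {a, b}) (insert b v) = 0" using two by simp
    moreover have "insert b v - {b} = v" using b by auto
    ultimately show False using vb assms(4) ab(1) by (simp add: ml_def)
  qed
  have sub: "{k, l} \<subseteq> v" using in_v[of k l] in_v[of l k] assms(3) by auto
  have False if rs: "r \<in> v" "r \<notin> {k, l}" "s \<in> Y1" "s \<notin> v" for r s
  proof -
    have r: "r \<in> Y1" "r \<noteq> s" using rs v by (auto simp: B_def)
    have "rot r s (ef 0 {k, l}) x = 0" if "x \<in> B" for x
      by (rule rot_e0[OF kl r(1) rs(3) r(2)]) (use rs sub that in auto)
    from rot_zeroD[OF this rs(1,4) v rs(3)] show False using assms(4) by simp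
  qed
  then show ?thesis using sub v by (auto simp: B_def \<omega>_def)
qed

text \<open>Rotating \<open>k\<close> to \<open>l\<close> carries one pair to the other, and no
  rotation produces x^\<omega>.\<close>

lemma e_pair_move:
  assumes "k \<in> Y1" "q \<in> Y1" "l \<in> Y1" "k \<noteq> q" "q \<noteq> l" "k \<noteq> l"
  shows "ef 0 {q, l} \<omega> = 0" "ef 0 {q, l} {q, l} = ef 0 {k, q} {k, q}"
proof -
  note kq = pair_B0[OF assms(1,2,4)]
  have w: "{k, q} - {k} = {q}" "insert l ({k, q} - {k}) = {q, l}" using assms by auto
  have eq: "reord_sign {k} {l} * reord_sign {k} {q} * reord_sign {l} {q} * ef 0 {q, l} v = rot k l (ef 0 {k, q}) v"
    if "v \<in> B" for v
    using rot_e[OF kq _ assms(3), of k v] that assms unfolding w(2) unfolding w(1) by simp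
  have "rot k l (ef 0 {k, q}) \<omega> = 0" by (rule rot_same) (use assms in \<open>auto simp: \<omega>_def\<close>)
  then show "ef 0 {q, l} \<omega> = 0" using eq[of \<omega>] by simp
  have v: "{q, l} \<in> B" "{q, l} - {l} = {q}" using assms by (auto simp: B_def)
  have "rot k l (ef 0 {k, q}) {q, l} =
      reord_sign {k} {l} * reord_sign {k} {q} * reord_sign {l} {q} * ef 0 {k, q} (insert k {q})"
    using rot_eval[of k l "{q, l}" "ef 0 {k, q}"] v assms by simp
  then show "ef 0 {q, l} {q, l} = ef 0 {k, q} {k, q}" using eq[OF v(1)] by simp
qed

text \<open>The division by 2 normalizes e(u) = \<lambda> |u| x^u at a pair; which pair is taken is
  immaterial by \<open>e_pair\<close>.\<close>

definition lam0 :: 'a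
  where "lam0 = ef 0 {2 * m + 1, 2 * m + 2} {2 * m + 1, 2 * m + 2} / of_nat 2"

lemma e_pair:
  assumes "k \<in> Y1" "l \<in> Y1" "k \<noteq> l"
  shows "ef 0 {k, l} v = (if v = {k, l} then of_nat 2 * lam0 else 0)"
proof -
  define aa where "aa k l = ef 0 {k, l} {k, l}" for k l
  have sym: "aa k l = aa l k" for k l unfolding aa_def by (simp add: insert_commute)
  \<comment> \<open>\<open>aa\<close> is symmetric and agrees on pairs that share an index, hence is
    constant.\<close>
  have mv: "aa q k = aa q l" if "k \<in> Y1" "q \<in> Y1" "l \<in> Y1" "k \<noteq> q" "q \<noteq> l" for q k l
  proof (cases "k = l")
    case False
    then have "aa q l = aa k q" unfolding aa_def using e_pair_move(2) that by blast
    then show ?thesis using sym by simp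
  qed simp
  let ?k = "2 * m + 1" and ?l = "2 * m + 2"
  have "aa k l = aa ?k ?l"
  proof (cases "k = ?k")
    case True
    then show ?thesis using mv[of l ?k ?l] first_Y1 assms by simp
  next
    case k: False
    show ?thesis
    proof (cases "l = ?k")
      case True
      then show ?thesis using mv[of k ?k ?l] sym[of k l] first_Y1 assms by simp
    next
      case False
      have "aa k l = aa l ?k" using mv[of k l ?k] sym[of k l] first_Y1 assms False by simp
      also have "\<dots> = aa ?k ?l" using mv[of l ?k ?l] sym[of l ?k] first_Y1 assms False by simp
      finally show ?thesis .
    qed
  qed
  moreover have "of_nat 2 \<noteq> (0::'a)" using p3 by (intro of_nat_small) auto
  ultimately have 1: "ef 0 {k, l} {k, l} = of_nat 2 * lam0" by (simp add: lam0_def aa_def)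
  obtain q where q: "q \<in> Y1" "q \<noteq> k" "q \<noteq> l" using Y1_other[OF assms(1), of l] by blast
  have 2: "ef 0 {k, l} \<omega> = 0" using e_pair_move(1)[of q k l] q assms by auto
  show ?thesis using e_pair_support[OF assms, of v] 1 2 by auto
qed

text \<open>Splitting off the two smallest indices makes x^u the product of x_k x_l and x^w without
  a sign, for use in the inductions below.\<close>

lemma B0_split:
  assumes "u \<in> B0" "u \<noteq> {}"
  obtains k l w where "k \<in> Y1" "l \<in> Y1" "k < l" "w \<in> B0" "u = {k, l} \<union> w" "{k, l} \<inter> w = {}"
    "\<forall>x\<in>w. l < x" "card u = card w + 2"
proof -
  have fin: "finite u" "u \<subseteq> Y1" "even (card u)" using assms(1) B0_B B_finite by (auto simp: B0_def B_def)
  define k where "k = Min u"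
  have k: "k \<in> u" "\<And>x. x \<in> u \<Longrightarrow> k \<le> x" unfolding k_def using fin assms(2) by auto
  have "u - {k} \<noteq> {}"
  proof
    assume "u - {k} = {}"
    then have "u = {k}" using k(1) by auto
    then show False using fin(3) by simp
  qed
  define l where "l = Min (u - {k})"
  have l: "l \<in> u - {k}" "\<And>x. x \<in> u - {k} \<Longrightarrow> l \<le> x"
    unfolding l_def using fin \<open>u - {k} \<noteq> {}\<close> Min_in[of "u - {k}"] Min_le[of "u - {k}"] by simp_all
  define w where "w = u - {k} - {l}"
  have c: "card u = card w + 2"
    using card_Suc_Diff1[OF fin(1) k(1)] card_Suc_Diff1[OF _ l(1)] fin(1) by (simp add: w_def)
  show ?thesis
  proof
    show "k < l" using k(2)[of l] l(1) by auto
    show "\<forall>x\<in>w. l < x" using l(2) by (fastforce simp: w_def)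
    show "w \<in> B0" using fin c by (auto simp: w_def B0_def B_def)
    show "k \<in> Y1" "l \<in> Y1" using k(1) l(1) fin(2) by auto
    show "u = {k, l} \<union> w" using k(1) l(1) unfolding w_def by blast
    show "{k, l} \<inter> w = {}" unfolding w_def by blast
    show "card u = card w + 2" by (rule c)
  qed
qed

lemma zero_e:
  assumes "u \<in> B0"
  shows "ef 0 u v = (if v = u then of_nat (card u) * lam0 else 0)"
  using assms
proof (induction "card u" arbitrary: u v rule: less_induct)
  case less
  show ?case
  proof (cases "u = {}")
    case True
    have "ps (eps 1) {} = 0" using ps_vanish[OF idx_eps[OF one_Y0(1) B0_empty]] one_Y0(1) by simp
    then show ?thesis using True by (simp add: ef_def cc_def)
  next
    case False
    obtain k l w where kl: "k \<in> Y1" "l \<in> Y1" "k < l" "w \<in> B0" "u = {k, l} \<union> w" "{k, l} \<inter> w = {}"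
      "\<forall>x\<in>w. l < x" "card u = card w + 2" by (rule B0_split[OF less(2) False])
    have ne: "k \<noteq> l" using kl(3) by simp
    note P = pair_B0[OF kl(1,2) ne]
    have IH: "ef 0 w v = (if v = w then of_nat (card w) * lam0 else 0)" for v
      using less(1)[of w v] kl(4,8) by simp
    have B: "w \<in> B" "finite w" "u \<in> B" "even (card {k, l})"
      using B0_B[OF kl(4)] B0_B[OF less(2)] B_finite ne by auto
    have s1: "reord_sign {k, l} w = (1 :: 'a)" by (rule reord_sign_less) (use kl(3,7) in force)
    then have s2: "reord_sign w {k, l} = (1 :: 'a)"
      using reord_sign_even[OF _ B(2) kl(6) B(4), where 'a = 'a] by simp
    have d: "{k, l} \<subseteq> v \<and> v - {k, l} = w \<longleftrightarrow> v = u" "w \<subseteq> v \<and> v - w = {k, l} \<longleftrightarrow> v = u" for v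
      using kl(5,6) by auto
    have "ml {k, l} (ef 0 w) v = (if v = u then of_nat (card w) * lam0 else 0)"
      unfolding ml_def IH using d(1)[of v] s1 B by auto
    moreover have "ml w (ef 0 {k, l}) v = (if v = u then of_nat 2 * lam0 else 0)"
      unfolding ml_def e_pair[OF kl(1,2) ne] using d(2)[of v] s2 B by auto
    ultimately show ?thesis
      using prod_e[OF P kl(4,6), of v] s1 kl(8) unfolding kl(5)[symmetric] by (simp add: algebra_simps)
  qed
qed

text \<open>Each induction step splits off a pair, on which g is zero because \<phi> kills quadratic
  elements, so the new terms come from e. The factor |u| - 2 is that of \<open>ad_\<Gamma>'\<close>
  on the odd components.\<close>

lemma zero_g:
  assumes "u \<in> B0"
  shows "cc 0 u j v =
    (if j \<in> u \<and> v = u - {j} then (of_nat (card u) - 2) * lam0 * reord_sign {j} (u - {j}) else 0)"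
  using assms
proof (induction "card u" arbitrary: u v rule: less_induct)
  case less
  show ?case
  proof (cases "u = {}")
    case True
    then show ?thesis by (simp add: cc_def ps_one)
  next
    case False
    obtain k l w where kl: "k \<in> Y1" "l \<in> Y1" "k < l" "w \<in> B0" "u = {k, l} \<union> w" "{k, l} \<inter> w = {}"
      "\<forall>x\<in>w. l < x" "card u = card w + 2" by (rule B0_split[OF less(2) False])
    have ne: "k \<noteq> l" using kl(3) by simp
    note P = pair_B0[OF kl(1,2) ne]
    have IH: "cc 0 w j v = (if j \<in> w \<and> v = w - {j} then (of_nat (card w) - 2) * lam0 * reord_sign {j} (w - {j}) else 0)" for v
      using less(1)[of w v] kl(4,8) by simp
    have B: "w \<in> B" "finite w" "u \<in> B" "even (card {k, l})"
      using B0_B[OF kl(4)] B0_B[OF less(2)] B_finite ne by auto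
    have uj: "u - {x} \<in> B" for x using B(3) by (rule B_subset) auto
    have s1: "reord_sign {k, l} w = (1 :: 'a)" by (rule reord_sign_less) (use kl(3,7) in force)
    have c0: "cc 0 {k, l} j = (\<lambda>v. 0)" using ps_pair[OF kl(1,2) ne] by (auto simp: cc_def)
    have g: "cc 0 u j v = ml {k, l} (cc 0 w j) v
      + (if j \<in> {k, l} then reord_sign {j} ({k, l} - {j}) * ml ({k, l} - {j}) (ef 0 w) v else 0)
      + (if j \<in> w then reord_sign {j} (w - {j}) * ml (w - {j}) (ef 0 {k, l}) v else 0)"
      using prod_g[OF P kl(4), of j v] kl(6) s1 unfolding kl(5)[symmetric] c0 by simp
    have klx: "l \<notin> w" "k \<notin> w" using kl(6) by auto
    consider "j = k" | "j = l" | "j \<in> w" "j \<noteq> k" "j \<noteq> l" | "j \<notin> u" using kl(5) by auto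
    then show ?thesis
    proof cases
      case 1
      have e: "{k, l} - {k} = {l}" "u - {k} = insert l w" using ne kl(5) klx by auto
      have s: "reord_sign {k} {l} = (1 :: 'a)" "reord_sign {l} w = (1 :: 'a)" "reord_sign {k} (insert l w) = (1 :: 'a)"
        by (rule reord_sign_less; use kl(3,7) in force)+
      have "{l} \<subseteq> v \<and> v - {l} = w \<longleftrightarrow> v = insert l w" using klx by auto
      then have "ml {l} (ef 0 w) v = (if v = insert l w then of_nat (card w) * lam0 else 0)"
        unfolding ml_def zero_e[OF kl(4)] using s uj[of k] e(2) by auto
      moreover have "ml {k, l} (cc 0 w j) v = 0" unfolding ml_def IH using 1 klx by simp
      ultimately show ?thesis unfolding g using 1 klx kl(5,8) s e by simp
    next
      case 2
      have e: "{k, l} - {l} = {k}" "u - {l} = insert k w" using ne kl(5) klx by auto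
      have s: "reord_sign {k} {l} = (1 :: 'a)" "reord_sign {k} w = (1 :: 'a)" "reord_sign {l} w = (1 :: 'a)"
        by (rule reord_sign_less; use kl(3,7) in force)+
      \<comment> \<open>Removing the second index passes the smaller \<open>k\<close>; the same -1
        enters the claim through \<open>s3\<close>.\<close>
      then have s': "reord_sign {l} {k} = (-1 :: 'a)" using reord_sign_swap[OF ne, where 'a = 'a] by simp
      have s3: "reord_sign {l} (insert k w) = (-1 :: 'a)"
        using reord_sign_insert_right[of "{l}" w k, where 'a = 'a] B(2) klx s s' by simp
      have "{k} \<subseteq> v \<and> v - {k} = w \<longleftrightarrow> v = insert k w" using klx by auto
      then have "ml {k} (ef 0 w) v = (if v = insert k w then of_nat (card w) * lam0 else 0)"
        unfolding ml_def zero_e[OF kl(4)] using s uj[of l] e(2) by auto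
      moreover have "ml {k, l} (cc 0 w j) v = 0" unfolding ml_def IH using 2 klx by simp
      ultimately show ?thesis unfolding g using 2 klx kl(5,8) s' s3 e by simp
    next
      case 3
      let ?w = "w - {j}"
      have e: "u - {j} = {k, l} \<union> ?w" "{k, l} \<inter> ?w = {}" using 3 kl(5,6) by auto
      have t1: "reord_sign {k, l} ?w = (1 :: 'a)" by (rule reord_sign_less) (use kl(3,7) in force)
      then have t2: "reord_sign ?w {k, l} = (1 :: 'a)"
        using reord_sign_even[OF _ _ e(2) B(4), where 'a = 'a] B(2) by simp
      have "reord_sign {k, l} {j} = (1 :: 'a)" by (rule reord_sign_less) (use kl(3,7) 3 in force)
      moreover have "reord_sign {j} {k, l} = (reord_sign {k, l} {j} :: 'a)"
        by (rule reord_sign_even) (use 3 B(4) in auto)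
      ultimately have t3: "reord_sign {j} ({k, l} \<union> ?w) = (reord_sign {j} ?w :: 'a)"
        using reord_sign_union_right[of "{j}" "{k, l}" ?w, where 'a = 'a] B(2) e(2) by simp
      have d: "{k, l} \<subseteq> v \<and> v - {k, l} = ?w \<longleftrightarrow> v = u - {j}" "?w \<subseteq> v \<and> v - ?w = {k, l} \<longleftrightarrow> v = u - {j}"
        using e by auto
      have "ml {k, l} (cc 0 w j) v = (if v = u - {j} then (of_nat (card w) - 2) * lam0 * reord_sign {j} ?w else 0)"
        unfolding ml_def IH using d(1) t1 uj[of j] 3 by auto
      moreover have "ml ?w (ef 0 {k, l}) v = (if v = u - {j} then of_nat 2 * lam0 else 0)"
        unfolding ml_def e_pair[OF kl(1,2) ne] using d(2) t2 uj[of j] by auto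
      ultimately show ?thesis unfolding g e(1)[symmetric] t3[folded e(1)]
        using 3 kl(5,8) t3[folded e(1)] by (simp add: algebra_simps)
    next
      case 4
      then have "j \<noteq> k" "j \<noteq> l" "j \<notin> w" using kl(5) by auto
      then have "ml {k, l} (cc 0 w j) v = 0" unfolding ml_def IH by simp
      then show ?thesis unfolding g using 4 \<open>j \<noteq> k\<close> \<open>j \<noteq> l\<close> \<open>j \<notin> w\<close> by simp
    qed
  qed
qed

end

subsection \<open>Comparison with the explicit derivations\<close>

context ham
begin

lemma ad_pd_pow:
  fixes f :: "'a::field sup"
  assumes "f \<in> O_par 0" "i \<in> Y0"
  shows "(der i ^^ k) f \<in> O_par 0 \<and> (ad (pd i) ^^ k) (D\<^sub>H f) = D\<^sub>H ((der i ^^ k) f)"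
proof (induction k)
  case (Suc k)
  then show ?case using D\<^sub>H_der[of "(der i ^^ k) f" i] assms(2) by (simp add: ad_def)
qed (use assms in simp)

lemma der_pow_add: "(der i ^^ k) (f + g) = (der i ^^ k) f + (der i ^^ k) g"
proof (induction k)
  case (Suc k)
  have IH: "(der i ^^ k) (f + g) = (der i ^^ k) f + (der i ^^ k) g" by (rule Suc)
  have "(der i ^^ Suc k) (f + g) = (der i ^^ Suc k) f + (der i ^^ Suc k) g"
    unfolding funpow.simps o_apply IH by (rule der_add)
  then show ?case .
qed simp

lemma der_pow_oscale: "(der i ^^ k) (oscale c f) = oscale c ((der i ^^ k) f)"
proof (induction k)
  case (Suc k)
  have IH: "(der i ^^ k) (oscale c f) = oscale c ((der i ^^ k) f)" by (rule Suc)
  have "(der i ^^ Suc k) (oscale c f) = oscale c ((der i ^^ Suc k) f)"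
    unfolding funpow.simps o_apply IH by (rule der_oscale)
  then show ?case .
qed simp

lemma der_pow_xmon:
  assumes "\<alpha> \<in> A" "u \<in> B" "i \<in> Y0"
  shows "(der i ^^ k) (xmon \<alpha> u) = (if k \<le> \<alpha> i then xmon (\<alpha>(i := \<alpha> i - k)) u else (0 :: 'a::field sup))"
proof (induction k)
  case (Suc k)
  have A: "\<alpha>(i := \<alpha> i - k) \<in> A" using assms(1) by (rule A_down) (auto simp: le_fun_def)
  have e: "(\<alpha>(i := \<alpha> i - k))(i := (\<alpha>(i := \<alpha> i - k)) i - 1) = \<alpha>(i := \<alpha> i - Suc k)" by (simp add: fun_eq_iff)
  have IH: "(der i ^^ k) (xmon \<alpha> u) = (if k \<le> \<alpha> i then xmon (\<alpha>(i := \<alpha> i - k)) u else (0 :: 'a sup))"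
    by (rule Suc)
  have d: "der i (xmon (\<alpha>(i := \<alpha> i - k)) u) =
      (if (\<alpha>(i := \<alpha> i - k)) i = 0 then 0 else xmon (\<alpha>(i := \<alpha> i - Suc k)) u :: 'a sup)"
    unfolding e[symmetric] by (rule der_xmon0[OF A assms(2,3)])
  have "(der i ^^ Suc k) (xmon \<alpha> u) = (if Suc k \<le> \<alpha> i then xmon (\<alpha>(i := \<alpha> i - Suc k)) u else (0 :: 'a sup))"
    unfolding funpow.simps o_apply IH using d by (cases "k \<le> \<alpha> i") auto
  then show ?case .
qed simp

lemma bracket_linear:
  assumes "D \<in> W_even" "E \<in> W_even" "F \<in> W_even"
  shows "bracket D (wscale c E + F) = wscale c (bracket D E) + bracket D F"
proof
  fix j
  have W: "wscale c E + F \<in> W_even"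
    using assms(2,3) by (intro W_evenI) (auto simp: W_even_O_par W_even_outside O_par_add O_par_oscale)
  show "bracket D (wscale c E + F) j = (wscale c (bracket D E) + bracket D F) j"
    unfolding plus_fun_apply[of "wscale c (bracket D E)"] wscale_apply
      bracket_even[OF assms(1) W] bracket_even[OF assms(1,2)] bracket_even[OF assms(1,3)]
    by (simp add: der_add der_oscale omult_add_left omult_add_right omult_scale_left omult_scale_right
        ovec.scale_sum_right ovec.scale_right_diff_distrib sum.distrib sum_subtractf)
qed

lemma \<Gamma>'_apply: "\<Gamma>' j = (if j \<in> Y1 then xmon 0 {j} else 0)"
proof -
  have "\<Gamma>' j = (\<Sum>r\<in>Y1. vf (xmon (\<lambda>_. 0) {r}) r j)"
    unfolding \<Gamma>'_def by (rule sum_fun_apply)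
  also have "\<dots> = (\<Sum>r\<in>Y1. if j = r then xmon 0 {j} else 0)"
    by (rule sum.cong) (auto simp: vf_def zero_fun_def)
  finally show ?thesis by simp
qed

lemma \<Gamma>'_W_even: "\<Gamma>' \<in> W_even"
  by (rule W_evenI) (auto simp: \<Gamma>'_apply Y_cases B_def intro!: O_par_xmon)

text \<open>Euler's identity in the odd variables: every index of \<open>w\<close> contributes once,
  its two signs cancelling.\<close>

lemma euler_odd:
  assumes "\<alpha> \<in> A" "w \<in> B"
  shows "(\<Sum>i\<in>Y1. xmon 0 {i} \<star> der i (xmon \<alpha> w)) = (oscale (of_nat (card w)) (xmon \<alpha> w) :: 'a::field sup)"
proof -
  have "xmon 0 {i} \<star> der i (xmon \<alpha> w) = (if i \<in> w then xmon \<alpha> w else (0 :: 'a sup))" if i: "i \<in> Y1" for i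
  proof (cases "i \<in> w")
    case True
    have B: "{i} \<in> B" "w - {i} \<in> B" using i B_subset[OF assms(2)] by (auto simp: B_def)
    have "0 + \<alpha> = \<alpha>" by simp
    then have "xmon 0 {i} \<star> xmon \<alpha> (w - {i}) = (oscale (reord_sign {i} (w - {i})) (xmon \<alpha> w) :: 'a sup)"
      using omult_xmon_xmon[OF zero_in_A(1) B(1) assms(1) B(2), where 'a = 'a]
        xmon_mult_eq[of 0 \<alpha> \<alpha> "{i}" "w - {i}", where 'a = 'a] assms(1) True by (simp add: insert_absorb)
    then show ?thesis using True der_xmon1[OF assms i, where 'a = 'a] by (simp add: omult_scale_right reord_sign_sq)
  qed (use der_xmon1[OF assms i, where 'a = 'a] in simp)
  then have "(\<Sum>i\<in>Y1. xmon 0 {i} \<star> der i (xmon \<alpha> w)) = (\<Sum>i\<in>Y1. if i \<in> w then xmon \<alpha> w else (0 :: 'a sup))"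
    by (intro sum.cong) auto
  also have "\<dots> = (\<Sum>i\<in>w. xmon \<alpha> w)"
    using assms(2) sum.inter_restrict[of Y1 "\<lambda>_. xmon \<alpha> w :: 'a sup" w] by (simp add: B_def Int_absorb1)
  also have "\<dots> = oscale (of_nat (card w)) (xmon \<alpha> w)"
    by (simp add: fun_eq_iff sum_fun_apply)
  finally show ?thesis .
qed

text \<open>The operator \<Gamma>' weighs x_j by 1 and \<partial>_j by -1 for odd j. An odd
  component has exterior degree |u| - 1 and loses one more through \<partial>_j.\<close>

lemma ad_\<Gamma>':
  assumes "\<alpha> \<in> A" "u \<in> B0"
  shows "bracket \<Gamma>' (D\<^sub>H (xmon \<alpha> u)) j =
    (oscale (of_nat (card u) - (if j \<in> Y1 then 2 else 0)) (D\<^sub>H (xmon \<alpha> u) j) :: 'a::field sup)"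
proof -
  let ?x = "D\<^sub>H (xmon \<alpha> u) :: 'a witt"
  have x: "?x \<in> W_even" by (intro D\<^sub>H_W_even O_par_xmon_B0 assms)
  have uB: "u \<in> B" "u - {j} \<in> B" using B0_B[OF assms(2)] by (auto intro: B_subset)
  have sum1: "(\<Sum>i\<in>Y. \<Gamma>' i \<star> der i (?x j)) = (\<Sum>i\<in>Y1. xmon 0 {i} \<star> der i (?x j))"
    unfolding sum_Y by (simp add: \<Gamma>'_apply Y_disjoint)
  show ?thesis
  proof (cases "j \<in> Y")
    case True
    then consider "j \<in> Y0" | "j \<in> Y1" by (auto simp: Y_cases)
    then show ?thesis
    proof cases
      case 1
      have "(\<Sum>i\<in>Y1. xmon 0 {i} \<star> der i (?x j)) = oscale (of_nat (card u)) (?x j)"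
      proof (cases "\<alpha> (prm j) = 0")
        case False
        then have "?x j = oscale (\<tau> (prm j)) (xmon (\<alpha>(prm j := \<alpha> (prm j) - 1)) u)"
          using 1 by (simp add: D\<^sub>H_xmon[OF assms])
        then show ?thesis using euler_odd[OF A_upd_dec[OF assms(1), of "prm j"] uB(1), where 'a = 'a]
          by (simp add: der_oscale omult_scale_right mult.commute flip: ovec.scale_sum_right del: fun_upd_apply)
      next
        case z: True
        have "?x j = 0" using 1 z Y_disjoint(1)[OF 1] by (simp add: D\<^sub>H_xmon[OF assms])
        then show ?thesis by simp
      qed
      then show ?thesis unfolding bracket_even[OF \<Gamma>'_W_even x] sum_subtractf sum1
        using True 1 by (simp add: \<Gamma>'_apply Y_disjoint)
    next
      case 2
      have j0: "j \<notin> Y0" using Y_disjoint 2 by blast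
      have "(\<Sum>i\<in>Y1. xmon 0 {i} \<star> der i (?x j)) = oscale (of_nat (card u) - 1) (?x j)"
      proof (cases "j \<in> u")
        case ju: True
        then have xj: "?x j = oscale (reord_sign {j} (u - {j})) (xmon \<alpha> (u - {j}))"
          using 2 j0 by (simp add: D\<^sub>H_xmon[OF assms])
        have "of_nat (card (u - {j})) = (of_nat (card u) - 1 :: 'a)"
          using card_Suc_Diff1[OF B_finite[OF uB(1)] ju] by (metis add_diff_cancel_left' of_nat_Suc)
        then show ?thesis using euler_odd[OF assms(1) uB(2), where 'a = 'a] unfolding xj
          by (simp add: der_oscale omult_scale_right mult.commute flip: ovec.scale_sum_right)
      next
        case False
        then have "?x j = 0" using j0 by (simp add: D\<^sub>H_xmon[OF assms])
        then show ?thesis by simp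
      qed
      moreover have "(\<Sum>i\<in>Y. ?x i \<star> der i (\<Gamma>' j)) = ?x j"
      proof -
        have jB: "{j} \<in> B" using 2 by (simp add: B_def)
        have "?x i \<star> der i (\<Gamma>' j) = (if i = j then ?x j else 0)" if "i \<in> Y" for i
        proof (cases "i = j")
          case True
          have "der j (\<Gamma>' j) = (xmon 0 {} :: 'a sup)"
            using 2 jB der_xmon1[OF zero_in_A(1) jB 2, where 'a = 'a] by (simp add: \<Gamma>'_apply)
          moreover have "?x j \<star> xmon 0 {} = ?x j"
            using omult_xmon_right[OF W_even_O_par[OF x \<open>j \<in> Y\<close>] zero_in_A(1) empty_in_B]
              unit_omult(1)[OF W_even_O_set[OF x]] by simp
          ultimately show ?thesis using True by simp
        next
          case False
          then have "der i (\<Gamma>' j) = (0 :: 'a sup)"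
            using that 2 jB der_xmon0[OF zero_in_A(1) jB, of i, where 'a = 'a]
              der_xmon1[OF zero_in_A(1) jB, of i, where 'a = 'a] by (auto simp: \<Gamma>'_apply Y_cases)
          then show ?thesis using False by simp
        qed
        then have "(\<Sum>i\<in>Y. ?x i \<star> der i (\<Gamma>' j)) = (\<Sum>i\<in>Y. if i = j then ?x j else 0)"
          by (intro sum.cong) auto
        then show ?thesis using True by simp
      qed
      ultimately show ?thesis unfolding bracket_even[OF \<Gamma>'_W_even x] sum_subtractf sum1
        using True 2 by (simp add: fun_eq_iff algebra_simps)
    qed
  next
    case False
    then have "j \<notin> Y1" "j \<notin> Y0" by (auto simp: Y_def)
    then show ?thesis using False by (simp add: bracket_even[OF \<Gamma>'_W_even x] D\<^sub>H_xmon[OF assms])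
  qed
qed

text \<open>The constant part of \<open>D\<^sub>H (x\<^sup>(\<^sup>\<beta>\<^sup>) x\<^sup>u)\<close>.\<close>

definition hc :: "(nat \<Rightarrow> nat) \<Rightarrow> nat set \<Rightarrow> nat \<Rightarrow> nat set \<Rightarrow> 'a::field"
  where "hc \<beta> u j v = (if j \<in> Y0 \<and> \<beta> = eps (prm j) \<and> v = u then \<tau> (prm j)
     else if j \<in> Y1 \<and> j \<in> u \<and> \<beta> = 0 \<and> v = u - {j} then reord_sign {j} (u - {j}) else 0)"

lemma le_minus_eq: "\<delta> \<le> \<beta> \<and> \<beta> - \<delta> = x \<longleftrightarrow> \<beta> = \<delta> + x" for \<delta> \<beta> x :: "nat \<Rightarrow> nat"
proof
  assume *: "\<delta> \<le> \<beta> \<and> \<beta> - \<delta> = x"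
  have "\<beta> i = \<delta> i + x i" for i using * le_funD[of \<delta> \<beta> i] fun_cong[of "\<beta> - \<delta>" x i] by auto
  then show "\<beta> = \<delta> + x" by (simp add: fun_eq_iff)
qed (auto simp: le_fun_def fun_eq_iff)

lemma D\<^sub>H_xmon_coeff:
  assumes "\<alpha> \<in> A" "u \<in> B0"
  shows "D\<^sub>H (xmon \<alpha> u) j (\<gamma>, v) = (if \<gamma> \<le> \<alpha> then hc (\<alpha> - \<gamma>) u j v else (0 :: 'a::field))"
proof -
  have e1: "\<alpha> i \<noteq> 0 \<and> \<gamma> = \<alpha>(i := \<alpha> i - 1) \<longleftrightarrow> \<gamma> \<le> \<alpha> \<and> \<alpha> - \<gamma> = eps i" for i
    unfolding le_minus_eq by (auto simp: fun_eq_iff)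
  have e2: "\<gamma> = \<alpha> \<longleftrightarrow> \<gamma> \<le> \<alpha> \<and> \<alpha> - \<gamma> = 0"
    by (auto simp: le_fun_def fun_eq_iff antisym)
  have x: "xmon \<beta> w (\<gamma>, v) = (if \<gamma> = \<beta> \<and> v = w then 1 else (0 :: 'a))" for \<beta> w by (auto simp: xmon_def)
  consider "j \<in> Y0" | "j \<in> Y1" | "j \<notin> Y0" "j \<notin> Y1" by blast
  then show ?thesis
  proof cases
    case 1
    then show ?thesis using Y_disjoint(1)[OF 1] e1[of "prm j"] by (auto simp: D\<^sub>H_xmon[OF assms] hc_def x)
  next
    case 2
    then show ?thesis using Y_disjoint(2)[OF 2] e2 by (auto simp: D\<^sub>H_xmon[OF assms] hc_def x)
  next
    case 3
    then show ?thesis by (simp add: D\<^sub>H_xmon[OF assms] hc_def)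
  qed
qed

lemma D\<^sub>H_der_pow_coeff:
  assumes "\<alpha> \<in> A" "u \<in> B0" "i \<in> Y0"
  shows "D\<^sub>H ((der i ^^ k) (xmon \<alpha> u)) j (\<gamma>, v) =
    (if \<gamma> \<le> \<alpha> \<and> ee i k \<le> \<alpha> - \<gamma> then hc (\<alpha> - \<gamma> - ee i k) u j v else (0 :: 'a::field))"
proof (cases "k \<le> \<alpha> i")
  case True
  have A: "\<alpha>(i := \<alpha> i - k) \<in> A" using assms(1) by (rule A_down) (auto simp: le_fun_def)
  have "\<gamma> x \<le> (\<alpha>(i := \<alpha> i - k)) x \<longleftrightarrow> \<gamma> x \<le> \<alpha> x \<and> ee i k x \<le> (\<alpha> - \<gamma>) x" for x
    using True by auto
  then have 1: "\<gamma> \<le> \<alpha>(i := \<alpha> i - k) \<longleftrightarrow> \<gamma> \<le> \<alpha> \<and> ee i k \<le> \<alpha> - \<gamma>" unfolding le_fun_def by blast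
  have 2: "\<alpha>(i := \<alpha> i - k) - \<gamma> = \<alpha> - \<gamma> - ee i k" by (simp add: fun_eq_iff)
  show ?thesis unfolding der_pow_xmon[OF assms(1) B0_B[OF assms(2)] assms(3)] using True
    by (simp add: D\<^sub>H_xmon_coeff[OF A assms(2)] 1 2 del: fun_upd_apply)
next
  case False
  have "\<not> ee i k \<le> \<alpha> - \<gamma>"
  proof
    assume "ee i k \<le> \<alpha> - \<gamma>"
    from le_funD[OF this, of i] show False using False by simp
  qed
  then show ?thesis using False unfolding der_pow_xmon[OF assms(1) B0_B[OF assms(2)] assms(3)] by simp
qed

lemma hc_shift:
  "(if \<delta> \<le> \<beta> then hc (\<beta> - \<delta>) u j v else 0) = (if j \<in> Y0 \<and> \<beta> = \<delta> + eps (prm j) \<and> v = u then \<tau> (prm j)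
     else if j \<in> Y1 \<and> j \<in> u \<and> \<beta> = \<delta> \<and> v = u - {j} then reord_sign {j} (u - {j}) else (0 :: 'a::field))"
proof -
  have "\<delta> \<le> \<beta> \<and> \<beta> - \<delta> = eps (prm j) \<longleftrightarrow> \<beta> = \<delta> + eps (prm j)" "\<delta> \<le> \<beta> \<and> \<beta> - \<delta> = 0 \<longleftrightarrow> \<beta> = \<delta>"
    unfolding le_minus_eq by auto
  then show ?thesis unfolding hc_def by auto
qed

lemma \<omega>_B0: "even n \<Longrightarrow> \<omega> \<in> B0"
  by (simp add: B0_def \<omega>_def B_def Y1_def)

lemma x\<omega>_eq: "x\<omega> = xmon 0 \<omega>"
  by (simp add: x\<omega>_def zero_fun_def)

lemma x\<omega>_omult:
  assumes "f \<in> O_set"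
  shows "(x\<omega> \<star> f) (\<gamma>, v) = (if v = \<omega> then f (\<gamma>, {}) else (0 :: 'a::field))"
proof -
  have "v = \<omega>" if "v \<in> B" "\<omega> \<subseteq> v" using that by (auto simp: B_def \<omega>_def)
  then show ?thesis unfolding x\<omega>_eq using assms
    by (auto simp: xmon_omult_apply O_set_iff)
qed

end

context ham_field
begin

text \<open>Multiplication by x^\<omega> keeps only coefficients at the empty exterior index. Odd
  components have none, since \<open>u - {j}\<close> is nonempty for |u| even.\<close>

lemma \<Theta>_coeff:
  assumes "\<alpha> \<in> A" "u \<in> B0" "i \<in> Y0"
  shows "wmod x\<omega> (D\<^sub>H ((der i ^^ k) (xmon \<alpha> u))) j (\<gamma>, v) =
    (if \<gamma> \<le> \<alpha> \<and> j \<in> Y0 \<and> u = {} \<and> v = \<omega> \<and> \<alpha> - \<gamma> = ee i k + eps (prm j) then \<tau> (prm j) else (0 :: 'a))"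
proof -
  have O: "(der i ^^ k) (xmon \<alpha> u :: 'a sup) \<in> O_par 0"
    using ad_pd_pow[OF O_par_xmon_B0[OF assms(1,2)] assms(3)] by blast
  have "u - {j} \<noteq> {}" if "j \<in> u"
  proof
    assume "u - {j} = {}"
    then have "u = {j}" using that by auto
    then show False using assms(2) by (simp add: B0_def)
  qed
  then show ?thesis
    using hc_shift[of "ee i k" "\<alpha> - \<gamma>" u j "{}", where 'a = 'a]
    unfolding wmod_def x\<omega>_omult[OF W_even_O_set[OF D\<^sub>H_W_even[OF O]]] D\<^sub>H_der_pow_coeff[OF assms]
    by (auto split: if_splits)
qed

text \<open>x^u times x^(\<omega> - {j}) is nonzero only if \<open>u\<close> is contained in {j},
  hence empty as |u| is even.\<close>

lemma \<Phi>_coeff: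
  assumes "\<alpha> \<in> A" "u \<in> B0" "i \<in> Y0" "even n"
  shows "wmod ((der i ^^ k) (xmon \<alpha> u)) (D\<^sub>H x\<omega>) j (\<gamma>, v) =
    (if \<gamma> \<le> \<alpha> \<and> j \<in> Y1 \<and> u = {} \<and> v = \<omega> - {j} \<and> \<alpha> - \<gamma> = ee i k then reord_sign {j} (\<omega> - {j}) else (0 :: 'a))"
proof -
  let ?\<alpha> = "\<alpha>(i := \<alpha> i - k)"
  have A: "?\<alpha> \<in> A" using assms(1) by (rule A_down) (auto simp: le_fun_def)
  have uB: "u \<in> B" by (rule B0_B[OF assms(2)])
  have D: "D\<^sub>H x\<omega> j = (if j \<in> Y1 then oscale (reord_sign {j} (\<omega> - {j})) (xmon 0 (\<omega> - {j})) else (0 :: 'a sup))"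
  proof -
    have "j \<in> \<omega> \<longleftrightarrow> j \<in> Y1" by (simp add: \<omega>_def)
    then show ?thesis unfolding x\<omega>_eq by (auto simp: D\<^sub>H_xmon[OF zero_in_A(1) \<omega>_B0[OF assms(4)]])
  qed
  have w: "\<omega> - {j} \<in> B" by (auto simp: \<omega>_def B_def)
  have u0: "u = {}" if "u \<inter> (\<omega> - {j}) = {}"
  proof (rule ccontr)
    assume ne: "u \<noteq> {}"
    have "u \<subseteq> {j}" using that uB by (auto simp: \<omega>_def B_def)
    then have "u = {j}" using ne by auto
    then show False using assms(2) by (simp add: B0_def)
  qed
  have bin: "bin \<beta> \<beta> = 1" for \<beta> by (simp add: bin_def)
  have eq: "k \<le> \<alpha> i \<and> \<gamma> = ?\<alpha> \<longleftrightarrow> \<gamma> \<le> \<alpha> \<and> \<alpha> - \<gamma> = ee i k"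
  proof
    assume "k \<le> \<alpha> i \<and> \<gamma> = ?\<alpha>"
    then show "\<gamma> \<le> \<alpha> \<and> \<alpha> - \<gamma> = ee i k" by (auto simp: le_fun_def fun_eq_iff)
  next
    assume "\<gamma> \<le> \<alpha> \<and> \<alpha> - \<gamma> = ee i k"
    then have *: "\<alpha> = \<gamma> + ee i k" using le_minus_eq by blast
    show "k \<le> \<alpha> i \<and> \<gamma> = ?\<alpha>" unfolding * by (auto simp: fun_eq_iff)
  qed
  have "wmod ((der i ^^ k) (xmon \<alpha> u)) (D\<^sub>H x\<omega>) j (\<gamma>, v) =
      (if k \<le> \<alpha> i \<and> j \<in> Y1 then reord_sign {j} (\<omega> - {j}) * xmon_mult ?\<alpha> u 0 (\<omega> - {j}) (\<gamma>, v) else (0 :: 'a))"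
    unfolding wmod_def D der_pow_xmon[OF assms(1) uB assms(3)]
    using omult_xmon_xmon[OF A uB zero_in_A(1) w, where 'a = 'a] by (simp add: omult_scale_right)
  also have "\<dots> = (if (k \<le> \<alpha> i \<and> \<gamma> = ?\<alpha>) \<and> j \<in> Y1 \<and> u = {} \<and> v = \<omega> - {j} then reord_sign {j} (\<omega> - {j}) else (0 :: 'a))"
    unfolding xmon_mult_apply using u0 A by (auto simp: bin simp del: fun_upd_apply)
  finally show ?thesis unfolding eq by (simp add: conj_ac)
qed

end

section \<open>Assembling the formula for the derivation\<close>

context ham_der
begin

abbreviation \<delta>\<delta> :: "nat \<Rightarrow> nat \<Rightarrow> nat \<Rightarrow> nat" where "\<delta>\<delta> r s \<equiv> ee r (p ^ s)"

text \<open>The claimed right side as a function of the preimage \<open>f\<close> instead of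
  \<open>D\<^sub>H f\<close>. It is linear in \<open>f\<close>, and the choice of a preimage in
  \<open>\<Phi>\<close> is postponed to \<open>\<phi>_formula\<close>.\<close>

definition rhs :: "'a sup \<Rightarrow> 'a witt"
  where "rhs f = wscale lam0 (bracket \<Gamma>' (D\<^sub>H f)) + (\<Sum>r\<in>Y0. \<Sum>s=1..<t r.
      wscale (lamf (\<delta>\<delta> r s)) (wmod ((der r ^^ (p ^ s)) f) (D\<^sub>H x\<omega>))
    + wscale (ef (\<delta>\<delta> r s) {} \<omega>) (wmod x\<omega> (D\<^sub>H ((der r ^^ (p ^ s)) f)))
    + wscale (ef (\<delta>\<delta> r s) {} {}) (D\<^sub>H ((der r ^^ (p ^ s)) f)))"

lemma rhs_linear:
  assumes "f \<in> O_par 0" "g \<in> O_par 0"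
  shows "rhs (oscale c f + g) = wscale c (rhs f) + rhs g"
proof -
  have 1: "bracket \<Gamma>' (wscale c (D\<^sub>H f) + D\<^sub>H g) = wscale c (bracket \<Gamma>' (D\<^sub>H f)) + bracket \<Gamma>' (D\<^sub>H g)"
    by (intro bracket_linear \<Gamma>'_W_even D\<^sub>H_W_even assms)
  have w: "wmod (oscale c a + b) D = wscale c (wmod a D) + wmod b D"
    "wmod a (wscale c D + E) = wscale c (wmod a D) + wmod a E" for a b and D E :: "'a witt"
    by (auto simp: wmod_def fun_eq_iff omult_add_left omult_add_right omult_scale_left omult_scale_right)
  have 2: "wscale a (wscale c X + Y) = wscale c (wscale a X) + wscale a Y" for a and X Y :: "'a witt"
    by (simp add: wvec.scale_right_distrib mult.commute)
  show ?thesis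
    unfolding rhs_def 1 der_pow_add der_pow_oscale D\<^sub>H_add D\<^sub>H_oscale w 2
    by (simp add: wvec.scale_right_distrib wvec.scale_sum_right sum.distrib add_ac)
qed

lemma \<delta>\<delta>_Dp: "r \<in> Y0 \<Longrightarrow> s \<in> {1..<t r} \<Longrightarrow> \<delta>\<delta> r s \<in> Dp"
  by (auto simp: Dp_def)

lemma \<delta>\<delta>_inject: "\<delta>\<delta> r s = \<delta>\<delta> r' s' \<longleftrightarrow> r = r' \<and> s = s'"
  using ee_inject[of "p ^ s" r r' "p ^ s'"] p3 by (auto simp: power_inject_exp)

lemma \<delta>\<delta>_nonzero: "\<delta>\<delta> r s \<noteq> 0"
proof
  assume "\<delta>\<delta> r s = 0"
  from fun_cong[OF this, of r] show False using p3 by simp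
qed

text \<open>The exponents 0 and p^s \<epsilon>_r are pairwise distinct, so at most one condition on
  the right holds; by \<open>cc_cases\<close> one does whenever the coefficient is nonzero.\<close>

lemma cc_expansion:
  assumes "idx \<beta> u"
  shows "cc \<beta> u j v =
    (if (j \<in> Y1 \<and> \<beta> = 0) \<or> (j \<in> Y0 \<and> \<beta> = eps (prm j)) then cc \<beta> u j v else 0)
    + (\<Sum>r\<in>Y0. \<Sum>s=1..<t r. if (j \<in> Y1 \<and> \<beta> = \<delta>\<delta> r s) \<or> (j \<in> Y0 \<and> \<beta> = \<delta>\<delta> r s + eps (prm j))
        then cc \<beta> u j v else 0)" (is "_ = ?Z + (\<Sum>r\<in>Y0. \<Sum>s=1..<t r. ?T r s)")
proof (cases "cc \<beta> u j v = 0")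
  case False
  from cc_cases[OF assms this] obtain \<delta> where \<delta>: "\<delta> \<in> insert 0 Dp"
    "(\<beta> = \<delta> \<and> j \<in> Y1) \<or> (\<exists>l\<in>Y0. \<beta> = \<delta> + eps l \<and> j = prm l)" by blast
  have shape: "(j \<in> Y1 \<and> \<beta> = \<delta>) \<or> (j \<in> Y0 \<and> \<beta> = \<delta> + eps (prm j))"
    using \<delta>(2) prm_simps by (auto simp: Y_cases)
  have uniq: "(j \<in> Y1 \<and> \<beta> = \<epsilon>) \<or> (j \<in> Y0 \<and> \<beta> = \<epsilon> + eps (prm j)) \<longleftrightarrow> \<epsilon> = \<delta>" for \<epsilon>
    using shape Y_disjoint[of j] by auto
  have Z: "?Z = (if \<delta> = 0 then cc \<beta> u j v else 0)" using uniq[of 0] by auto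
  have T: "?T r s = (if \<delta> = \<delta>\<delta> r s then cc \<beta> u j v else 0)" for r s
    using uniq[of "\<delta>\<delta> r s"] by auto
  show ?thesis
  proof (cases "\<delta> = 0")
    case True
    then have "?T r s = 0" for r s unfolding T using \<delta>\<delta>_nonzero[of r s] by auto
    then show ?thesis unfolding Z using True by simp
  next
    case nz: False
    then obtain r0 s0 where rs: "\<delta> = \<delta>\<delta> r0 s0" "r0 \<in> Y0" "1 \<le> s0" "s0 < t r0" using \<delta>(1) by (auto simp: Dp_def)
    have "(\<Sum>r\<in>Y0. \<Sum>s=1..<t r. ?T r s) =
        (\<Sum>r\<in>Y0. if r = r0 then \<Sum>s=1..<t r0. if s = s0 then cc \<beta> u j v else 0 else 0)"
      unfolding T rs(1) \<delta>\<delta>_inject by (rule sum.cong) (auto intro!: sum.cong)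
    also have "\<dots> = cc \<beta> u j v" using rs by simp
    finally show ?thesis unfolding Z using nz by simp
  qed
next
  case True
  show ?thesis unfolding True by simp
qed

lemma idx_mono:
  assumes "idx \<alpha> u" "\<beta> \<le> \<alpha>"
  shows "idx \<beta> u"
proof -
  have "\<beta> \<in> A" using A_down[OF idxD(1)[OF assms(1)] assms(2)] .
  moreover have "\<alpha> = \<pi>" if "\<beta> = \<pi>"
    using that assms(2) idx_le[OF assms(1)] by (auto simp: le_fun_def fun_eq_iff antisym)
  ultimately show ?thesis using assms(1) by (auto simp: idx_def)
qed

lemma order_zero_coeff:
  assumes "idx \<alpha> u"
  shows "lam0 * ((of_nat (card u) - (if j \<in> Y1 then 2 else 0)) * D\<^sub>H (xmon \<alpha> u) j (\<gamma>, v)) =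
    (if \<gamma> \<le> \<alpha> then if (j \<in> Y1 \<and> \<alpha> - \<gamma> = 0) \<or> (j \<in> Y0 \<and> \<alpha> - \<gamma> = eps (prm j))
       then cc (\<alpha> - \<gamma>) u j v else 0 else 0)"
proof -
  note \<alpha> = idxD(1)[OF assms] and u = idxD(2)[OF assms]
  consider "j \<in> Y1" | "j \<in> Y0" | "j \<notin> Y0" "j \<notin> Y1" by blast
  then show ?thesis
  proof cases
    case 1
    then have "j \<notin> Y0" using Y_disjoint by blast
    then show ?thesis using 1 zero_g[OF u, of j v] by (simp add: D\<^sub>H_xmon_coeff[OF \<alpha> u] hc_def)
  next
    case 2
    have j: "prm j \<in> Y0" "prm (prm j) = j" "j \<notin> Y1" using 2 prm_simps Y_disjoint by (auto simp: Y_cases)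
    have "cc (eps (prm j)) u j v = \<tau> (prm j) * ef 0 u v" using cc_eps[OF u j(1)] j(2) by simp
    then show ?thesis using 2 j zero_e[OF u, of v] by (simp add: D\<^sub>H_xmon_coeff[OF \<alpha> u] hc_def)
  next
    case 3
    then show ?thesis by (simp add: D\<^sub>H_xmon_coeff[OF \<alpha> u] hc_def)
  qed
qed

lemma order_pos_coeff:
  assumes "idx \<alpha> u" "r \<in> Y0" "s \<in> {1..<t r}"
  shows "lamf (\<delta>\<delta> r s) * wmod ((der r ^^ (p ^ s)) (xmon \<alpha> u)) (D\<^sub>H x\<omega>) j (\<gamma>, v)
      + ef (\<delta>\<delta> r s) {} \<omega> * wmod x\<omega> (D\<^sub>H ((der r ^^ (p ^ s)) (xmon \<alpha> u))) j (\<gamma>, v)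
      + ef (\<delta>\<delta> r s) {} {} * D\<^sub>H ((der r ^^ (p ^ s)) (xmon \<alpha> u)) j (\<gamma>, v) =
    (if \<gamma> \<le> \<alpha> then if (j \<in> Y1 \<and> \<alpha> - \<gamma> = \<delta>\<delta> r s) \<or> (j \<in> Y0 \<and> \<alpha> - \<gamma> = \<delta>\<delta> r s + eps (prm j))
       then cc (\<alpha> - \<gamma>) u j v else 0 else 0)"
proof -
  note \<alpha> = idxD(1)[OF assms(1)] and u = idxD(2)[OF assms(1)]
  let ?\<delta> = "\<delta>\<delta> r s" and ?\<beta> = "\<alpha> - \<gamma>"
  have \<delta>: "?\<delta> \<in> Dp" "?\<delta> \<in> insert 0 Dp" using \<delta>\<delta>_Dp assms(2,3) by auto
  have 1: "lamf ?\<delta> * wmod ((der r ^^ (p ^ s)) (xmon \<alpha> u)) (D\<^sub>H x\<omega>) j (\<gamma>, v) =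
    (if \<gamma> \<le> \<alpha> \<and> j \<in> Y1 \<and> u = {} \<and> v = \<omega> - {j} \<and> ?\<beta> = ?\<delta> then reord_sign {j} (\<omega> - {j}) * lamf ?\<delta> else 0)"
  proof (cases "even n")
    case True
    show ?thesis unfolding \<Phi>_coeff[OF \<alpha> u assms(2) True] by simp
  next
    case False
    \<comment> \<open>For odd n, x^\<omega> is odd and outside the scope of
      \<open>\<Phi>_coeff\<close>, but the scalar in front is 0.\<close>
    then show ?thesis using Dp_odd(2)[OF \<delta>(1)] by simp
  qed
  have 3: "D\<^sub>H ((der r ^^ (p ^ s)) (xmon \<alpha> u)) j (\<gamma>, v) =
    (if \<gamma> \<le> \<alpha> then if j \<in> Y0 \<and> ?\<beta> = ?\<delta> + eps (prm j) \<and> v = u then \<tau> (prm j)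
     else if j \<in> Y1 \<and> j \<in> u \<and> ?\<beta> = ?\<delta> \<and> v = u - {j} then reord_sign {j} (u - {j}) else 0 else (0 :: 'a))"
    unfolding D\<^sub>H_der_pow_coeff[OF \<alpha> u assms(2)] hc_shift[symmetric] by simp
  consider "j \<in> Y1" | "j \<in> Y0" | "j \<notin> Y0" "j \<notin> Y1" by blast
  then show ?thesis
  proof cases
    case j: 1
    then have "j \<notin> Y0" using Y_disjoint by blast
    then show ?thesis unfolding 1 3 \<Theta>_coeff[OF \<alpha> u assms(2)]
      using j Dp_g[OF \<delta>(1) u j, of v] by (cases "?\<beta> = ?\<delta>") simp_all
  next
    case 2
    have j: "prm j \<in> Y0" "prm (prm j) = j" "j \<notin> Y1" using 2 prm_simps Y_disjoint by (auto simp: Y_cases)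
    have "cc (?\<delta> + eps (prm j)) u j v = \<tau> (prm j) * ef ?\<delta> u v" using cc_ef[OF \<delta>(2) u j(1)] j(2) by simp
    then show ?thesis unfolding 1 3 \<Theta>_coeff[OF \<alpha> u assms(2)]
      using 2 j Dp_e[OF \<delta>(1) u, of v] \<omega>_nonempty
      by (cases "?\<beta> = ?\<delta> + eps (prm j)"; cases "u = {}") (auto simp: algebra_simps)
  next
    case j: 3
    then show ?thesis unfolding 1 3 \<Theta>_coeff[OF \<alpha> u assms(2)] by simp
  qed
qed

lemma rhs_xmon:
  assumes "idx \<alpha> u"
  shows "rhs (xmon \<alpha> u) = ps \<alpha> u"
proof -
  have "rhs (xmon \<alpha> u) j (\<gamma>, v) = ps \<alpha> u j (\<gamma>, v)" for j \<gamma> v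
  proof -
    let ?\<beta> = "\<alpha> - \<gamma>"
    have "rhs (xmon \<alpha> u) j (\<gamma>, v) = lam0 * ((of_nat (card u) - (if j \<in> Y1 then 2 else 0)) * D\<^sub>H (xmon \<alpha> u) j (\<gamma>, v))
      + (\<Sum>r\<in>Y0. \<Sum>s=1..<t r. lamf (\<delta>\<delta> r s) * wmod ((der r ^^ (p ^ s)) (xmon \<alpha> u)) (D\<^sub>H x\<omega>) j (\<gamma>, v)
      + ef (\<delta>\<delta> r s) {} \<omega> * wmod x\<omega> (D\<^sub>H ((der r ^^ (p ^ s)) (xmon \<alpha> u))) j (\<gamma>, v)
      + ef (\<delta>\<delta> r s) {} {} * D\<^sub>H ((der r ^^ (p ^ s)) (xmon \<alpha> u)) j (\<gamma>, v))"
      unfolding rhs_def by (simp add: sum_fun_apply ad_\<Gamma>'[OF idxD(1,2)[OF assms]])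
    also have "\<dots> = (if \<gamma> \<le> \<alpha> then if (j \<in> Y1 \<and> ?\<beta> = 0) \<or> (j \<in> Y0 \<and> ?\<beta> = eps (prm j)) then cc ?\<beta> u j v else 0 else 0)
      + (\<Sum>r\<in>Y0. \<Sum>s=1..<t r. if \<gamma> \<le> \<alpha> then if (j \<in> Y1 \<and> ?\<beta> = \<delta>\<delta> r s) \<or> (j \<in> Y0 \<and> ?\<beta> = \<delta>\<delta> r s + eps (prm j))
        then cc ?\<beta> u j v else 0 else 0)"
      unfolding order_zero_coeff[OF assms]
      by (intro arg_cong2[where f = "(+)"] refl sum.cong order_pos_coeff[OF assms])
    also have "\<dots> = (if \<gamma> \<le> \<alpha> then cc ?\<beta> u j v else 0)"
    proof (cases "\<gamma> \<le> \<alpha>")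
      case True
      have "idx ?\<beta> u" by (rule idx_mono[OF assms]) (simp add: le_fun_def)
      from cc_expansion[OF this, of j v] show ?thesis using True by simp
    qed simp
    also have "\<dots> = ps \<alpha> u j (\<gamma>, v)" unfolding ps_coeff[OF assms] ..
    finally show ?thesis .
  qed
  then show ?thesis by (auto simp: fun_eq_iff)
qed

lemma N_preimage:
  assumes "x \<in> N"
  shows "\<exists>f\<in>ovec.span N_monos. x = D\<^sub>H f"
  using assms unfolding N_def
proof (induction rule: wvec.span_induct_alt)
  case base
  have "0 = D\<^sub>H 0" by simp
  then show ?case using ovec.span_zero by blast
next
  case (step c x y)
  then obtain f g where "f \<in> N_monos" "x = D\<^sub>H f" "g \<in> ovec.span N_monos" "y = D\<^sub>H g" by blast
  then have "wscale c x + y = D\<^sub>H (oscale c f + g)" "oscale c f + g \<in> ovec.span N_monos"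
    using ovec.span_add[OF ovec.span_scale[OF ovec.span_base]] by (auto simp: D\<^sub>H_add D\<^sub>H_oscale)
  then show ?case by blast
qed

lemma \<phi>_rhs:
  assumes "f \<in> ovec.span N_monos"
  shows "f \<in> O_par 0 \<and> D\<^sub>H f \<in> N \<and> \<phi> (D\<^sub>H f) = rhs f"
  using assms
proof (induction rule: ovec.span_induct_alt)
  case base
  have "rhs 0 = 0" using rhs_linear[of 0 0 1] by simp
  then have "0 \<in> O_par 0 \<and> D\<^sub>H (0 :: 'a sup) \<in> N \<and> \<phi> (D\<^sub>H 0) = rhs 0" using N_closed(3) by simp
  then show ?case .
next
  case (step c f g)
  have g: "g \<in> O_par 0" "D\<^sub>H g \<in> N" "\<phi> (D\<^sub>H g) = rhs g" using step(2) by auto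
  from step(1) obtain \<alpha> u where f: "f = xmon \<alpha> u" "idx \<alpha> u" unfolding N_monos_def idx_def by blast
  have fO: "f \<in> O_par 0" unfolding f(1) by (intro O_par_xmon_B0 idxD[OF f(2)])
  have fN: "D\<^sub>H f \<in> N" unfolding f(1) by (rule D\<^sub>H_N[OF f(2)])
  have "\<phi> (D\<^sub>H f) = rhs f" using rhs_xmon[OF f(2)] unfolding f(1) ps_def by simp
  then have "\<phi> (D\<^sub>H (oscale c f + g)) = rhs (oscale c f + g)"
    unfolding D\<^sub>H_add D\<^sub>H_oscale rhs_linear[OF fO g(1)]
    using \<phi>_add[OF N_closed(1)[OF fN] g(2)] \<phi>_scale[OF fN] g(3) by simp
  moreover have "D\<^sub>H (oscale c f + g) \<in> N" unfolding D\<^sub>H_add D\<^sub>H_oscale using fN g(2) by (intro N_closed)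
  moreover have "oscale c f + g \<in> O_par 0" using fO g(1) by (intro O_par_add O_par_oscale)
  ultimately have "oscale c f + g \<in> O_par 0 \<and> D\<^sub>H (oscale c f + g) \<in> N \<and>
      \<phi> (D\<^sub>H (oscale c f + g)) = rhs (oscale c f + g)" by blast
  then show ?case .
qed

text \<open>A preimage in the span of \<open>N_monos\<close> lies in that of \<open>H_monos\<close>,
  where \<open>\<Phi>_D\<^sub>H\<close> allows it to replace the one chosen by
  \<open>\<Phi>\<close>.\<close>

lemma \<phi>_formula:
  assumes "x \<in> N"
  shows "\<phi> x = wscale lam0 (ad \<Gamma>' x) + (\<Sum>r\<in>Y0. \<Sum>s=1..<t r.
      wscale (lamf (\<delta>\<delta> r s)) (\<Phi> r s x) + wscale (ef (\<delta>\<delta> r s) {} \<omega>) (\<Theta> r s x)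
    + wscale (ef (\<delta>\<delta> r s) {} {}) ((ad (pd r) ^^ (p ^ s)) x))"
proof -
  obtain f where f: "f \<in> ovec.span N_monos" "x = D\<^sub>H f" using N_preimage[OF assms] by blast
  have fO: "f \<in> O_par 0" and eq: "\<phi> x = rhs f" using \<phi>_rhs[OF f(1)] f(2) by auto
  have "N_monos \<subseteq> H_monos" unfolding N_monos_def H_monos_def by blast
  then have fH: "f \<in> ovec.span H_monos" using f(1) ovec.span_mono by blast
  have "(ad (pd r) ^^ k) x = D\<^sub>H ((der r ^^ k) f)" if "r \<in> Y0" for r k
    unfolding f(2) using ad_pd_pow[OF fO that] by blast
  moreover have "\<Phi> r s x = wmod ((der r ^^ (p ^ s)) f) (D\<^sub>H x\<omega>)" if "r \<in> Y0" for r s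
    unfolding f(2) by (rule \<Phi>_D\<^sub>H) (use p3 that fH in auto)
  ultimately show ?thesis unfolding eq rhs_def \<Theta>_def ad_def f(2)[symmetric]
    by (intro arg_cong2[where f = "(+)"] refl sum.cong) simp_all
qed

lemma W_deg_O_deg:
  assumes "D \<in> W_deg k"
  shows "D j \<in> O_deg (k + 1)"
  using assms unfolding W_deg_def
proof (induction rule: wvec.span_induct_alt)
  case base
  have "(0 :: 'b witt) j \<in> O_deg (k + 1)" by (simp add: O_deg_iff)
  then show ?case .
next
  case (step c x y)
  have "x j \<in> O_deg (k + 1)" using step(1) by (auto simp: vf_def O_deg_zero)
  with step(2) have "(wscale c x + y) j \<in> O_deg (k + 1)" by (simp add: O_deg_iff)
  then show ?case .
qed

text \<open>Both factors are, up to the same sign, coefficients of the component 1' of \<phi> at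
  x^(\<delta>+\<epsilon>_1), namely at x^\<omega> and at 1. That component is homogeneous, and these
  monomials have degrees n and 0.\<close>

lemma ef_product:
  assumes "homogeneous_of_degree \<phi> k" "\<delta> \<in> Dp"
  shows "ef \<delta> {} \<omega> * ef \<delta> {} {} = 0"
proof -
  have \<delta>: "\<delta> \<in> insert 0 Dp" using assms(2) by simp
  note i = idx_Dl(2)[OF \<delta> B0_empty one_Y0(1)]
  let ?d = "int (sum (\<delta> + eps 1) Y0 + card ({} :: nat set)) - 2"
  have "D\<^sub>H (xmon (\<delta> + eps 1) {}) \<in> (N_deg ?d :: 'a witt set)"
    unfolding N_deg_def using D\<^sub>H_N[OF i] D\<^sub>H_xmon_W_deg[OF idxD(1,2)[OF i]] by (rule IntI)
  then have "ps (\<delta> + eps 1) {} \<in> W_even_deg (?d + k)"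
    using assms(1) unfolding homogeneous_of_degree_def ps_def by blast
  then have "ps (\<delta> + eps 1) {} (prm 1) \<in> O_deg (?d + k + 1)"
    unfolding W_even_deg_def by (intro W_deg_O_deg) blast
  moreover have "card \<omega> = n" by (simp add: \<omega>_def Y1_def)
  moreover have "int (sum (0 :: nat \<Rightarrow> nat) Y0 + card \<omega>) \<noteq> int (sum (0 :: nat \<Rightarrow> nat) Y0 + card ({} :: nat set))"
    using n3 \<open>card \<omega> = n\<close> by simp
  ultimately have "cc (\<delta> + eps 1) {} (prm 1) \<omega> = 0 \<or> cc (\<delta> + eps 1) {} (prm 1) {} = 0"
    unfolding O_deg_iff cc_def by metis
  then show ?thesis by (auto simp: ef_def)
qed

end

theorem theorem4p7:
  fixes p m n :: nat and t :: "nat \<Rightarrow> nat"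
    and \<phi> :: "'a::field witt \<Rightarrow> 'a witt"
  assumes "CHAR('a) = p" and "p > 3" and "m > 1" and "n > 3"
    and "\<forall>i\<in>ham.Y0 m. t i > 0"
    and "\<phi> \<in> ham.Der p m n t"
    and "\<exists>k. ham.homogeneous_of_degree p m n t \<phi> k"
    and "\<forall>x\<in>ham.N_deg p m n t (-1). \<forall>y\<in>ham.N_deg p m n t 0.
           \<phi> (x + y) = 0"
  shows "(\<exists>l (lam :: nat \<Rightarrow> nat \<Rightarrow> 'a) (mu :: nat \<Rightarrow> nat \<Rightarrow> 'a) (eta :: nat \<Rightarrow> nat \<Rightarrow> 'a).
            (\<forall>r\<in>ham.Y0 m. \<forall>s\<in>{1..<t r}. mu r s * eta r s = 0)
          \<and> (\<forall>x\<in>ham.N p m n t.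
               \<phi> x = wscale l (ham.ad p m n t (ham.\<Gamma>' m n) x)
                 + (\<Sum>r\<in>ham.Y0 m. \<Sum>s=1..<t r.
                      wscale (lam r s) (ham.\<Phi> p m n t r s x)
                    + wscale (mu r s) (ham.\<Theta> p m n t r s x)
                    + wscale (eta r s) ((ham.ad p m n t (ham.pd r) ^^ (p ^ s)) x))))
       \<and> (odd n \<longrightarrow> (\<exists>l (eta :: nat \<Rightarrow> nat \<Rightarrow> 'a).
            \<forall>x\<in>ham.N p m n t.
               \<phi> x = wscale l (ham.ad p m n t (ham.\<Gamma>' m n) x)
                 + (\<Sum>r\<in>ham.Y0 m. \<Sum>s=1..<t r.
                      wscale (eta r s) ((ham.ad p m n t (ham.pd r) ^^ (p ^ s)) x))))"
proof -
  interpret ham_der p m n t "TYPE('a)" \<phi>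
    by unfold_locales (use assms in auto)
  obtain k where k: "homogeneous_of_degree \<phi> k" using assms(7) by blast
  have "\<forall>r\<in>Y0. \<forall>s\<in>{1..<t r}. ef (\<delta>\<delta> r s) {} \<omega> * ef (\<delta>\<delta> r s) {} {} = 0"
    using ef_product[OF k \<delta>\<delta>_Dp] by blast
  moreover have "\<phi> x = wscale lam0 (ad \<Gamma>' x) + (\<Sum>r\<in>Y0. \<Sum>s=1..<t r.
      wscale (ef (\<delta>\<delta> r s) {} {}) ((ad (pd r) ^^ (p ^ s)) x))" if "odd n" "x \<in> N" for x
    unfolding \<phi>_formula[OF that(2)]
    by (intro arg_cong2[where f = "(+)"] refl sum.cong) (simp add: Dp_odd[OF \<delta>\<delta>_Dp that(1)])
  ultimately show ?thesis using \<phi>_formula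
    by (intro conjI impI exI[of _ lam0] exI[of _ "\<lambda>r s. lamf (\<delta>\<delta> r s)"]
        exI[of _ "\<lambda>r s. ef (\<delta>\<delta> r s) {} \<omega>"] exI[of _ "\<lambda>r s. ef (\<delta>\<delta> r s) {} {}"]) auto
qed

end
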